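(* Let $n\ge 2$ and $k\in\{1,\ldots,n-1\}$. Assume that $f\in C(k,n)$. Then $f$ can be recovered from its $k$-plane transform $\hat f$ by $$f=(4\pi)^{-\frac{k}{2}}\,\frac{\Gamma\left(\frac{n-k}{2}\right)}{\Gamma\left(\frac{n}{2}\right)}\,I^{-k}\big((\hat f)^{\vee}\big),$$ as an identity at every point of $\mathbb{R}^n$.
   Context: Functions are complex-valued. For $a>0$, $C_a(\mathbb{R}^n)$ is the set of continuous functions $f$ on $\mathbb{R}^n$ with $f(x)=O(|x|^{-a})$ as $|x|\to\infty$. $C(k,n)$ is the set of functions $f$ on $\mathbb{R}^n$ such that $f\in C_{k+\delta}(\mathbb{R}^n)$ for some $\delta>0$ and such that for each $x\in\mathbb{R}^n$ there exist a neighborhood $\mathcal{O}$ of $x$, an $\epsilon$ with $0<\epsilon<1$ and an $M>0$ with $|f(x_1)-f(x_2)|\le M|x_1-x_2|^{\epsilon}$ for all $x_1,x_2\in\mathcal{O}$. $k$-plane transform: $\hat f(\xi)=\int_{\xi} f(x)\,dm(x)$ for every $k$-dimensional affine subspace ($k$-plane) $\xi$ of $\mathbb{R}^n$, where $dm$ is Lebesgue (Euclidean) measure on $\xi$. Dual transform: for a continuous function $\varphi$ on the set of $k$-planes, $\varphi^{\vee}(x)=\int_{\xi\ni x}\varphi(\xi)\,d\mu(\xi)$, where $\mu$ is the probability measure on the set of $k$-planes through $x$ invariant under rotations about $x$. Riesz potentials: $H_n(\alpha)=2^{\alpha}\pi^{n/2}\Gamma(\alpha/2)/\Gamma((n-\alpha)/2)$.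 For $g\in C_b(\mathbb{R}^n)$ with $b>0$, $x\in\mathbb{R}^n$ and $\alpha\in\mathbb{C}\setminus\{n,n+2,n+4,\ldots\}$ with $0<\operatorname{Re}\alpha<b$, $$(I^{\alpha}g)(x)=\frac{1}{H_n(\alpha)}\int_{\mathbb{R}^n}g(y)|x-y|^{\alpha-n}\,dy .$$ For $\operatorname{Re}\alpha\le 0$, $(I^{\alpha}g)(x)$ denotes the value at $\alpha$ of the analytic continuation of the map $\alpha\mapsto(I^{\alpha}g)(x)$ from $\{0<\operatorname{Re}\alpha<b\}$ to a larger strip $\{c<\operatorname{Re}\alpha<b\}$, $c<0$. If, in a neighborhood of $x$, $g$ is $C^l$ with all order-$l$ derivatives Hölder continuous of index $\epsilon\in(0,1)$, then this (meromorphic) continuation exists on $\{-l-\epsilon<\operatorname{Re}\alpha<b\}$, with poles only in $\{n,n+2,\ldots\}$. Here $I^{-k}$ is taken in this sense. *)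

theory Defs
  imports "HOL-Analysis.Analysis" "HOL-Complex_Analysis.Complex_Analysis"
    "HOL-Probability.Probability" "HOL-Library.Landau_Symbols"
begin

text \<open>Throughout, the dimension \<open>n\<close> of the ambient space is \<open>CARD('n)\<close>.\<close>

definition C_decay :: "real \<Rightarrow> (real ^ 'n \<Rightarrow> complex) set" where
  "C_decay a = {f. continuous_on UNIV f \<and>
     (\<lambda>x. norm (f x)) \<in> O[at_infinity](\<lambda>x. norm x powr (- a))}"

definition locally_Hoelder :: "(real ^ 'n \<Rightarrow> complex) \<Rightarrow> bool" where
  "locally_Hoelder f \<longleftrightarrow>
     (\<forall>x. \<exists>U \<epsilon> M. open U \<and> x \<in> U \<and> 0 < \<epsilon> \<and> \<epsilon> < 1 \<and> 0 < M \<and>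
        (\<forall>x1\<in>U. \<forall>x2\<in>U. norm (f x1 - f x2) \<le> M * norm (x1 - x2) powr \<epsilon>))"

definition C_kn :: "nat \<Rightarrow> (real ^ 'n \<Rightarrow> complex) set" where
  "C_kn k = {f. (\<exists>\<delta>>0. f \<in> C_decay (real k + \<delta>)) \<and> locally_Hoelder f}"

text \<open>Lebesgue measure on an affine subspace \<open>\<xi>\<close>: the image of product Lebesgue measure under the
  coordinates given by a base point \<open>p\<close> and an orthonormal basis \<open>B\<close> of the direction space (this
  is how \<open>lborel\<close> itself is defined, with \<open>p = 0\<close> and \<open>B = Basis\<close>). All choices of \<open>p\<close> and \<open>B\<close>
  yield the same measure, so the choice operator is harmless.\<close>

definition plane_lborel :: "(real ^ 'n) set \<Rightarrow> (real ^ 'n) measure" where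
  "plane_lborel \<xi> = (SOME m. \<exists>p B. p \<in> \<xi> \<and>
     pairwise orthogonal B \<and> (\<forall>b\<in>B. norm b = 1) \<and> span B = (\<lambda>y. y - p) ` \<xi> \<and>
     m = distr (\<Pi>\<^sub>M b\<in>B. lborel) borel (\<lambda>t. p + (\<Sum>b\<in>B. t b *\<^sub>R b)))"

definition plane_transform :: "(real ^ 'n \<Rightarrow> complex) \<Rightarrow> (real ^ 'n) set \<Rightarrow> complex" where
  "plane_transform f \<xi> = (\<integral>y. f y \<partial>plane_lborel \<xi>)"

definition planes_through :: "nat \<Rightarrow> real ^ 'n \<Rightarrow> (real ^ 'n) set set" where
  "planes_through k x = {\<xi>. affine \<xi> \<and> aff_dim \<xi> = int k \<and> x \<in> \<xi>}"

text \<open>The Borel sigma-algebra of the usual (Grassmannian) topology on the \<open>k\<close>-planes through \<open>x\<close>.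
  That topology identifies a plane with its orthogonal projection \<open>closest_point \<xi>\<close>; as it is second
  countable, its Borel sets are generated by the evaluations \<open>\<xi> \<mapsto> closest_point \<xi> y\<close>.\<close>

definition planes_borel :: "nat \<Rightarrow> real ^ 'n \<Rightarrow> (real ^ 'n) set measure" where
  "planes_borel k x = vimage_algebra (planes_through k x) closest_point (\<Pi>\<^sub>M y\<in>UNIV. borel)"

definition rotation_about :: "real ^ 'n \<Rightarrow> real ^ 'n ^ 'n \<Rightarrow> real ^ 'n \<Rightarrow> real ^ 'n" where
  "rotation_about x R y = x + R *v (y - x)"

definition invariant_prob_on_planes :: "nat \<Rightarrow> real ^ 'n \<Rightarrow> (real ^ 'n) set measure \<Rightarrow> bool" where
  "invariant_prob_on_planes k x \<mu> \<longleftrightarrow>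
     sets \<mu> = sets (planes_borel k x) \<and> prob_space \<mu> \<and>
     (\<forall>R. rotation_matrix R \<longrightarrow> distr \<mu> \<mu> (\<lambda>\<xi>. rotation_about x R ` \<xi>) = \<mu>)"

text \<open>For \<open>0 < k < n\<close> the rotations about \<open>x\<close> act transitively on the \<open>k\<close>-planes through \<open>x\<close>,
  so the invariant probability measure exists and is unique.\<close>

definition planes_measure :: "nat \<Rightarrow> real ^ 'n \<Rightarrow> (real ^ 'n) set measure" where
  "planes_measure k x = (SOME \<mu>. invariant_prob_on_planes k x \<mu>)"

definition dual_transform :: "nat \<Rightarrow> ((real ^ 'n) set \<Rightarrow> complex) \<Rightarrow> real ^ 'n \<Rightarrow> complex" where
  "dual_transform k \<phi> x = (\<integral>\<xi>. \<phi> \<xi> \<partial>planes_measure k x)"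

definition riesz_const :: "nat \<Rightarrow> complex \<Rightarrow> complex" where
  "riesz_const n \<alpha> =
     2 powr \<alpha> * of_real (pi powr (real n / 2)) * Gamma (\<alpha> / 2) / Gamma ((of_nat n - \<alpha>) / 2)"

definition riesz_poles :: "nat \<Rightarrow> complex set" where
  "riesz_poles n = {of_nat (n + 2 * j) | j. True}"

definition riesz_integral :: "complex \<Rightarrow> (real ^ 'n \<Rightarrow> complex) \<Rightarrow> real ^ 'n \<Rightarrow> complex" where
  "riesz_integral \<alpha> g x = 1 / riesz_const CARD('n) \<alpha> *
     (\<integral>y. g y * of_real (norm (x - y)) powr (\<alpha> - of_nat CARD('n)) \<partial>lborel)"

text \<open>\<open>v\<close> is the value at \<open>\<alpha>\<close> of the continuation of \<open>z \<mapsto> riesz_integral z g x\<close> from the strip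
  \<open>0 < Re z < b\<close> to some strip \<open>c < Re z < b\<close> containing \<open>\<alpha>\<close>. The strip without \<open>riesz_poles\<close> is
  connected, so \<open>v\<close> is determined by \<open>g\<close>, \<open>x\<close> and \<open>\<alpha>\<close>, independently of \<open>b\<close> and \<open>c\<close>.\<close>

definition has_riesz_continuation ::
    "complex \<Rightarrow> (real ^ 'n \<Rightarrow> complex) \<Rightarrow> real ^ 'n \<Rightarrow> complex \<Rightarrow> bool" where
  "has_riesz_continuation \<alpha> g x v \<longleftrightarrow>
     (\<exists>b c h. 0 < b \<and> g \<in> C_decay b \<and> c < 0 \<and> c < Re \<alpha> \<and> Re \<alpha> < b \<and>
        h holomorphic_on ({z. c < Re z \<and> Re z < b} - riesz_poles CARD('n)) \<and>
        (\<forall>z. 0 < Re z \<longrightarrow> Re z < b \<longrightarrow> z \<notin> riesz_poles CARD('n) \<longrightarrow> h z = riesz_integral z g x) \<and>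
        h \<alpha> = v)"

definition riesz_potential :: "complex \<Rightarrow> (real ^ 'n \<Rightarrow> complex) \<Rightarrow> real ^ 'n \<Rightarrow> complex" where
  "riesz_potential \<alpha> g x =
     (if 0 < Re \<alpha> then riesz_integral \<alpha> g x else (THE v. has_riesz_continuation \<alpha> g x v))"

end

theory Submission
  imports Defs
begin

text \<open>
  Averaging Lebesgue measure over all \<open>k\<close>-planes through \<open>x\<close> gives a rotation invariant measure that
  assigns to a ball of radius \<open>r\<close> about \<open>x\<close> the volume of a \<open>k\<close>-dimensional ball; hence it is a
  multiple of \<open>\<bar>x - y\<bar>\<^sup>k\<^sup>-\<^sup>n dy\<close>, and the dual transform of the plane transform of \<open>f\<close> is a multiple of
  \<open>I\<^sup>k f\<close>. Both measures are compared through their values on small balls: those determine integrals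
  of continuous functions in the limit, depend on a plane only through its distance to the centre,
  and are radial functions of the centre after averaging.

  By the Riesz composition formula \<open>I\<^sup>\<alpha> I\<^sup>k f = I\<^sup>\<alpha>\<^sup>+\<^sup>k f\<close> for small \<open>\<alpha> > 0\<close>. Since \<open>f\<close> is Hoelder continuous
  near \<open>x\<close>, \<open>\<beta> \<mapsto> I\<^sup>\<beta> f x\<close> extends holomorphically across \<open>\<beta> = 0\<close> with value \<open>f x\<close> there; the
  extension at \<open>\<beta> = \<alpha> + k\<close> is the continuation in \<open>\<alpha>\<close>, and \<open>\<alpha> = - k\<close> gives the theorem.
\<close>

subsection \<open>Radial integration\<close>

text \<open>The measure on a plane and the measure on planes are only known as choices. Masses of
  balls do not depend on the choice of base point and basis, and they are jointly measurable in
  plane and centre. Hence measurability of the plane transform and the exchange of integrals are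
  proved for ball averages and passed to the limit. The obstacle is balls not centred at
  \<open>x\<close>, where a single plane measure has no symmetry: agreement is first obtained after
  integration over radial sets of centres, and then, by radiality, for almost every centre.

  The constant comes from two normalisations. The ratio of the areas of the unit spheres in
  dimensions \<open>k\<close> and \<open>n\<close>, divided by 1/H_n(k), is (4 pi)^(k/2) Gamma(n/2)
  / Gamma((n-k)/2), the reciprocal of the factor in the theorem.

  Composition of potentials is established for real exponents whose sum stays below
  \<open>n\<close>. So the decay exponent of \<open>f\<close> is lowered to lie strictly between
  \<open>k\<close> and \<open>n\<close>, and the identity theorem supplies complex
  exponents.\<close>

lemma distr_eq_power_density:
  fixes M :: "'a measure" and g :: "'a \<Rightarrow> real" and V \<kappa> :: real
  assumes meas: "g \<in> borel_measurable M" and \<kappa>: "\<kappa> > 0" and V: "V \<ge> 0"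
    and sublevel: "\<And>r. r > 0 \<Longrightarrow> emeasure M {y \<in> space M. g y \<le> r} = ennreal (V * r powr \<kappa>)"
  shows "distr M borel g = density lborel (\<lambda>r. ennreal (indicator {0<..} r * (\<kappa> * V * r powr (\<kappa> - 1))))"
    (is "?L = ?R")
proof -
  let ?S = "\<lambda>r. {y \<in> space M. g y \<le> r}"
  \<comment> \<open>The hypothesis speaks of positive \<open>r\<close> only. The level set at 0 is
    null because it lies in sublevel sets of arbitrarily small measure; \<open>V + 1\<close> in
    place of \<open>V\<close> in the choice of \<open>r\<close> covers \<open>V = 0\<close>.\<close>
  have zero: "emeasure M (?S 0) = 0"
  proof -
    have *: "emeasure M (?S 0) \<le> ennreal e" if "e > 0" for e :: real
    proof -
      define r where "r = (e / (V + 1)) powr (1 / \<kappa>)"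
      have r: "r > 0" using that V by (simp add: r_def)
      have "r powr \<kappa> = e / (V + 1)" using that V \<kappa> by (simp add: r_def powr_powr)
      moreover have "V + 1 \<noteq> 0" using V by simp
      ultimately have "(V + 1) * r powr \<kappa> = e" by simp
      then have "r powr \<kappa> + V * r powr \<kappa> = e" unfolding distrib_right by simp
      moreover have "r powr \<kappa> \<ge> 0" by simp
      ultimately have le: "V * r powr \<kappa> \<le> e" by linarith
      have "emeasure M (?S 0) \<le> emeasure M (?S r)"
        using r meas by (intro emeasure_mono) auto
      also have "\<dots> \<le> ennreal e"
        using r le by (simp add: sublevel ennreal_leI)
      finally show ?thesis .
    qed
    have "emeasure M (?S 0) \<le> 0"
    proof (rule ennreal_le_epsilon)
      fix e :: real assume "0 < e"
      then show "emeasure M (?S 0) \<le> 0 + ennreal e" using * by simp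
    qed
    then show ?thesis by simp
  qed
  have L: "emeasure ?L {..r} = ennreal (if r > 0 then V * r powr \<kappa> else 0)" for r
  proof -
    have "emeasure ?L {..r} = emeasure M (?S r)"
      using meas by (subst emeasure_distr) (auto intro!: arg_cong[where f="emeasure M"])
    also have "\<dots> = ennreal (if r > 0 then V * r powr \<kappa> else 0)"
    proof (cases "r > 0")
      case False
      then have "?S r \<subseteq> ?S 0" by auto
      then have "emeasure M (?S r) \<le> 0"
        unfolding zero[symmetric] using meas by (intro emeasure_mono) auto
      then show ?thesis using False by simp
    qed (simp add: sublevel)
    finally show ?thesis .
  qed
  have R: "emeasure ?R {..r} = ennreal (if r > 0 then V * r powr \<kappa> else 0)" for r
  proof (cases "r > 0")
    case True
    have "emeasure ?R {..r} = (\<integral>\<^sup>+s. ennreal (indicator {0<..} s * (\<kappa> * V * s powr (\<kappa> - 1))) * indicator {..r} s \<partial>lborel)"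
      by (subst emeasure_density) auto
    also have "\<dots> = (\<integral>\<^sup>+s. ennreal (indicator {0..r} s * (\<kappa> * V * s powr (\<kappa> - 1))) \<partial>lborel)"
      by (intro nn_integral_cong) (auto simp: indicator_def)
    also have "\<dots> = ennreal (\<kappa> * V * (r powr (\<kappa> - 1 + 1) / (\<kappa> - 1 + 1)))"
      using True V \<kappa> by (intro nn_integral_has_integral_lebesgue has_integral_mult_right has_integral_powr_from_0) auto
    finally show ?thesis using True \<kappa> by simp
  next
    case False
    have "emeasure ?R {..r} = (\<integral>\<^sup>+s. ennreal (indicator {0<..} s * (\<kappa> * V * s powr (\<kappa> - 1))) * indicator {..r} s \<partial>lborel)"
      by (subst emeasure_density) auto
    also have "\<dots> = (\<integral>\<^sup>+s. 0 \<partial>(lborel::real measure))"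
      using False by (intro nn_integral_cong) (auto simp: indicator_def)
    finally show ?thesis using False by simp
  qed
  show ?thesis
  proof (rule measure_eqI_generator_eq[where E="range atMost" and \<Omega>=UNIV and A="\<lambda>i. {..real i}"])
    show "Int_stable (range (atMost :: real \<Rightarrow> _))"
      by (auto simp: Int_stable_def)
    show "sets ?L = sigma_sets UNIV (range atMost)"
      by (simp add: borel_eq_atMost)
    show "sets ?R = sigma_sets UNIV (range atMost)"
      by (simp add: borel_eq_atMost)
    show "(\<Union>i. {..real i}) = UNIV" by (auto intro: real_arch_simple)
    show "emeasure ?L {..real i} \<noteq> \<infinity>" for i using L[of "real i"] by auto
    show "emeasure ?L X = emeasure ?R X" if "X \<in> range atMost" for X
      using that by (auto simp only: L R)
  qed auto
qed

lemma nn_integral_power_density: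
  fixes M :: "'a measure" and g :: "'a \<Rightarrow> real" and V \<kappa> :: real
  assumes meas: "g \<in> borel_measurable M" and \<kappa>: "\<kappa> > 0" and V: "V \<ge> 0"
    and sublevel: "\<And>r. r > 0 \<Longrightarrow> emeasure M {y \<in> space M. g y \<le> r} = ennreal (V * r powr \<kappa>)"
    and F: "F \<in> borel_measurable borel"
  shows "(\<integral>\<^sup>+y. F (g y) \<partial>M) = (\<integral>\<^sup>+r\<in>{0<..}. F r * ennreal (\<kappa> * V * r powr (\<kappa> - 1)) \<partial>lborel)"
proof -
  have "(\<integral>\<^sup>+y. F (g y) \<partial>M) = (\<integral>\<^sup>+r. F r \<partial>distr M borel g)"
    using meas F by (subst nn_integral_distr) auto
  also have "\<dots> = (\<integral>\<^sup>+r. ennreal (indicator {0<..} r * (\<kappa> * V * r powr (\<kappa> - 1))) * F r \<partial>lborel)"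
    using F distr_eq_power_density[OF meas \<kappa> V sublevel] by (simp add: nn_integral_density)
  also have "\<dots> = (\<integral>\<^sup>+r\<in>{0<..}. F r * ennreal (\<kappa> * V * r powr (\<kappa> - 1)) \<partial>lborel)"
    by (intro nn_integral_cong) (auto simp: indicator_def mult.commute)
  finally show ?thesis .
qed

text \<open>Only the masses of balls about \<open>x\<close> enter, so one formula serves Lebesgue
  measure on the whole space and the measure on a plane, without surface measure on spheres.\<close>

lemma nn_integral_polar:
  fixes M :: "'a::metric_space measure" and x :: 'a and V :: real and d :: nat
  assumes sets: "sets M = sets borel" and d: "d > 0" and V: "V \<ge> 0"
    and ball: "\<And>r. r > 0 \<Longrightarrow> emeasure M (cball x r) = ennreal (V * r ^ d)"
    and F: "F \<in> borel_measurable borel"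
  shows "(\<integral>\<^sup>+y. F (dist x y) \<partial>M) =
    (\<integral>\<^sup>+r\<in>{0<..}. F r * ennreal (d * V * r ^ (d - 1)) \<partial>lborel)"
proof -
  have meas: "dist x \<in> borel_measurable M"
    unfolding measurable_cong_sets[OF sets refl]
    by (intro borel_measurable_continuous_onI continuous_intros)
  have "emeasure M {y \<in> space M. dist x y \<le> r} = ennreal (V * r powr real d)" if "r > 0" for r
    using ball[OF that] sets_eq_imp_space_eq[OF sets] that by (simp add: cball_def powr_realpow)
  from nn_integral_power_density[OF meas _ V this F]
  have "(\<integral>\<^sup>+y. F (dist x y) \<partial>M) = (\<integral>\<^sup>+r\<in>{0<..}. F r * ennreal (d * V * r powr (d - 1)) \<partial>lborel)"
    using d by simp
  also have "\<dots> = (\<integral>\<^sup>+r\<in>{0<..}. F r * ennreal (d * V * r ^ (d - 1)) \<partial>lborel)"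
    using d by (intro nn_integral_cong) (auto simp: indicator_def powr_realpow[symmetric] of_nat_diff)
  finally show ?thesis .
qed

text \<open>The area of the unit sphere in dimension \<open>d\<close>. The quotients of such areas
  are the source of the Gamma factors in the inversion constant.\<close>

lemma unit_ball_vol_times:
  assumes "d > 0"
  shows "d * unit_ball_vol d = 2 * pi powr (d / 2) / Gamma (d / 2)"
proof -
  have "Gamma (d / 2 + 1) = d / 2 * Gamma (d / 2)"
    using assms by (intro Gamma_plus1) (auto simp: nonpos_Ints_def)
  then have "Gamma (d / 2 + 1) * 2 = d * Gamma (d / 2)" by simp
  moreover have "Gamma (d / 2) > 0" "Gamma (d / 2 + 1) > 0" using assms by (auto intro!: Gamma_real_pos)
  ultimately show ?thesis unfolding unit_ball_vol_def times_divide_eq_right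
    by (subst frac_eq_eq) (auto simp: mult_ac)
qed

subsection \<open>Averages over small balls\<close>

lemma sigma_finite_measure_cball:
  fixes M :: "'a::metric_space measure"
  assumes sets: "sets M = sets borel"
    and fin: "\<And>z r. emeasure M (cball z r) < \<infinity>"
  shows "sigma_finite_measure M"
proof
  fix x0 :: 'a
  have "space M = UNIV" using sets_eq_imp_space_eq[OF sets] by simp
  moreover have "(\<Union>i::nat. cball x0 i) = UNIV"
    using real_arch_simple by auto
  ultimately show "\<exists>A. countable A \<and> A \<subseteq> sets M \<and> \<Union>A = space M \<and> (\<forall>a\<in>A. emeasure M a \<noteq> \<infinity>)"
    using fin sets by (intro exI[of _ "range (\<lambda>i::nat. cball x0 i)"]) (auto simp: less_top)
qed

text \<open>By Fubini this is the integral against \<open>M\<close> of the means of \<open>f\<close>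
  over balls of radius \<open>r\<close> (\<open>ball_average_eq\<close>). Written in this order it
  sees \<open>M\<close> only through its masses on balls.\<close>

definition ball_average ::
    "'a::euclidean_space measure \<Rightarrow> ('a \<Rightarrow> 'b::{banach, second_countable_topology}) \<Rightarrow> real \<Rightarrow> 'b" where
  "ball_average M f r =
     (\<integral>z. measure M (cball z r) *\<^sub>R f z \<partial>lborel) /\<^sub>R measure lborel (cball (0::'a) r)"

lemma measure_lborel_cball_cong:
  fixes x :: "'a::euclidean_space"
  shows "measure lborel (cball x r) = measure lborel (cball (0::'a) r)"
proof (cases "r \<ge> 0")
  case True then show ?thesis by (simp add: content_cball)
next
  case False then show ?thesis by (simp add: cball_empty)
qed

lemma integrable_indicator_cball [simp]: "integrable lborel (indicat_real (cball y r))"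
  using emeasure_lborel_cball_finite[of y r] by (intro integrable_real_indicator) auto

text \<open>The majorant \<open>w\<close> bounds \<open>f\<close> on the whole unit ball about each
  point, so it also bounds every local mean of radius at most 1. This makes dominated convergence
  applicable as the radius shrinks.\<close>

locale dominated_on_balls =
  fixes M :: "'a::euclidean_space measure" and f :: "'a \<Rightarrow> 'b::{banach, second_countable_topology}"
    and w :: "'a \<Rightarrow> real"
  assumes sets_M: "sets M = sets borel"
    and fin: "\<And>z r. emeasure M (cball z r) < \<infinity>"
    and cont: "continuous_on UNIV f"
    and w: "integrable M w" and fw: "\<And>y z. dist y z \<le> 1 \<Longrightarrow> norm (f z) \<le> w y"
begin

lemma f_borel: "f \<in> borel_measurable borel"
  using cont by (rule borel_measurable_continuous_onI)

lemma w_nonneg: "w y \<ge> 0"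
  using fw[of y y] norm_ge_zero[of "f y"] by (simp del: norm_ge_zero)

definition local_mean :: "real \<Rightarrow> 'a \<Rightarrow> 'b" where
  "local_mean r y = (\<integral>z. indicator (cball y r) z *\<^sub>R f z \<partial>lborel) /\<^sub>R measure lborel (cball (0::'a) r)"

lemma integrable_cball: "integrable lborel (\<lambda>z. indicator (cball y r) z *\<^sub>R f z)"
  using borel_integrable_compact[of "cball y r" f] continuous_on_subset[OF cont] by simp

lemma norm_cball_integral:
  assumes "0 < r" "r \<le> 1"
  shows "(\<integral>z. norm (indicator (cball y r) z *\<^sub>R f z) \<partial>lborel) \<le> measure lborel (cball (0::'a) r) * w y"
proof -
  have "(\<integral>z. norm (indicator (cball y r) z *\<^sub>R f z) \<partial>lborel) \<le> (\<integral>z. indicator (cball y r) z *\<^sub>R w y \<partial>lborel)"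
  proof (rule integral_mono)
    show "integrable lborel (\<lambda>z. norm (indicat_real (cball y r) z *\<^sub>R f z))"
      using integrable_cball by (rule integrable_norm)
    show "integrable lborel (\<lambda>z. indicat_real (cball y r) z *\<^sub>R w y)"
      by (intro integrable_scaleR_left integrable_indicator_cball)
    show "norm (indicator (cball y r) z *\<^sub>R f z) \<le> indicator (cball y r) z *\<^sub>R w y" for z
      using fw[of y z] assms by (auto simp: indicator_def)
  qed
  also have "\<dots> = measure lborel (cball (0::'a) r) * w y"
    using measure_lborel_cball_cong[of y r] by (simp add: emeasure_lborel_cball_finite)
  finally show ?thesis .
qed

lemma integrable_M_lborel:
  assumes "0 < r" "r \<le> 1"
  shows "integrable (M \<Otimes>\<^sub>M lborel) (\<lambda>(y, z). indicator (cball y r) z *\<^sub>R f z)"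
proof -
  interpret M: sigma_finite_measure M
    using sets_M fin by (rule sigma_finite_measure_cball)
  interpret pair_sigma_finite M lborel ..
  have meas: "(\<lambda>(y, z). indicator (cball y r) z *\<^sub>R f z) \<in> borel_measurable (M \<Otimes>\<^sub>M lborel)"
  proof -
    have [measurable]: "f \<in> borel_measurable borel" by (rule f_borel)
    have "(\<lambda>(y::'a, z). indicator {x. dist (fst x) (snd x) \<le> r} (y, z) *\<^sub>R f z) \<in> borel_measurable (borel \<Otimes>\<^sub>M borel)"
      by measurable
    then show ?thesis
      by (simp add: indicator_def cball_def measurable_cong_sets[OF sets_pair_measure_cong[OF sets_M sets_lborel] refl])
  qed
  show ?thesis
  proof (rule Fubini_integrable[OF meas])
    show "AE x in M. integrable lborel (\<lambda>y. case (x, y) of (y, z) \<Rightarrow> indicat_real (cball y r) z *\<^sub>R f z)"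
      using integrable_cball by simp
    have "(\<lambda>x. \<integral> y. norm (case (x, y) of (y, z) \<Rightarrow> indicat_real (cball y r) z *\<^sub>R f z) \<partial>lborel) \<in> borel_measurable M"
      using meas by measurable
    then show "integrable M (\<lambda>x. \<integral> y. norm (case (x, y) of (y, z) \<Rightarrow> indicat_real (cball y r) z *\<^sub>R f z) \<partial>lborel)"
    proof (rule Bochner_Integration.integrable_bound[rotated])
      show "integrable M (\<lambda>y. measure lborel (cball (0::'a) r) * w y)" using w by simp
      show "AE x in M. norm (\<integral> y. norm (case (x, y) of (y, z) \<Rightarrow> indicat_real (cball y r) z *\<^sub>R f z) \<partial>lborel)
         \<le> norm (measure lborel (cball (0::'a) r) * w x)"
        using norm_cball_integral[OF assms] w_nonneg by (auto simp: integral_nonneg abs_of_nonneg)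
    qed
  qed
qed

lemma integral_cball: "(\<integral>y. indicator (cball y r) z *\<^sub>R f z \<partial>M) = measure M (cball z r) *\<^sub>R f z"
proof -
  have "(\<integral>y. indicator (cball y r) z *\<^sub>R f z \<partial>M) = (\<integral>y. indicator (cball z r) y *\<^sub>R f z \<partial>M)"
    by (intro Bochner_Integration.integral_cong) (auto simp: indicator_def dist_commute)
  also have "\<dots> = measure M (cball z r) *\<^sub>R f z"
    using fin[of z r] sets_M by (subst integral_scaleR_left) auto
  finally show ?thesis .
qed

lemma ball_average_eq:
  assumes "0 < r" "r \<le> 1"
  shows "ball_average M f r = (\<integral>y. local_mean r y \<partial>M)"
proof -
  interpret M: sigma_finite_measure M
    using sets_M fin by (rule sigma_finite_measure_cball)
  interpret pair_sigma_finite M lborel ..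
  have "(\<integral>y. (\<integral>z. indicator (cball y r) z *\<^sub>R f z \<partial>lborel) \<partial>M) = (\<integral>z. (\<integral>y. indicator (cball y r) z *\<^sub>R f z \<partial>M) \<partial>lborel)"
    by (rule Fubini_integral[OF integrable_M_lborel[OF assms], symmetric])
  then show ?thesis
    unfolding ball_average_def local_mean_def by (simp add: integral_cball)
qed

lemma norm_local_mean:
  assumes "0 < r" "r \<le> 1"
  shows "norm (local_mean r y) \<le> w y"
proof -
  have "measure lborel (cball (0::'a) r) > 0" using assms by simp
  moreover have "norm (\<integral>z. indicator (cball y r) z *\<^sub>R f z \<partial>lborel) \<le> measure lborel (cball (0::'a) r) * w y"
    using norm_cball_integral[OF assms, of y] integral_norm_bound[of lborel "\<lambda>z. indicator (cball y r) z *\<^sub>R f z"]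
    by linarith
  ultimately show ?thesis by (simp add: local_mean_def field_simps)
qed

lemma local_mean_measurable:
  assumes "0 < r" "r \<le> 1"
  shows "local_mean r \<in> borel_measurable M"
proof -
  have "(\<lambda>(y, z). indicator (cball y r) z *\<^sub>R f z) \<in> borel_measurable (M \<Otimes>\<^sub>M lborel)"
    using integrable_M_lborel[OF assms] by (rule borel_measurable_integrable)
  then show ?thesis unfolding local_mean_def by measurable
qed

lemma norm_ball_average:
  assumes "0 < r" "r \<le> 1"
  shows "norm (ball_average M f r) \<le> (\<integral>y. w y \<partial>M)"
proof -
  have "norm (\<integral>y. local_mean r y \<partial>M) \<le> (\<integral>y. w y \<partial>M)"
  proof (rule Bochner_Integration.integral_norm_bound_integral[OF _ w norm_local_mean[OF assms]])
    show "integrable M (local_mean r)"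
      using norm_local_mean[OF assms] w_nonneg
      by (intro Bochner_Integration.integrable_bound[OF w local_mean_measurable[OF assms]]) simp
  qed
  then show ?thesis by (simp add: ball_average_eq assms)
qed

lemma local_mean_tendsto: "(\<lambda>j. local_mean (inverse (Suc j)) y) \<longlonglongrightarrow> f y"
proof (rule LIMSEQ_I)
  fix e :: real assume e: "e > 0"
  have "isCont f y" using cont by (simp add: continuous_on_eq_continuous_at)
  then obtain d where d: "d > 0" "\<And>z. dist y z < d \<Longrightarrow> norm (f z - f y) < e / 2"
    using e unfolding continuous_at_eps_delta by (metis dist_commute dist_norm half_gt_zero)
  obtain N where N: "inverse (Suc N) < d" using d(1) reals_Archimedean by blast
  have "norm (local_mean (inverse (Suc j)) y - f y) < e" if "j \<ge> N" for j
  proof -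
    define r where "r = inverse (real (Suc j))"
    have r: "r > 0" "r < d" using N that
      by (auto simp: r_def intro: le_less_trans[OF _ N] le_imp_inverse_le)
    let ?V = "measure lborel (cball (0::'a) r)"
    have V: "?V > 0" using r by simp
    have int: "integrable lborel (\<lambda>z. indicator (cball y r) z *\<^sub>R f y)"
      by (intro integrable_scaleR_left integrable_indicator_cball)
    have "(\<integral>z. indicator (cball y r) z *\<^sub>R (f z - f y) \<partial>lborel)
      = (\<integral>z. indicator (cball y r) z *\<^sub>R f z \<partial>lborel) - ?V *\<^sub>R f y"
      unfolding scaleR_diff_right
      by (subst Bochner_Integration.integral_diff[OF integrable_cball int])
        (use measure_lborel_cball_cong[of y r] in \<open>simp add: emeasure_lborel_cball_finite\<close>)
    then have *: "local_mean r y - f y = (\<integral>z. indicator (cball y r) z *\<^sub>R (f z - f y) \<partial>lborel) /\<^sub>R ?V"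
      using V by (simp add: local_mean_def scaleR_diff_right)
    have "norm (\<integral>z. indicator (cball y r) z *\<^sub>R (f z - f y) \<partial>lborel) \<le> (\<integral>z. indicator (cball y r) z *\<^sub>R (e/2) \<partial>lborel)"
    proof (rule Bochner_Integration.integral_norm_bound_integral)
      show "integrable lborel (\<lambda>z. indicator (cball y r) z *\<^sub>R (f z - f y))"
        unfolding scaleR_diff_right using integrable_cball int by (rule Bochner_Integration.integrable_diff)
      show "integrable lborel (\<lambda>z. indicat_real (cball y r) z *\<^sub>R (e/2))"
        by (intro integrable_scaleR_left integrable_indicator_cball)
      show "norm (indicator (cball y r) z *\<^sub>R (f z - f y)) \<le> indicator (cball y r) z *\<^sub>R (e/2)" for z
        using d(2)[of z] r e by (auto simp: indicator_def)
    qed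
    also have "\<dots> = ?V * (e/2)"
      using measure_lborel_cball_cong[of y r] by (simp add: emeasure_lborel_cball_finite)
    finally have "norm (local_mean r y - f y) \<le> e / 2"
      using V by (simp add: * field_simps)
    then show ?thesis using e by (simp add: r_def)
  qed
  then show "\<exists>N. \<forall>j\<ge>N. norm (local_mean (inverse (Suc j)) y - f y) < e" by blast
qed

text \<open>Lets \<open>norm_ball_average\<close> bound integrals of norms, as required for Fubini
  when the measure varies over planes.\<close>

lemma dominated_norm: "dominated_on_balls M (\<lambda>z. norm (f z)) w"
  using sets_M fin cont w fw by unfold_locales (auto intro: continuous_on_norm)

lemma integrable_measure_cball:
  assumes "0 < r" "r \<le> 1"
  shows "integrable lborel (\<lambda>z. measure M (cball z r) *\<^sub>R f z)"
proof -
  interpret M: sigma_finite_measure M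
    using sets_M fin by (rule sigma_finite_measure_cball)
  interpret pair_sigma_finite M lborel ..
  show ?thesis
    using integrable_snd[OF integrable_M_lborel[OF assms]] by (simp add: integral_cball)
qed

lemma ball_average_tendsto: "(\<lambda>j. ball_average M f (inverse (Suc j))) \<longlonglongrightarrow> (\<integral>y. f y \<partial>M)"
proof -
  have r: "0 < inverse (real (Suc j))" "inverse (real (Suc j)) \<le> 1" for j
    by (auto simp: field_simps)
  have "(\<lambda>j. \<integral>y. local_mean (inverse (Suc j)) y \<partial>M) \<longlonglongrightarrow> (\<integral>y. f y \<partial>M)"
  proof (rule integral_dominated_convergence[OF _ _ w])
    show "f \<in> borel_measurable M" using f_borel by (simp add: measurable_cong_sets[OF sets_M refl])
  qed (use r norm_local_mean local_mean_measurable local_mean_tendsto in auto)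
  then show ?thesis using r by (simp add: ball_average_eq del: of_nat_Suc)
qed

end

text \<open>Balls are not closed under intersection, so the usual uniqueness argument does not start
  from them. Ball averages show that both measures give the same integral to continuous functions
  vanishing outside a box; these approximate the indicator of an open box, and boxes do form an
  intersection-stable generator.\<close>

lemma measure_eqI_cball:
  fixes M N :: "'a::euclidean_space measure"
  assumes sets: "sets M = sets borel" "sets N = sets borel"
    and fin: "\<And>z r. emeasure M (cball z r) < \<infinity>"
    and eq: "\<And>z r. emeasure M (cball z r) = emeasure N (cball z r)"
  shows "M = N"
proof -
  have box: "emeasure M (box a b) = emeasure N (box a b)" for a b :: 'a
  proof -
    let ?U = "box a b"
    obtain R where R: "?U \<subseteq> cball 0 R"
      using bounded_box[of a b] by (auto simp: bounded_iff subset_iff)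
    \<comment> \<open>Continuous functions, increasing in \<open>j\<close> to the indicator of the
      open box.\<close>
    define h where "h = (\<lambda>(j::nat) y. min 1 (real j * infdist y (-?U)))"
    \<comment> \<open>\<open>infdist\<close> to the empty set is 0 by convention, so positivity
      inside the box requires a nonempty complement.\<close>
    have ne: "- ?U \<noteq> {}" using bounded_box[of a b] by (metis Compl_UNIV_eq double_complement not_bounded_UNIV)
    have h: "h j y \<ge> 0" "h j y \<le> 1" "y \<notin> ?U \<Longrightarrow> h j y = 0" for j y
      by (auto simp: h_def infdist_nonneg)
    have lim: "(\<lambda>j. h j y) \<longlonglongrightarrow> indicator ?U y" for y
    proof (cases "y \<in> ?U")
      case True
      have "infdist y (-?U) > 0"
        using True ne in_closed_iff_infdist_zero[of "-?U" y] infdist_nonneg[of y "-?U"]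
        by (auto simp: open_box closed_Compl less_le)
      then obtain N :: nat where N: "1 < N * infdist y (-?U)"
        using reals_Archimedean3 by blast
      have "h j y = 1" if "j \<ge> N" for j
        using order.strict_implies_order[OF N] infdist_nonneg[of y "-?U"] that
        by (auto simp: h_def intro!: min_absorb1 elim!: order_trans intro: mult_right_mono)
      then have "\<forall>\<^sub>F j in sequentially. h j y = 1"
        by (auto simp: eventually_sequentially)
      then show ?thesis using True by (simp add: tendsto_eventually)
    qed (simp add: h)
    \<comment> \<open>The radius grows by 1 because the majorant must bound \<open>h j\<close> on
      unit balls.\<close>
    have dom: "dominated_on_balls L (h j) (indicator (cball 0 (R + 1)))"
      if L: "sets L = sets borel" "\<And>z r. emeasure L (cball z r) < \<infinity>" for L j
    proof
      show "continuous_on UNIV (h j)" unfolding h_def by (intro continuous_intros)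
      show "integrable L (indicat_real (cball 0 (R + 1)))" using L by simp
      show "norm (h j z) \<le> indicat_real (cball 0 (R + 1)) y" if "dist y z \<le> 1" for y z
      proof (cases "z \<in> ?U")
        case True
        then have "norm y \<le> R + 1" using R that norm_triangle_ineq2[of y z] by (force simp: dist_norm)
        then show ?thesis using h(1,2)[of j z] by simp
      qed (simp add: h)
    qed (use L in auto)
    have lim2: "(\<lambda>j. \<integral>y. h j y \<partial>L) \<longlonglongrightarrow> measure L ?U"
      if L: "sets L = sets borel" "\<And>z r. emeasure L (cball z r) < \<infinity>" for L
    proof -
      have "(\<lambda>j. \<integral>y. h j y \<partial>L) \<longlonglongrightarrow> (\<integral>y. indicator ?U y \<partial>L)"
      proof (rule integral_dominated_convergence[where w="indicator (cball 0 R)"])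
        show "indicat_real ?U \<in> borel_measurable L" using L by simp
        show "h j \<in> borel_measurable L" for j
          using dominated_on_balls.f_borel[OF dom[OF L]] by (simp add: measurable_cong_sets[OF L(1) refl])
        show "integrable L (indicat_real (cball 0 R))" using L by simp
        show "AE x in L. norm (h j x) \<le> indicat_real (cball 0 R) x" for j
        proof (rule AE_I2)
          fix x show "norm (h j x) \<le> indicat_real (cball 0 R) x"
            using h(1,2)[of j x] h(3)[of x j] R by (cases "x \<in> ?U") (auto simp: indicator_def)
        qed
      qed (use lim in auto)
      then show ?thesis using L by simp
    qed
    have finN: "\<And>z r. emeasure N (cball z r) < \<infinity>" using fin eq by simp
    have "(\<integral>y. h j y \<partial>M) = (\<integral>y. h j y \<partial>N)" for j
    proof (rule LIMSEQ_unique)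
      show "(\<lambda>i. ball_average M (h j) (inverse (Suc i))) \<longlonglongrightarrow> (\<integral>y. h j y \<partial>M)"
        using dominated_on_balls.ball_average_tendsto[OF dom[OF sets(1) fin]] .
      show "(\<lambda>i. ball_average M (h j) (inverse (Suc i))) \<longlonglongrightarrow> (\<integral>y. h j y \<partial>N)"
        using dominated_on_balls.ball_average_tendsto[OF dom[OF sets(2) finN]]
        by (simp add: ball_average_def measure_def eq)
    qed
    then have "measure M ?U = measure N ?U"
      using lim2[OF sets(1) fin] lim2[OF sets(2) finN] LIMSEQ_unique by auto
    moreover have "emeasure M ?U < \<infinity>" "emeasure N ?U < \<infinity>"
      using emeasure_mono[OF R, of M] emeasure_mono[OF R, of N] fin finN sets
      by (auto intro: le_less_trans)
    ultimately show ?thesis by (metis emeasure_eq_ennreal_measure infinity_ennreal_def less_irrefl)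
  qed
  show ?thesis
  proof (rule measure_eqI_generator_eq[where E="range (\<lambda>(a, b). box a b)" and \<Omega>=UNIV and A="\<lambda>n::nat. box (- (real n *\<^sub>R One)) (real n *\<^sub>R One)"])
    show "Int_stable (range (\<lambda>(a, b). box a b::'a set))"
      by (auto simp: Int_stable_def box_Int_box)
    show "sets M = sigma_sets UNIV (range (\<lambda>(a, b). box a b))" "sets N = sigma_sets UNIV (range (\<lambda>(a, b). box a b))"
      using sets by (simp_all add: borel_eq_box)
    show "(\<Union>n::nat. box (- (real n *\<^sub>R One)) (real n *\<^sub>R One)) = (UNIV::'a set)"
      by (rule UN_box_eq_UNIV)
    show "emeasure M (box (- (real n *\<^sub>R One)) (real n *\<^sub>R One)) \<noteq> \<infinity>" for n :: nat
    proof -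
      obtain R where R: "box (- (real n *\<^sub>R One)) (real n *\<^sub>R One) \<subseteq> cball (0::'a) R"
        using bounded_box[of "- (real n *\<^sub>R One)" "real n *\<^sub>R One::'a"] by (auto simp: bounded_iff subset_iff)
      show ?thesis using emeasure_mono[OF R, of M] fin[of 0 R] sets by auto
    qed
  qed (use box in auto)
qed

text \<open>The preimage of a ball is a ball of the same radius, so \<open>measure_eqI_cball\<close>
  applies. Besides rotations about a point this covers linear isometries of the space of matrices,
  which are needed for the invariant measure on planes.\<close>

lemma distr_lborel_isometry:
  fixes T :: "'a::euclidean_space \<Rightarrow> 'a"
  assumes surj: "surj T" and iso: "\<And>x y. dist (T x) (T y) = dist x y"
  shows "distr lborel borel T = lborel"
proof (rule measure_eqI_cball)
  have "continuous_on UNIV T"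
    by (rule continuous_onI) (use iso in auto)
  then have meas: "T \<in> borel_measurable borel"
    by (rule borel_measurable_continuous_onI)
  have eq: "emeasure (distr lborel borel T) (cball z r) = emeasure lborel (cball z r)" for z r
  proof (cases "r \<ge> 0")
    case True
    obtain z' where z: "z = T z'" using surj by blast
    have "T -` cball z r = cball z' r"
      using iso by (auto simp: z)
    then show ?thesis using meas True by (simp add: emeasure_distr emeasure_cball)
  next
    case False then show ?thesis by (simp add: cball_empty)
  qed
  show "emeasure (distr lborel borel T) (cball z r) = emeasure lborel (cball z r)" for z r by (rule eq)
  show "emeasure (distr lborel borel T) (cball z r) < \<infinity>" for z r
    unfolding eq using emeasure_lborel_cball_finite[of z r] by simp
qed auto

lemma distr_lborel_linear_isometry:
  fixes T :: "'a::euclidean_space \<Rightarrow> 'a"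
  assumes T: "linear T" "\<And>x. norm (T x) = norm x"
  shows "distr lborel borel T = lborel"
proof (rule distr_lborel_isometry)
  have "inj T" using T by (metis linear_injective_0 norm_eq_zero)
  then show "surj T" using linear_injective_imp_surjective[OF T(1)] by blast
  show "dist (T x) (T y) = dist x y" for x y
    using T by (simp add: dist_norm linear_diff[symmetric])
qed

subsection \<open>Lebesgue measure on planes\<close>

text \<open>Recentres balls in the coordinates of a plane. The restriction to \<open>B\<close> keeps
  the translated functions in the product space.\<close>

lemma PiM_lborel_translation:
  fixes \<tau> :: "'b \<Rightarrow> real"
  assumes "finite B"
  shows "distr (\<Pi>\<^sub>M b\<in>B. lborel) (\<Pi>\<^sub>M b\<in>B. lborel) (\<lambda>t. \<lambda>b\<in>B. t b - \<tau> b) = (\<Pi>\<^sub>M b\<in>B. lborel)"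
proof -
  interpret product_sigma_finite "\<lambda>_::'b. lborel :: real measure" ..
  have meas: "(\<lambda>t. \<lambda>b\<in>B. t b - \<tau> b) \<in> measurable (\<Pi>\<^sub>M b\<in>B. lborel) (\<Pi>\<^sub>M b\<in>B. lborel)"
    by measurable
  have one: "emeasure lborel ((\<lambda>s. s - c) -` A) = emeasure lborel A" if "A \<in> sets borel" for A and c :: real
  proof -
    have "(+) (- c) -` A = (\<lambda>s. s - c) -` A" by (auto simp: vimage_def)
    moreover have "emeasure (distr lborel borel ((+) (- c))) A = emeasure lborel ((+) (- c) -` A)"
      using that by (subst emeasure_distr) simp_all
    ultimately show ?thesis by (simp only: lborel_distr_plus)
  qed
  show ?thesis
  proof (rule PiM_eqI[OF assms])
    fix A :: "'b \<Rightarrow> real set" assume "\<And>i. i \<in> B \<Longrightarrow> A i \<in> sets lborel"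
    then have A: "\<And>i. i \<in> B \<Longrightarrow> A i \<in> sets borel" by simp
    have *: "(\<lambda>t. \<lambda>b\<in>B. t b - \<tau> b) -` (Pi\<^sub>E B A) \<inter> space (\<Pi>\<^sub>M b\<in>B. lborel) = Pi\<^sub>E B (\<lambda>b. (\<lambda>s. s - \<tau> b) -` A b)"
      by (auto simp: space_PiM PiE_def Pi_def extensional_def)
    have "Pi\<^sub>E B A \<in> sets (\<Pi>\<^sub>M b\<in>B. lborel)"
      using A by (intro sets_PiM_I_finite assms) simp
    then have "emeasure (distr (\<Pi>\<^sub>M b\<in>B. lborel) (\<Pi>\<^sub>M b\<in>B. lborel) (\<lambda>t. \<lambda>b\<in>B. t b - \<tau> b)) (Pi\<^sub>E B A)
      = emeasure (\<Pi>\<^sub>M b\<in>B. lborel) (Pi\<^sub>E B (\<lambda>b. (\<lambda>s. s - \<tau> b) -` A b))"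
      by (subst emeasure_distr[OF meas]) (simp_all only: *)
    also have "\<dots> = (\<Prod>b\<in>B. emeasure lborel ((\<lambda>s. s - \<tau> b) -` A b))"
    proof (rule emeasure_PiM[OF assms])
      fix b assume "b \<in> B"
      have "(\<lambda>s. s - \<tau> b) \<in> borel_measurable borel" by simp
      from measurable_sets[OF this A[OF \<open>b \<in> B\<close>]] show "(\<lambda>s. s - \<tau> b) -` A b \<in> sets lborel" by simp
    qed
    also have "\<dots> = (\<Prod>b\<in>B. emeasure lborel (A b))"
      by (rule prod.cong[OF refl]) (rule one[OF A])
    finally show "emeasure (distr (\<Pi>\<^sub>M b\<in>B. lborel) (\<Pi>\<^sub>M b\<in>B. lborel) (\<lambda>t. \<lambda>b\<in>B. t b - \<tau> b)) (Pi\<^sub>E B A)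
      = (\<Prod>b\<in>B. emeasure lborel (A b))" .
  qed simp
qed

lemma planes_through_closed:
  assumes "\<xi> \<in> planes_through k x"
  shows "closed \<xi>" "\<xi> \<noteq> {}" "affine \<xi>" "x \<in> \<xi>"
  using assms by (auto simp: planes_through_def intro: affine_closed)

lemma closest_point_affine_orthogonal:
  fixes S :: "'a::euclidean_space set"
  assumes "affine S" "y \<in> S"
  shows "(z - closest_point S z) \<bullet> (y - closest_point S z) = 0"
proof -
  have S: "closed S" "convex S" "S \<noteq> {}" using assms by (auto intro: affine_closed affine_imp_convex)
  let ?c = "closest_point S z"
  have c: "?c \<in> S" using closest_point_in_set[OF S(1,3)] .
  \<comment> \<open>The reflection of \<open>y\<close> in the closest point lies in \<open>S\<close>
    too. The obtuse-angle inequality for \<open>y\<close> and for its reflection gives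
    equality.\<close>
  have "2 *\<^sub>R ?c + (-1) *\<^sub>R y \<in> S"
    using assms c by (intro mem_affine) auto
  then have "(z - ?c) \<bullet> (2 *\<^sub>R ?c + (-1) *\<^sub>R y - ?c) \<le> 0"
    using closest_point_dot[OF S(2,1)] by blast
  moreover have "2 *\<^sub>R ?c + (-1) *\<^sub>R y - ?c = ?c - y" by (simp add: scaleR_2)
  moreover have "(z - ?c) \<bullet> (y - ?c) \<le> 0"
    using closest_point_dot[OF S(2,1) assms(2)] .
  ultimately show ?thesis by (simp add: inner_diff_right del: scaleR_minus_left scaleR_one)
qed

text \<open>\<open>plane_lborel\<close> is a choice, so its properties have to be derived for an
  arbitrary base point \<open>p\<close> and an arbitrary orthonormal basis \<open>B\<close> of the
  direction space.\<close>

lemma plane_lborel_cases: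
  fixes \<xi> :: "(real ^ 'n) set"
  assumes "\<xi> \<in> planes_through k x"
  obtains p B where "p \<in> \<xi>" "pairwise orthogonal B" "\<And>b. b \<in> B \<Longrightarrow> norm b = 1"
    "span B = (\<lambda>y. y - p) ` \<xi>" "finite B" "card B = k"
    "plane_lborel \<xi> = distr (\<Pi>\<^sub>M b\<in>B. lborel) borel (\<lambda>t. p + (\<Sum>b\<in>B. t b *\<^sub>R b))"
proof -
  note \<xi> = planes_through_closed[OF assms]
  have "subspace ((\<lambda>y. y - x) ` \<xi>)" using \<xi> by (intro affine_diffs_subspace_subtract)
  from orthonormal_basis_subspace[OF this]
  have "\<exists>B. pairwise orthogonal B \<and> (\<forall>b\<in>B. norm b = 1) \<and> span B = (\<lambda>y. y - x) ` \<xi>" by metis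
  then obtain B0 where B0: "pairwise orthogonal B0" "\<And>b. b \<in> B0 \<Longrightarrow> norm b = 1" "span B0 = (\<lambda>y. y - x) ` \<xi>"
    by metis
  define Q where "Q m p B \<longleftrightarrow> p \<in> \<xi> \<and>
     pairwise orthogonal B \<and> (\<forall>b\<in>B. norm b = 1) \<and> span B = (\<lambda>y. y - p) ` \<xi> \<and>
     m = distr (\<Pi>\<^sub>M b\<in>B. lborel) borel (\<lambda>t. p + (\<Sum>b\<in>B. t b *\<^sub>R b))" for m p B
  have "Q (distr (\<Pi>\<^sub>M b\<in>B0. lborel) borel (\<lambda>t. x + (\<Sum>b\<in>B0. t b *\<^sub>R b))) x B0"
    unfolding Q_def using B0 \<xi>(4) by (intro conjI ballI refl)
  then have "\<exists>m p B. Q m p B" by (intro exI)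
  from someI_ex[OF this] have "\<exists>p B. Q (plane_lborel \<xi>) p B"
    unfolding plane_lborel_def Q_def .
  then obtain p B where "Q (plane_lborel \<xi>) p B" by (elim exE)
  then have pB: "p \<in> \<xi>" "pairwise orthogonal B" "\<forall>b\<in>B. norm b = 1"
    "span B = (\<lambda>y. y - p) ` \<xi>"
    "plane_lborel \<xi> = distr (\<Pi>\<^sub>M b\<in>B. lborel) borel (\<lambda>t. p + (\<Sum>b\<in>B. t b *\<^sub>R b))"
    unfolding Q_def by simp_all
  have ind: "independent B" using pB by (intro pairwise_orthogonal_independent) auto
  then have "finite B" by (rule independent_imp_finite)
  have "aff_dim \<xi> = int (dim ((\<lambda>y. y - p) ` \<xi>))"
    using pB(1) by (intro aff_dim_eq_dim_subtract) (simp add: hull_inc)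
  moreover have "aff_dim \<xi> = int k" using assms by (simp add: planes_through_def)
  ultimately have "dim (span B) = k" unfolding pB(4) by simp
  then have "card B = k" using dim_eq_card_independent[OF ind] by simp
  with pB(3) show thesis by (intro that[OF pB(1,2) _ pB(4) \<open>finite B\<close> _ pB(5)]) simp_all
qed

lemma sets_plane_lborel:
  assumes "\<xi> \<in> planes_through k x"
  shows "sets (plane_lborel \<xi>) = sets borel"
  by (rule plane_lborel_cases[OF assms]) (simp only: sets_distr)

text \<open>By Pythagoras the ball meets the plane in a \<open>k\<close>-dimensional ball about the
  foot of the perpendicular. The right-hand side mentions neither base point nor basis;
  \<open>max 0\<close> gives mass 0 to a ball that misses or only touches the plane.\<close>

lemma emeasure_plane_lborel_cball:
  fixes \<xi> :: "(real ^ 'n) set"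
  assumes \<xi>: "\<xi> \<in> planes_through k x" and k: "k > 0" and r: "r > 0"
  shows "emeasure (plane_lborel \<xi>) (cball z r) =
    ennreal (unit_ball_vol k * sqrt (max 0 (r\<^sup>2 - (dist z (closest_point \<xi> z))\<^sup>2)) ^ k)"
proof -
  obtain p B where p: "p \<in> \<xi>" and orth: "pairwise orthogonal B" and one: "\<And>b. b \<in> B \<Longrightarrow> norm b = 1"
    and span: "span B = (\<lambda>y. y - p) ` \<xi>" and B: "finite B" "card B = k"
    and m: "plane_lborel \<xi> = distr (\<Pi>\<^sub>M b\<in>B. lborel) borel (\<lambda>t. p + (\<Sum>b\<in>B. t b *\<^sub>R b))"
    by (rule plane_lborel_cases[OF \<xi>]) (rule that)
  define c where "c = closest_point \<xi> z"
  define d where "d = dist z c"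
  \<comment> \<open>Coordinates of the foot of the perpendicular; subtracting them moves the centre
    of the intersection to the origin.\<close>
  define \<tau> where "\<tau> b = (c - p) \<bullet> b" for b
  let ?P = "\<Pi>\<^sub>M b\<in>B. lborel :: real measure"
  let ?S = "\<lambda>s. {t. sqrt (\<Sum>b\<in>B. (t b)\<^sup>2) \<le> s} \<inter> space ?P"
  have meas: "(\<lambda>t. p + (\<Sum>b\<in>B. t b *\<^sub>R b)) \<in> borel_measurable ?P" by measurable
  have "c \<in> \<xi>" unfolding c_def using planes_through_closed[OF \<xi>] by (intro closest_point_in_set)
  then have "c - p \<in> span B" unfolding span by simp
  then have c: "c - p = (\<Sum>b\<in>B. \<tau> b *\<^sub>R b)"
    using orthonormal_basis_expand[OF orth one _ B(1)] by (simp add: \<tau>_def)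
  have dist: "(dist z (p + (\<Sum>b\<in>B. t b *\<^sub>R b)))\<^sup>2 = d\<^sup>2 + (\<Sum>b\<in>B. (t b - \<tau> b)\<^sup>2)" for t
  proof -
    let ?y = "p + (\<Sum>b\<in>B. t b *\<^sub>R b)"
    have "?y - p \<in> span B" by (simp add: span_sum span_scale span_base)
    then have y: "?y \<in> \<xi>" unfolding span by auto
    have yc: "?y - c = (\<Sum>b\<in>B. (t b - \<tau> b) *\<^sub>R b)"
      using c by (simp add: scaleR_diff_left sum_subtractf algebra_simps)
    have "(norm (?y - c))\<^sup>2 = (\<Sum>b\<in>B. (norm ((t b - \<tau> b) *\<^sub>R b))\<^sup>2)"
      unfolding yc using orth B(1) by (intro norm_sum_Pythagorean)
        (auto simp: pairwise_def orthogonal_def)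
    also have "\<dots> = (\<Sum>b\<in>B. (t b - \<tau> b)\<^sup>2)"
      using one by (intro sum.cong) auto
    finally have *: "(norm (?y - c))\<^sup>2 = (\<Sum>b\<in>B. (t b - \<tau> b)\<^sup>2)" .
    have "orthogonal (z - c) (c - ?y)"
      using closest_point_affine_orthogonal[OF planes_through_closed(3)[OF \<xi>] y, of z]
      by (simp add: c_def orthogonal_def inner_diff_right)
    then have "(norm ((z - c) + (c - ?y)))\<^sup>2 = (norm (z - c))\<^sup>2 + (norm (c - ?y))\<^sup>2"
      by (rule norm_add_Pythagorean)
    then have "(norm (z - ?y))\<^sup>2 = (norm (z - c))\<^sup>2 + (norm (c - ?y))\<^sup>2" by (simp only: diff_add_cancel add_diff_eq)
    then show ?thesis using * unfolding d_def dist_norm by (simp only: norm_minus_commute)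
  qed
  have ball: "emeasure (plane_lborel \<xi>) (cball z r) = emeasure ?P ({t. (\<Sum>b\<in>B. (t b)\<^sup>2) \<le> r\<^sup>2 - d\<^sup>2} \<inter> space ?P)"
  proof -
    have "emeasure (plane_lborel \<xi>) (cball z r) = emeasure ?P ({t. (\<Sum>b\<in>B. (t b - \<tau> b)\<^sup>2) \<le> r\<^sup>2 - d\<^sup>2} \<inter> space ?P)"
    proof -
      have "dist z y \<le> r \<longleftrightarrow> (dist z y)\<^sup>2 \<le> r\<^sup>2" for y
        using r by (simp add: abs_le_square_iff[symmetric])
      then have "(\<lambda>t. p + (\<Sum>b\<in>B. t b *\<^sub>R b)) -` cball z r = {t. (\<Sum>b\<in>B. (t b - \<tau> b)\<^sup>2) \<le> r\<^sup>2 - d\<^sup>2}"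
        by (auto simp: dist le_diff_eq add.commute)
      then show ?thesis unfolding m using meas by (simp add: emeasure_distr)
    qed
    also have "\<dots> = emeasure (distr ?P ?P (\<lambda>t. \<lambda>b\<in>B. t b - \<tau> b)) ({t. (\<Sum>b\<in>B. (t b)\<^sup>2) \<le> r\<^sup>2 - d\<^sup>2} \<inter> space ?P)"
    proof (subst emeasure_distr)
      show "{t. (\<Sum>b\<in>B. (t b)\<^sup>2) \<le> r\<^sup>2 - d\<^sup>2} \<inter> space ?P \<in> sets ?P" by measurable
    qed (auto intro!: arg_cong[where f="emeasure ?P"] simp: space_PiM)
    finally show ?thesis by (simp add: PiM_lborel_translation[OF B(1)])
  qed
  have S: "emeasure ?P (?S s) = ennreal (unit_ball_vol k * s ^ k)" if "s > 0" for s
    using emeasure_cball_aux[OF B(1) that] B(2) by simp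
  show ?thesis
  proof (cases "r\<^sup>2 - d\<^sup>2 > 0")
    case True
    have "{t. (\<Sum>b\<in>B. (t b)\<^sup>2) \<le> r\<^sup>2 - d\<^sup>2} \<inter> space ?P = ?S (sqrt (r\<^sup>2 - d\<^sup>2))" by auto
    then show ?thesis using S[of "sqrt (r\<^sup>2 - d\<^sup>2)"] True ball by (simp add: d_def c_def)
  next
    \<comment> \<open>The intersection has at most one point. It is null because it fits into
      coordinate balls of any prescribed volume \<open>e\<close>.\<close>
    case False
    have "emeasure ?P ({t. (\<Sum>b\<in>B. (t b)\<^sup>2) \<le> r\<^sup>2 - d\<^sup>2} \<inter> space ?P) \<le> 0"
    proof (rule ennreal_le_epsilon)
      fix e :: real assume e: "e > 0"
      define s where "s = root k (e / unit_ball_vol k)"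
      have V: "unit_ball_vol k > 0" by simp
      have s: "s > 0" "unit_ball_vol k * s ^ k = e" using e k V by (simp_all add: s_def del: unit_ball_vol_pos)
      have "{t. (\<Sum>b\<in>B. (t b)\<^sup>2) \<le> r\<^sup>2 - d\<^sup>2} \<inter> space ?P \<subseteq> ?S s"
        using False s by (auto simp: real_sqrt_le_iff' intro: order_trans[of _ 0])
      moreover have "?S s \<in> sets ?P" by measurable
      ultimately have "emeasure ?P ({t. (\<Sum>b\<in>B. (t b)\<^sup>2) \<le> r\<^sup>2 - d\<^sup>2} \<inter> space ?P) \<le> emeasure ?P (?S s)"
        by (rule emeasure_mono)
      then show "emeasure ?P ({t. (\<Sum>b\<in>B. (t b)\<^sup>2) \<le> r\<^sup>2 - d\<^sup>2} \<inter> space ?P) \<le> 0 + ennreal e"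
        using S[OF s(1)] s(2) by simp
    qed
    then show ?thesis using False k ball by (simp add: d_def c_def max_def)
  qed
qed

subsection \<open>The invariant measure on planes through a point\<close>

lemma closest_point_affine_orthogonal':
  fixes S :: "'a::euclidean_space set"
  assumes "affine S" "y1 \<in> S" "y2 \<in> S"
  shows "(z - closest_point S z) \<bullet> (y1 - y2) = 0"
  using closest_point_affine_orthogonal[OF assms(1,2), of z] closest_point_affine_orthogonal[OF assms(1,3), of z]
  by (simp add: inner_diff_right)

lemma closest_point_affineI:
  fixes S :: "'a::euclidean_space set"
  assumes "affine S" "p \<in> S" "\<And>y. y \<in> S \<Longrightarrow> (z - p) \<bullet> (y - p) = 0"
  shows "closest_point S z = p"
proof (rule closest_point_unique[symmetric])
  show "convex S" "closed S" using assms(1) by (auto intro: affine_imp_convex affine_closed)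
  show "\<forall>y\<in>S. dist z p \<le> dist z y"
  proof
    fix y assume "y \<in> S"
    then have "(z - p) \<bullet> (p - y) = 0" using assms(3)[of y] by (simp add: inner_diff_right)
    then have "(norm ((z - p) + (p - y)))\<^sup>2 = (norm (z - p))\<^sup>2 + (norm (p - y))\<^sup>2"
      by (intro norm_add_Pythagorean) (simp add: orthogonal_def)
    then have "(norm (z - p))\<^sup>2 \<le> (norm (z - y))\<^sup>2" by (simp only: diff_add_cancel add_diff_eq) simp
    then show "dist z p \<le> dist z y" by (simp add: dist_norm)
  qed
qed (fact assms(2))

text \<open>Orthogonal projection onto an affine set is an affine map, hence determined by its
  values at 0 and at the basis vectors. This turns measurability in the plane for each fixed point
  into joint measurability in plane and point.\<close>

lemma closest_point_affine_expand:
  fixes S :: "'a::euclidean_space set"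
  assumes S: "affine S" "S \<noteq> {}"
  shows "closest_point S z =
    closest_point S 0 + (\<Sum>b\<in>Basis. (z \<bullet> b) *\<^sub>R (closest_point S b - closest_point S 0))"
    (is "_ = ?p")
proof (rule closest_point_affineI[OF S(1)])
  have cl: "closest_point S w \<in> S" for w
    using S by (intro closest_point_in_set affine_closed)
  let ?c = "closest_point S 0"
  have L: "subspace ((\<lambda>x. x - ?c) ` S)" using S(1) cl by (intro affine_diffs_subspace_subtract)
  have "(\<Sum>b\<in>Basis. (z \<bullet> b) *\<^sub>R (closest_point S b - ?c)) \<in> (\<lambda>x. x - ?c) ` S"
    by (intro subspace_sum[OF L] subspace_scale[OF L] imageI cl)
  then show p: "?p \<in> S" by auto
  fix y assume y: "y \<in> S"
  have "z - ?p = (\<Sum>b\<in>Basis. (z \<bullet> b) *\<^sub>R ((b - closest_point S b) - (0 - ?c))) + (0 - ?c)"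
  proof -
    have "z = (\<Sum>b\<in>Basis. (z \<bullet> b) *\<^sub>R b)" by (simp add: euclidean_representation)
    moreover have "(\<Sum>b\<in>Basis. (z \<bullet> b) *\<^sub>R ((b - closest_point S b) - (0 - ?c))) =
       (\<Sum>b\<in>Basis. (z \<bullet> b) *\<^sub>R b) - (\<Sum>b\<in>Basis. (z \<bullet> b) *\<^sub>R (closest_point S b - ?c))"
      unfolding sum_subtractf[symmetric] by (intro sum.cong) (auto simp: algebra_simps)
    ultimately show ?thesis by (simp add: algebra_simps)
  qed
  moreover have "((b - closest_point S b) - (0 - ?c)) \<bullet> (y - ?p) = 0" for b
    using closest_point_affine_orthogonal'[OF S(1) y p, of b] closest_point_affine_orthogonal'[OF S(1) y p, of 0]
    by (simp only: inner_diff_left)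
  moreover have "(0 - ?c) \<bullet> (y - ?p) = 0" using closest_point_affine_orthogonal'[OF S(1) y p, of 0] .
  ultimately show "(z - ?p) \<bullet> (y - ?p) = 0"
    by (simp only: inner_add_left inner_sum_left inner_scaleR_left) simp
qed

lemma infdist_closest_point:
  fixes S :: "'a::euclidean_space set"
  assumes "closed S" "S \<noteq> {}"
  shows "infdist z S = dist z (closest_point S z)"
proof (rule antisym)
  show "infdist z S \<le> dist z (closest_point S z)"
    using assms by (intro infdist_le closest_point_in_set)
  show "dist z (closest_point S z) \<le> infdist z S"
    unfolding infdist_def using assms by (auto intro!: cINF_greatest closest_point_le)
qed

text \<open>Reduces measurability of projections to that of distances, which are countable infima.\<close>
lemma closest_point_affine_polarisation:
  fixes S :: "'a::euclidean_space set"
  assumes S: "affine S" "S \<noteq> {}"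
  shows "closest_point S z \<bullet> e = z \<bullet> e - ((infdist (z + e) S)\<^sup>2 - (infdist (z - e) S)\<^sup>2) / 4"
proof -
  define c where "c = closest_point S"
  have cl: "c w \<in> S" for w
    unfolding c_def using S by (intro closest_point_in_set affine_closed)
  have closed: "closed S" using S(1) by (rule affine_closed)
  define l where "l w = (\<Sum>b\<in>Basis. (w \<bullet> b) *\<^sub>R (c b - c 0))" for w
  have cexp: "c w = c 0 + l w" for w
    unfolding c_def l_def by (rule closest_point_affine_expand[OF S])
  have "l (z + e) = l z + l e"
    by (simp add: l_def inner_add_left scaleR_add_left sum.distrib)
  moreover have "l (z - e) = l z - l e"
    by (simp add: l_def inner_diff_left scaleR_diff_left sum_subtractf)
  ultimately have lin: "c (z + e) + c (z - e) = 2 *\<^sub>R c z"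
    using cexp[of "z + e"] cexp[of "z - e"] cexp[of z] by (simp add: scaleR_2)
  \<comment> \<open>\<open>u\<close> is the normal component of \<open>z\<close> and
    \<open>q\<close> that of the translation \<open>e\<close>. The difference of the squared
    distances is \<open>4 * (u \<bullet> q)\<close>, and
    \<open>u \<bullet> q = u \<bullet> e\<close> since \<open>u\<close> is orthogonal to all
    directions of \<open>S\<close>.\<close>
  define u where "u = z - c z"
  define q where "q = (z + e - c (z + e)) - u"
  have p: "z + e - c (z + e) = u + q" by (simp add: q_def)
  have m: "z - e - c (z - e) = u - q"
    using lin by (simp add: q_def u_def algebra_simps scaleR_2)
  have "(infdist (z + e) S)\<^sup>2 - (infdist (z - e) S)\<^sup>2 = (u + q) \<bullet> (u + q) - (u - q) \<bullet> (u - q)"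
    unfolding infdist_closest_point[OF closed S(2)] dist_norm c_def[symmetric] p m
    by (simp only: power2_norm_eq_inner)
  also have "\<dots> = 4 * (u \<bullet> q)" by (simp add: inner_add_left inner_add_right inner_diff_left inner_diff_right inner_commute)
  also have "u \<bullet> q = u \<bullet> e - u \<bullet> (c (z + e) - c z)"
    by (simp add: q_def u_def inner_diff_right inner_add_right algebra_simps)
  also have "u \<bullet> (c (z + e) - c z) = 0"
    unfolding u_def c_def using closest_point_affine_orthogonal'[OF S(1) cl cl] by (simp add: c_def)
  finally show ?thesis by (simp add: u_def inner_diff_left c_def field_simps)
qed

section \<open>Measurability on the space of planes, and the action of rotations\<close>

lemma space_planes_borel [simp]: "space (planes_borel k x) = planes_through k x"
  by (simp add: planes_borel_def)

lemma closest_point_measurable_planes: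
  "(\<lambda>\<xi>. closest_point \<xi> y) \<in> borel_measurable (planes_borel k x)"
proof -
  have "closest_point \<in> measurable (planes_borel k x) (\<Pi>\<^sub>M y\<in>UNIV. borel)"
    unfolding planes_borel_def by (rule measurable_vimage_algebra1) (auto simp: space_PiM)
  then show ?thesis by (rule measurable_compose) (rule measurable_component_singleton, simp)
qed

lemma measurable_planes_borelI:
  assumes "\<And>w. w \<in> space N \<Longrightarrow> g w \<in> planes_through k x"
    and "\<And>y. (\<lambda>w. closest_point (g w) y) \<in> borel_measurable N"
  shows "g \<in> measurable N (planes_borel k x)"
  unfolding planes_borel_def
proof (rule measurable_vimage_algebra2)
  show "(\<lambda>w. closest_point (g w)) \<in> measurable N (\<Pi>\<^sub>M y\<in>UNIV. borel)"
    by (rule measurable_PiM_single'[where f="\<lambda>y w. closest_point (g w) y"]) (use assms in auto)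
qed (use assms in auto)

lemma dist_closest_point_measurable:
  "(\<lambda>(\<xi>, z). dist z (closest_point \<xi> z)) \<in> borel_measurable (planes_borel k x \<Otimes>\<^sub>M borel)"
proof -
  note [measurable] = closest_point_measurable_planes
  let ?f = "\<lambda>(\<xi>, z). dist z (closest_point \<xi> 0 + (\<Sum>b\<in>Basis. (z \<bullet> b) *\<^sub>R (closest_point \<xi> b - closest_point \<xi> 0)))"
  have "?f \<in> borel_measurable (planes_borel k x \<Otimes>\<^sub>M borel)" by measurable
  moreover have "?f w = (\<lambda>(\<xi>, z). dist z (closest_point \<xi> z)) w" if "w \<in> space (planes_borel k x \<Otimes>\<^sub>M borel)" for w
  proof -
    obtain \<xi> z where w: "w = (\<xi>, z)" by (cases w)
    with that have \<xi>: "\<xi> \<in> planes_through k x" by (auto simp: space_pair_measure)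
    show ?thesis
      using closest_point_affine_expand[OF planes_through_closed(3,2)[OF \<xi>], of z] by (simp add: w)
  qed
  ultimately show ?thesis by (rule measurable_cong[THEN iffD1, rotated])
qed

lemma rotation_matrix_isometry:
  fixes R :: "real ^ 'n ^ 'n"
  assumes "rotation_matrix R"
  shows "(R *v y) \<bullet> (R *v z) = y \<bullet> z" "transpose R *v (R *v y) = y" "R *v (transpose R *v y) = y"
    "rotation_matrix (transpose R)"
proof -
  have o: "orthogonal_matrix R" using assms by (simp add: rotation_matrix_def)
  then have "orthogonal_transformation (\<lambda>x. R *v x)"
    unfolding orthogonal_transformation_matrix by simp
  then show "(R *v y) \<bullet> (R *v z) = y \<bullet> z" by (simp add: orthogonal_transformation_def)
  show "transpose R *v (R *v y) = y" "R *v (transpose R *v y) = y"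
    using o unfolding orthogonal_matrix_def by (simp_all only: matrix_vector_mul_assoc matrix_vector_mul_lid)
  show "rotation_matrix (transpose R)"
    using assms by (simp add: rotation_matrix_def orthogonal_matrix_transpose det_transpose)
qed

lemma rotation_about_inverse:
  assumes "rotation_matrix R"
  shows "rotation_about x R (rotation_about x (transpose R) y) = y"
    "rotation_about x (transpose R) (rotation_about x R y) = y"
  unfolding rotation_about_def add_diff_cancel_left' rotation_matrix_isometry[OF assms] by simp_all

lemma rotation_about_diff:
  "rotation_about x R y - rotation_about x R z = R *v (y - z)"
  by (simp add: rotation_about_def matrix_vector_mult_diff_distrib[symmetric])

lemma dist_rotation_about:
  assumes "rotation_matrix R"
  shows "dist (rotation_about x R y) (rotation_about x R z) = dist y z"
  unfolding dist_norm rotation_about_diff norm_eq_sqrt_inner rotation_matrix_isometry[OF assms] ..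

lemma rotation_about_planes_through:
  assumes R: "rotation_matrix R" and \<xi>: "\<xi> \<in> planes_through k x"
  shows "rotation_about x R ` \<xi> \<in> planes_through k x"
proof -
  have eq: "rotation_about x R ` \<xi> = (\<lambda>y. (x - R *v x) + y) ` (\<lambda>y. R *v y) ` \<xi>"
    by (auto simp: rotation_about_def matrix_vector_mult_diff_distrib image_image algebra_simps)
  have inj: "inj (\<lambda>y. R *v y)" by (metis injI rotation_matrix_isometry(2)[OF R])
  have "affine ((\<lambda>y. R *v y) ` \<xi>)"
  proof -
    have "affine hull ((*v) R ` \<xi>) = (*v) R ` \<xi>"
      using affine_hull_linear_image[of "(*v) R" \<xi>] \<xi> by (simp add: planes_through_def hull_same)
    then show ?thesis by (metis affine_affine_hull)
  qed
  then have "affine (rotation_about x R ` \<xi>)"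
    unfolding eq by (simp add: affine_translation[symmetric])
  moreover have "aff_dim (rotation_about x R ` \<xi>) = int k"
    unfolding eq using \<xi> inj by (simp add: aff_dim_translation_eq planes_through_def)
  moreover have "x \<in> rotation_about x R ` \<xi>"
    using \<xi> by (auto simp: rotation_about_def planes_through_def intro!: image_eqI[of _ _ x])
  ultimately show ?thesis by (simp add: planes_through_def)
qed

lemma closest_point_rotation_about:
  assumes R: "rotation_matrix R" and \<xi>: "\<xi> \<in> planes_through k x"
  shows "closest_point (rotation_about x R ` \<xi>) (rotation_about x R z) = rotation_about x R (closest_point \<xi> z)"
proof (rule closest_point_affineI)
  show "affine (rotation_about x R ` \<xi>)"
    using rotation_about_planes_through[OF assms] planes_through_closed by blast
  note c = planes_through_closed[OF \<xi>]
  show "rotation_about x R (closest_point \<xi> z) \<in> rotation_about x R ` \<xi>"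
    using c by (intro imageI closest_point_in_set)
  fix y assume "y \<in> rotation_about x R ` \<xi>"
  then obtain y' where y: "y' \<in> \<xi>" "y = rotation_about x R y'" by blast
  show "(rotation_about x R z - rotation_about x R (closest_point \<xi> z)) \<bullet> (y - rotation_about x R (closest_point \<xi> z)) = 0"
    unfolding y(2) rotation_about_diff rotation_matrix_isometry[OF R]
    by (rule closest_point_affine_orthogonal[OF c(3) y(1)])
qed

lemma rotation_about_measurable_planes:
  assumes R: "rotation_matrix R"
  shows "(\<lambda>\<xi>. rotation_about x R ` \<xi>) \<in> measurable (planes_borel k x) (planes_borel k x)"
proof (rule measurable_planes_borelI)
  show "rotation_about x R ` \<xi> \<in> planes_through k x" if "\<xi> \<in> space (planes_borel k x)" for \<xi>
    using that rotation_about_planes_through[OF R] by simp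
  fix y
  let ?y = "rotation_about x (transpose R) y"
  have "continuous_on UNIV (rotation_about x R)"
    unfolding rotation_about_def matrix_vector_mult_diff_distrib by (intro continuous_intros)
  then have [measurable]: "rotation_about x R \<in> borel_measurable borel"
    by (rule borel_measurable_continuous_onI)
  note [measurable] = closest_point_measurable_planes
  have "(\<lambda>\<xi>. rotation_about x R (closest_point \<xi> ?y)) \<in> borel_measurable (planes_borel k x)"
    by measurable
  moreover have "rotation_about x R (closest_point \<xi> ?y) = closest_point (rotation_about x R ` \<xi>) y"
    if "\<xi> \<in> space (planes_borel k x)" for \<xi>
    using closest_point_rotation_about[OF R, of \<xi> k x ?y] that by (simp add: rotation_about_inverse[OF R])
  ultimately show "(\<lambda>\<xi>. closest_point (rotation_about x R ` \<xi>) y) \<in> borel_measurable (planes_borel k x)"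
    by (rule measurable_cong[THEN iffD1, rotated])
qed

text \<open>For countable \<open>D\<close> the distance to a parametrised set becomes a countable
  infimum, and so stays measurable in any parameter on which \<open>f\<close> depends
  measurably.\<close>

lemma infdist_dense_subset:
  fixes D W :: "'a::metric_space set" and f :: "'a \<Rightarrow> 'b::metric_space"
  assumes D: "D \<subseteq> W" "W \<subseteq> closure D" "D \<noteq> {}" and f: "continuous_on UNIV f"
  shows "infdist y (f ` W) = (INF w\<in>D. dist y (f w))"
proof -
  have "f ` closure D \<subseteq> closure (f ` D)"
    by (rule image_closure_subset) (use closure_subset[of "f ` D"] continuous_on_subset[OF f] in auto)
  then have "f ` W \<subseteq> closure (f ` D)" using D(2) by blast
  then have "infdist y (closure (f ` D)) \<le> infdist y (f ` W)"
    using D by (intro infdist_mono) auto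
  moreover have "infdist y (closure (f ` D)) = infdist y (f ` D)"
    by (simp add: infdist_eq_setdist)
  moreover have "infdist y (f ` W) \<le> infdist y (f ` D)"
    using D by (intro infdist_mono) auto
  ultimately have "infdist y (f ` W) = infdist y (f ` D)" by linarith
  then show ?thesis using D by (simp add: infdist_def image_image)
qed

text \<open>In place of Haar measure on the rotation group, a random matrix is used:
  \<open>A\<close> is uniform on a bounded open set of invertible matrices that is stable under
  rotations, and the plane is \<open>x\<close> plus the image of a fixed
  \<open>k\<close>-dimensional subspace under \<open>A\<close>. Vectors act from the left,
  \<open>w v* A\<close>, so that a rotation of the plane amounts to rotating each row of
  \<open>A\<close>, which preserves Lebesgue measure on matrices.\<close>

lemma invariant_prob_on_planes_exists:
  fixes x :: "real ^ 'n"
  assumes k: "k \<le> CARD('n)"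
  shows "\<exists>\<mu>. invariant_prob_on_planes k x \<mu>"
proof -
  obtain W :: "(real ^ 'n) set" where W: "subspace W" "dim W = k"
    using choose_subspace_of_subspace[of k "UNIV :: (real ^ 'n) set"] k by (auto simp: dim_UNIV)
  obtain D where D: "countable D" "D \<subseteq> W" "W \<subseteq> closure D"
    using separable by blast
  have "W \<noteq> {}" using W(1) subspace_0 by blast
  with D have "D \<noteq> {}" by auto
  \<comment> \<open>Large enough for the identity matrix to lie in \<open>E\<close>; a nonempty open
    bounded set has positive finite measure, as the uniform measure requires.\<close>
  define \<rho> where "\<rho> = norm (mat 1 :: real ^ 'n ^ 'n) + 1"
  define E where "E = {A :: real ^ 'n ^ 'n. norm A < \<rho> \<and> det A \<noteq> 0}"
  \<comment> \<open>The default outside \<open>E\<close> makes \<open>\<Xi> A\<close> a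
    \<open>k\<close>-plane for every matrix. As \<open>E\<close> has full measure for
    \<open>u\<close>, compatibility with rotations is required only on \<open>E\<close>.\<close>
  define act where "act A = (if A \<in> E then A else mat 1)" for A
  define \<Xi> where "\<Xi> A = (\<lambda>w. x + w v* act A) ` W" for A
  define u where "u = uniform_measure lborel E"
  have det_cont: "continuous_on UNIV (det :: real ^ 'n ^ 'n \<Rightarrow> real)"
    unfolding det_def by (intro continuous_intros)
  have "open E"
    unfolding E_def using det_cont
    by (intro open_Collect_conj open_Collect_less open_Collect_neq continuous_intros)
  then have E_sets [measurable]: "E \<in> sets borel" by simp
  have "E \<noteq> {}" by (auto simp: E_def \<rho>_def intro!: exI[of _ "mat 1"])
  have "E \<subseteq> ball 0 \<rho>" by (auto simp: E_def)
  then have "emeasure lborel E \<le> emeasure lborel (ball (0 :: real ^ 'n ^ 'n) \<rho>)"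
    by (intro emeasure_mono) auto
  then have "emeasure lborel E \<noteq> \<infinity>"
    using emeasure_lborel_ball_finite[of "0 :: real ^ 'n ^ 'n" \<rho>] by (auto simp: top_unique)
  moreover have E0: "emeasure lborel E \<noteq> 0"
  proof
    assume "emeasure lborel E = 0"
    then have "E \<in> null_sets lborel" by auto
    then show False
      using \<open>open E\<close> \<open>E \<noteq> {}\<close> open_not_negligible[of E] by (simp add: negligible_iff_null_sets null_sets_completion_iff)
  qed
  ultimately have prob: "prob_space u" unfolding u_def by (intro prob_space_uniform_measure) auto
  have sets_u: "sets u = sets borel" by (simp add: u_def)
  have det_act: "det (act A) \<noteq> 0" for A by (simp add: act_def E_def)
  have act_meas: "act \<in> borel_measurable u"
    unfolding act_def measurable_cong_sets[OF sets_u refl] by measurable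
  have plane: "\<Xi> A \<in> planes_through k x" for A
  proof -
    have "invertible (transpose (act A))"
      using det_act[of A] by (simp add: invertible_det_nz det_transpose)
    moreover have "(*v) (transpose (act A)) = (\<lambda>w. w v* act A)" by (rule ext) simp
    ultimately have inj: "inj (\<lambda>w. w v* act A)" by (metis inj_matrix_vector_mult)
    have lin: "linear (\<lambda>w. w v* act A)"
      using matrix_vector_mul_linear[of "transpose (act A)"] by simp
    have eq: "\<Xi> A = (+) x ` (\<lambda>w. w v* act A) ` W" by (auto simp: \<Xi>_def)
    have "subspace ((\<lambda>w. w v* act A) ` W)" using W(1) lin by (intro linear_subspace_image)
    moreover have "dim ((\<lambda>w. w v* act A) ` W) = k"
      using W(2) dim_image_eq[OF lin inj_on_subset[OF inj]] by simp
    moreover have "0 \<in> (\<lambda>w. w v* act A) ` W"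
      using calculation(1) by (rule subspace_0)
    ultimately show ?thesis
      unfolding eq planes_through_def
      by (auto simp: affine_translation[symmetric] subspace_imp_affine aff_dim_translation_eq aff_dim_subspace subspace_0 image_iff)
  qed
  have infdist_meas: "(\<lambda>A. infdist y (\<Xi> A)) \<in> borel_measurable u" for y
  proof -
    have "continuous_on UNIV (\<lambda>w. x + w v* act A)" for A
      unfolding transpose_matrix_vector[symmetric] by (intro continuous_intros)
    then have "infdist y (\<Xi> A) = (INF w\<in>D. dist y (x + w v* act A))" for A
      unfolding \<Xi>_def using D \<open>D \<noteq> {}\<close> by (intro infdist_dense_subset)
    moreover have "(\<lambda>A. dist y (x + w v* act A)) \<in> borel_measurable u" for w
    proof -
      have "continuous_on UNIV (\<lambda>A :: real ^ 'n ^ 'n. dist y (x + w v* A))"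
        unfolding vector_matrix_mult_def by (intro continuous_intros)
      then show ?thesis
        using measurable_compose[OF act_meas borel_measurable_continuous_onI] by blast
    qed
    ultimately show ?thesis using D(1) by (simp add: borel_measurable_cINF_real)
  qed
  have \<Xi>_meas: "\<Xi> \<in> measurable u (planes_borel k x)"
  proof (rule measurable_planes_borelI)
    fix y
    \<comment> \<open>Polarisation expresses each coordinate of the projection through distances to
      the plane, which are measurable in \<open>A\<close>.\<close>
    have "(\<lambda>A. closest_point (\<Xi> A) y \<bullet> e) \<in> borel_measurable u" for e
      unfolding closest_point_affine_polarisation[OF planes_through_closed(3,2)[OF plane]]
      using infdist_meas by measurable
    then show "(\<lambda>A. closest_point (\<Xi> A) y) \<in> borel_measurable u"
      by (subst borel_measurable_euclidean_space) auto
  qed (rule plane)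
  let ?\<mu> = "distr u (planes_borel k x) \<Xi>"
  have "distr ?\<mu> ?\<mu> (\<lambda>\<xi>. rotation_about x R ` \<xi>) = ?\<mu>" if R: "rotation_matrix R" for R
  proof -
    \<comment> \<open>Right multiplication by the transpose applies \<open>R\<close> to every row.
      Norm and determinant are unchanged, so \<open>T\<close> preserves \<open>E\<close> and, being
      a linear isometry, the uniform measure on it.\<close>
    define T where "T A = A ** transpose R" for A :: "real ^ 'n ^ 'n"
    have T_row: "T A $ i = R *v (A $ i)" for A i
      by (simp add: T_def matrix_matrix_mult_def matrix_vector_mult_def transpose_def vec_eq_iff mult.commute)
    have "norm (R *v y) = norm y" for y
      by (simp add: norm_eq_sqrt_inner rotation_matrix_isometry[OF R])
    then have norm_T: "norm (T A) = norm A" for A by (simp add: norm_vec_def T_row)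
    have lin_T: "linear T"
      by (rule linearI) (simp_all add: T_row vec_eq_iff matrix_vector_right_distrib matrix_vector_mult_scaleR)
    have T_distr: "distr lborel borel T = lborel" by (rule distr_lborel_linear_isometry[OF lin_T norm_T])
    have T_meas: "T \<in> borel_measurable borel"
      using lin_T by (intro borel_measurable_continuous_onI linear_continuous_on) (simp add: linear_conv_bounded_linear)
    have det_T: "det (T A) = det A" for A
      using R by (simp add: T_def det_mul det_transpose rotation_matrix_def)
    have T_E: "T A \<in> E \<longleftrightarrow> A \<in> E" for A by (simp add: E_def norm_T det_T)
    have u_T: "distr u u T = u"
    proof (rule measure_eqI)
      fix S assume "S \<in> sets (distr u u T)"
      then have S: "S \<in> sets borel" by (simp add: sets_u)
      have "emeasure lborel (E \<inter> T -` S) = emeasure (distr lborel borel T) (E \<inter> S)"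
        using S T_meas by (subst emeasure_distr) (auto simp: T_E vimage_def intro!: arg_cong[where f="emeasure lborel"])
      moreover have "T -` S \<in> sets borel" using measurable_sets[OF T_meas S] by simp
      moreover have "T \<in> measurable u u" using T_meas by (simp add: measurable_cong_sets[OF sets_u sets_u])
      ultimately show "emeasure (distr u u T) S = emeasure u S"
        using S by (simp add: emeasure_distr sets_u T_distr) (simp add: u_def T_distr)
    qed simp
    have rot: "rotation_about x R ` \<Xi> A = \<Xi> (T A)" if "A \<in> E" for A
    proof -
      have "w v* T A = R *v (w v* A)" for w
        unfolding T_def vector_matrix_mul_assoc[symmetric] by simp
      then show ?thesis
        using that by (simp add: \<Xi>_def act_def T_E image_image rotation_about_def)
    qed
    have "distr ?\<mu> ?\<mu> (\<lambda>\<xi>. rotation_about x R ` \<xi>) = distr u (planes_borel k x) (\<lambda>A. rotation_about x R ` \<Xi> A)"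
      using rotation_about_measurable_planes[OF R] \<Xi>_meas
      by (subst distr_distr) (auto simp: comp_def intro!: distr_cong)
    also have "\<dots> = distr u (planes_borel k x) (\<lambda>A. \<Xi> (T A))"
    proof (rule distr_cong_AE)
      have "AE A in u. A \<in> E" unfolding u_def by (rule AE_uniform_measureI) auto
      then show "AE A in u. rotation_about x R ` \<Xi> A = \<Xi> (T A)" by (rule eventually_mono) (rule rot)
      show "(\<lambda>A. rotation_about x R ` \<Xi> A) \<in> measurable u (planes_borel k x)"
        by (rule measurable_compose[OF \<Xi>_meas rotation_about_measurable_planes[OF R]])
      have "T \<in> measurable u u" using T_meas by (simp add: measurable_cong_sets[OF sets_u sets_u])
      then show "(\<lambda>A. \<Xi> (T A)) \<in> measurable u (planes_borel k x)" by (rule measurable_compose[OF _ \<Xi>_meas])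
    qed auto
    also have "\<dots> = distr (distr u u T) (planes_borel k x) \<Xi>"
      using T_meas \<Xi>_meas by (subst distr_distr) (auto simp: comp_def measurable_cong_sets[OF sets_u sets_u])
    finally show ?thesis by (simp add: u_T)
  qed
  moreover have "prob_space ?\<mu>" using prob_space.prob_space_distr[OF prob \<Xi>_meas] .
  ultimately have "invariant_prob_on_planes k x ?\<mu>"
    by (simp add: invariant_prob_on_planes_def)
  then show ?thesis by blast
qed

subsection \<open>The dual transform of the plane transform\<close>

lemma nn_integral_powr_finite:
  fixes p a :: real
  assumes "0 < p" "p < a"
  shows "(\<integral>\<^sup>+r\<in>{0<..}. ennreal (r powr (p - 1) * (1 + r) powr (- a)) \<partial>lborel) < \<infinity>"
proof -
  have 1: "(\<integral>\<^sup>+r. ennreal (indicator {0..1} r * r powr (p - 1)) \<partial>lborel) = ennreal (1 / p)"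
    using has_integral_powr_from_0[of "p - 1" 1] assms
    by (intro nn_integral_has_integral_lebesgue) auto
  have 2: "(\<integral>\<^sup>+r. ennreal (indicator {1..} r * r powr (p - 1 - a)) \<partial>lborel) = ennreal (- (1 / (p - a)))"
    using has_integral_powr_to_inf[of "p - 1 - a" 1] assms
    by (intro nn_integral_has_integral_lebesgue) auto
  have "(\<integral>\<^sup>+r\<in>{0<..}. ennreal (r powr (p - 1) * (1 + r) powr (- a)) \<partial>lborel)
    \<le> (\<integral>\<^sup>+r. ennreal (indicator {0..1} r * r powr (p - 1)) + ennreal (indicator {1..} r * r powr (p - 1 - a)) \<partial>lborel)"
  proof (rule nn_integral_mono)
    fix r :: real
    show "ennreal (r powr (p - 1) * (1 + r) powr (- a)) * indicator {0<..} r
      \<le> ennreal (indicator {0..1} r * r powr (p - 1)) + ennreal (indicator {1..} r * r powr (p - 1 - a))"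
    proof (cases "r > 0")
      case r: True
      show ?thesis
      proof (cases "r < 1")
        case True
        have "(1 + r) powr (- a) \<le> 1" using powr_mono2'[of "- a" 1 "1 + r"] r assms by simp
        then show ?thesis using r True by (auto intro!: ennreal_leI mult_left_le)
      next
        case False
        have "(1 + r) powr (- a) \<le> r powr (- a)" using r assms by (intro powr_mono2') auto
        then have "r powr (p - 1) * (1 + r) powr (- a) \<le> r powr (p - 1 - a)"
          by (simp add: diff_conv_add_uminus[of "p - 1" a] powr_add mult_left_mono del: diff_conv_add_uminus add_uminus_conv_diff)
        then have "ennreal (r powr (p - 1) * (1 + r) powr (- a)) \<le> ennreal (r powr (p - 1 - a))" by (rule ennreal_leI)
        then show ?thesis using False r by (auto intro: add_increasing)
      qed
    qed simp
  qed
  also have "\<dots> < \<infinity>"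
    by (subst nn_integral_add) (auto simp: 1 2)
  finally show ?thesis .
qed

lemma emeasure_plane_lborel_cball_center:
  assumes \<xi>: "\<xi> \<in> planes_through k x" and k: "k > 0" and r: "r > 0"
  shows "emeasure (plane_lborel \<xi>) (cball x r) = ennreal (unit_ball_vol k * r ^ k)"
  using emeasure_plane_lborel_cball[OF assms, of x] closest_point_self[of x \<xi>] planes_through_closed(4)[OF \<xi>] r
  by simp

lemma emeasure_plane_lborel_cball_finite:
  assumes \<xi>: "\<xi> \<in> planes_through k x" and k: "k > 0"
  shows "emeasure (plane_lborel \<xi>) (cball z r) < \<infinity>"
proof -
  have "emeasure (plane_lborel \<xi>) (cball z r) \<le> emeasure (plane_lborel \<xi>) (cball z (max r 1))"
    using \<xi> by (intro emeasure_mono) (auto simp: sets_plane_lborel[OF \<xi>])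
  also have "\<dots> < \<infinity>" using emeasure_plane_lborel_cball[OF assms, of "max r 1" z] by simp
  finally show ?thesis .
qed

text \<open>The constant is the ratio of the areas of the unit spheres in dimensions
  \<open>k\<close> and \<open>n\<close>. With it, a ball about \<open>x\<close> receives the volume
  of a \<open>k\<close>-dimensional ball of the same radius.\<close>

definition riesz_density :: "nat \<Rightarrow> real ^ 'n \<Rightarrow> real ^ 'n \<Rightarrow> real" where
  "riesz_density k x y = k * unit_ball_vol k / (CARD('n) * unit_ball_vol CARD('n)) * dist x y powr (real k - CARD('n))"

lemma riesz_density_nonneg: "riesz_density k x y \<ge> 0"
  by (simp add: riesz_density_def)

lemma riesz_density_measurable [measurable]: "riesz_density k x \<in> borel_measurable borel"
  unfolding riesz_density_def by measurable

definition riesz_measure :: "nat \<Rightarrow> real ^ 'n \<Rightarrow> (real ^ 'n) measure" where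
  "riesz_measure k x = density lborel (\<lambda>y. ennreal (riesz_density k x y))"

lemma sets_riesz_measure [simp, measurable_cong]: "sets (riesz_measure k x) = sets borel"
  by (simp add: riesz_measure_def)

lemma nn_integral_polar_lborel:
  fixes x :: "real ^ 'n"
  assumes "F \<in> borel_measurable borel"
  shows "(\<integral>\<^sup>+y. F (dist x y) \<partial>lborel) =
    (\<integral>\<^sup>+r\<in>{0<..}. F r * ennreal (CARD('n) * unit_ball_vol CARD('n) * r ^ (CARD('n) - 1)) \<partial>lborel)"
  using assms by (intro nn_integral_polar) (auto simp: emeasure_cball)

lemma nn_integral_polar_powr:
  fixes x :: "real ^ 'n" and s :: real
  assumes [measurable]: "F \<in> borel_measurable borel"
  shows "(\<integral>\<^sup>+y. ennreal (dist x y powr (s - CARD('n))) * F (dist x y) \<partial>lborel) =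
    ennreal (CARD('n) * unit_ball_vol CARD('n)) * (\<integral>\<^sup>+r\<in>{0<..}. ennreal (r powr (s - 1)) * F r \<partial>lborel)"
proof -
  let ?n = "CARD('n)"
  let ?c = "?n * unit_ball_vol ?n"
  have "(\<integral>\<^sup>+y. ennreal (dist x y powr (s - ?n)) * F (dist x y) \<partial>lborel)
    = (\<integral>\<^sup>+r\<in>{0<..}. ennreal (r powr (s - ?n)) * F r * ennreal (?c * r ^ (?n - 1)) \<partial>lborel)"
    by (rule nn_integral_polar_lborel[where F="\<lambda>r. ennreal (r powr (s - ?n)) * F r"]) measurable
  also have "\<dots> = (\<integral>\<^sup>+r. ennreal ?c * (ennreal (r powr (s - 1)) * F r * indicator {0<..} r) \<partial>lborel)"
  proof (rule nn_integral_cong)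
    fix r :: real
    show "ennreal (r powr (s - ?n)) * F r * ennreal (?c * r ^ (?n - 1)) * indicator {0<..} r
      = ennreal ?c * (ennreal (r powr (s - 1)) * F r * indicator {0<..} r)"
    proof (cases "r > 0")
      case True
      then have "r powr (s - ?n) * r ^ (?n - 1) = r powr (s - 1)"
        by (simp add: powr_realpow[symmetric] of_nat_diff powr_add[symmetric])
      then have "ennreal (r powr (s - ?n)) * ennreal (r ^ (?n - 1)) = ennreal (r powr (s - 1))"
        using True by (simp add: ennreal_mult[symmetric])
      then have "(ennreal (r powr (s - ?n)) * ennreal (r ^ (?n - 1))) * (ennreal ?c * F r) = ennreal (r powr (s - 1)) * (ennreal ?c * F r)"
        by simp
      then have "ennreal (r powr (s - ?n)) * F r * (ennreal ?c * ennreal (r ^ (?n - 1))) = ennreal ?c * (ennreal (r powr (s - 1)) * F r)"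
        by (simp only: mult_ac)
      then show ?thesis using True by (simp add: ennreal_mult)
    qed simp
  qed
  also have "\<dots> = ennreal ?c * (\<integral>\<^sup>+r\<in>{0<..}. ennreal (r powr (s - 1)) * F r \<partial>lborel)"
    by (rule nn_integral_cmult) measurable
  finally show ?thesis .
qed

lemma nn_integral_polar_plane:
  assumes "\<xi> \<in> planes_through k x" "k > 0" "F \<in> borel_measurable borel"
  shows "(\<integral>\<^sup>+y. F (dist x y) \<partial>plane_lborel \<xi>) =
    (\<integral>\<^sup>+r\<in>{0<..}. F r * ennreal (k * unit_ball_vol k * r ^ (k - 1)) \<partial>lborel)"
  using assms by (intro nn_integral_polar) (auto simp: emeasure_plane_lborel_cball_center sets_plane_lborel)

text \<open>The right-hand side is that of \<open>nn_integral_polar_plane\<close>: on radial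
  functions the weighted measure is indistinguishable from the measure on any plane through
  \<open>x\<close>.\<close>

lemma nn_integral_polar_riesz:
  fixes x :: "real ^ 'n"
  assumes k: "k > 0" and F [measurable]: "F \<in> borel_measurable borel"
  shows "(\<integral>\<^sup>+y. F (dist x y) \<partial>riesz_measure k x) =
    (\<integral>\<^sup>+r\<in>{0<..}. F r * ennreal (k * unit_ball_vol k * r ^ (k - 1)) \<partial>lborel)"
proof -
  let ?n = "CARD('n)"
  let ?K = "k * unit_ball_vol k"
  let ?N = "?n * unit_ball_vol ?n"
  have N: "?N > 0" by simp
  have "(\<integral>\<^sup>+y. F (dist x y) \<partial>riesz_measure k x) =
    (\<integral>\<^sup>+y. ennreal (?K / ?N * dist x y powr (real k - ?n)) * F (dist x y) \<partial>lborel)"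
    unfolding riesz_measure_def by (subst nn_integral_density) (simp_all add: riesz_density_def)
  also have "\<dots> = (\<integral>\<^sup>+y. ennreal (?K / ?N) * (ennreal (dist x y powr (real k - ?n)) * F (dist x y)) \<partial>lborel)"
    by (subst ennreal_mult) (auto simp: mult.assoc)
  also have "\<dots> = ennreal (?K / ?N) * (\<integral>\<^sup>+y. ennreal (dist x y powr (real k - ?n)) * F (dist x y) \<partial>lborel)"
    by (rule nn_integral_cmult) measurable
  also have "\<dots> = (ennreal (?K / ?N) * ennreal ?N) * (\<integral>\<^sup>+r\<in>{0<..}. ennreal (r powr (real k - 1)) * F r \<partial>lborel)"
    by (simp only: nn_integral_polar_powr[OF F] mult.assoc)
  also have "ennreal (?K / ?N) * ennreal ?N = ennreal ?K"
  proof -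
    have "?N \<noteq> 0" using N by (rule less_imp_neq[symmetric])
    then have e: "?K / ?N * ?N = ?K" using nonzero_eq_divide_eq[of ?N "?K / ?N" ?K] by blast
    have "?K / ?N \<ge> 0" by simp
    then show ?thesis using N by (simp only: ennreal_mult[symmetric] e less_imp_le)
  qed
  also have "ennreal ?K * (\<integral>\<^sup>+r\<in>{0<..}. ennreal (r powr (real k - 1)) * F r \<partial>lborel) =
    (\<integral>\<^sup>+r. ennreal ?K * (ennreal (r powr (real k - 1)) * F r * indicator {0<..} r) \<partial>lborel)"
    by (rule nn_integral_cmult[symmetric]) measurable
  also have "\<dots> = (\<integral>\<^sup>+r\<in>{0<..}. F r * ennreal (?K * r ^ (k - 1)) \<partial>lborel)"
    using k by (intro nn_integral_cong)
      (auto simp: indicator_def ennreal_mult powr_realpow[symmetric] of_nat_diff mult_ac)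
  finally show ?thesis .
qed

lemma emeasure_riesz_measure_finite:
  fixes x :: "real ^ 'n"
  assumes k: "k > 0"
  shows "emeasure (riesz_measure k x) (cball z r) < \<infinity>"
proof -
  define R where "R = dist x z + max r 0"
  have "cball z r \<subseteq> cball x R"
    unfolding R_def by (rule subsetI) (metis mem_cball add_left_mono dist_triangle le_max_iff_disj order_trans)
  then have "emeasure (riesz_measure k x) (cball z r) \<le> emeasure (riesz_measure k x) (cball x R)"
    by (intro emeasure_mono) auto
  also have "\<dots> = (\<integral>\<^sup>+y. indicator (cball x R) y \<partial>riesz_measure k x)" by simp
  also have "\<dots> = (\<integral>\<^sup>+y. indicator {..R} (dist x y) \<partial>riesz_measure k x)"
    by (intro nn_integral_cong) (auto split: split_indicator)
  also have "\<dots> = (\<integral>\<^sup>+s\<in>{0<..}. indicator {..R} s * ennreal (k * unit_ball_vol k * s ^ (k - 1)) \<partial>lborel)"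
    using k by (intro nn_integral_polar_riesz) auto
  also have "\<dots> \<le> (\<integral>\<^sup>+s. ennreal (k * unit_ball_vol k * R ^ (k - 1)) * indicator {0..R} s \<partial>lborel)"
    by (intro nn_integral_mono) (auto simp: indicator_def intro!: ennreal_leI mult_left_mono power_mono)
  also have "\<dots> < \<infinity>"
    using emeasure_lborel_cbox_finite[of 0 R] by (subst nn_integral_cmult_indicator) (auto simp: ennreal_mult_less_top)
  finally show ?thesis .
qed

text \<open>A form of \<open>C_decay\<close> with an explicit constant. The summand 1 makes the
  bound valid on the whole space, including the origin.\<close>

definition decays :: "real \<Rightarrow> real \<Rightarrow> (real ^ 'n \<Rightarrow> complex) \<Rightarrow> bool" where
  "decays a A f \<longleftrightarrow> continuous_on UNIV f \<and> 0 \<le> a \<and> 0 \<le> A \<and> (\<forall>y. norm (f y) \<le> A * (1 + norm y) powr (- a))"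

lemma decays_continuous: "decays a A f \<Longrightarrow> continuous_on UNIV f"
  by (simp add: decays_def)

lemma decays_measurable: "decays a A f \<Longrightarrow> f \<in> borel_measurable borel"
  using decays_continuous borel_measurable_continuous_onI by blast

text \<open>Moves the decay from the origin to \<open>x\<close> by the inequality 1 + |x - y| \<le>
  (1 + |x|)(1 + |y|), at the price of a factor that depends on \<open>x\<close>.\<close>

lemma decays_dist:
  assumes "decays a A f"
  shows "norm (f y) \<le> A * (1 + norm x) powr a * (1 + dist x y) powr (- a)"
proof -
  have "0 \<le> norm x * norm y" by simp
  moreover have "dist x y \<le> norm x + norm y" unfolding dist_norm by (rule norm_triangle_ineq4)
  moreover have "(1 + norm x) * (1 + norm y) = 1 + norm x + norm y + norm x * norm y" by (simp add: algebra_simps)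
  ultimately have "1 + dist x y \<le> (1 + norm x) * (1 + norm y)" by linarith
  then have "((1 + norm x) * (1 + norm y)) powr (- a) \<le> (1 + dist x y) powr (- a)"
    using assms by (intro powr_mono2') (auto simp: decays_def intro: add_pos_nonneg)
  then have "(1 + norm x) powr (- a) * (1 + norm y) powr (- a) \<le> (1 + dist x y) powr (- a)"
    by (simp add: powr_mult add_nonneg_nonneg)
  then have "(1 + norm x) powr a * ((1 + norm x) powr (- a) * (1 + norm y) powr (- a)) \<le> (1 + norm x) powr a * (1 + dist x y) powr (- a)"
    by (rule mult_left_mono) simp
  moreover have "(1 + norm x) powr a * (1 + norm x) powr (- a) = 1"
    by (simp add: powr_add[symmetric] add_pos_nonneg less_imp_neq[symmetric])
  ultimately have "(1 + norm y) powr (- a) \<le> (1 + norm x) powr a * (1 + dist x y) powr (- a)"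
    by (metis mult.assoc mult_1)
  then have "A * (1 + norm y) powr (- a) \<le> A * ((1 + norm x) powr a * (1 + dist x y) powr (- a))"
    using assms by (intro mult_left_mono) (auto simp: decays_def)
  then show ?thesis using assms by (auto simp: decays_def mult.assoc intro: order_trans)
qed

text \<open>Within distance 1 the weight 1 + |x - y| changes by at most a factor 2. The right-hand
  side is the majorant used in \<open>dominated_on_balls\<close>.\<close>

lemma decays_dist_near:
  assumes f: "decays a A f" and yz: "dist y z \<le> 1"
  shows "norm (f z) \<le> A * (1 + norm x) powr a * 2 powr a * (1 + dist x y) powr (- a)"
proof -
  have a: "a \<ge> 0" "A \<ge> 0" using f by (auto simp: decays_def)
  have "(1 + dist x y) / 2 \<le> 1 + dist x z"
    using dist_triangle[of x y z] yz zero_le_dist[of x z] by (simp add: dist_commute field_simps del: zero_le_dist)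
  then have "(1 + dist x z) powr (- a) \<le> ((1 + dist x y) / 2) powr (- a)"
    using a by (intro powr_mono2') (auto intro: add_pos_nonneg)
  also have "\<dots> = 2 powr a * (1 + dist x y) powr (- a)"
    by (simp add: powr_divide powr_minus_divide add_nonneg_nonneg)
  finally have "A * (1 + norm x) powr a * (1 + dist x z) powr (- a) \<le> A * (1 + norm x) powr a * (2 powr a * (1 + dist x y) powr (- a))"
    using a by (intro mult_left_mono) auto
  then show ?thesis using decays_dist[OF f, of z x] by (simp add: mult.assoc)
qed

lemma radial_integral_finite:
  fixes a :: real
  assumes "k > 0" "a > real k"
  shows "(\<integral>\<^sup>+r\<in>{0<..}. ennreal ((1 + r) powr (- a)) * ennreal (k * unit_ball_vol k * r ^ (k - 1)) \<partial>lborel) < \<infinity>"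
proof -
  have "(\<integral>\<^sup>+r\<in>{0<..}. ennreal ((1 + r) powr (- a)) * ennreal (k * unit_ball_vol k * r ^ (k - 1)) \<partial>lborel)
    = (\<integral>\<^sup>+r. ennreal (k * unit_ball_vol k) * (ennreal (r powr (real k - 1) * (1 + r) powr (- a)) * indicator {0<..} r) \<partial>lborel)"
  proof (rule nn_integral_cong)
    fix r :: real
    have "r ^ (k - 1) = r powr (real k - 1)" if "r > 0"
      using that assms(1) by (simp add: powr_realpow[symmetric] of_nat_diff)
    then show "ennreal ((1 + r) powr (- a)) * ennreal (k * unit_ball_vol k * r ^ (k - 1)) * indicator {0<..} r
      = ennreal (k * unit_ball_vol k) * (ennreal (r powr (real k - 1) * (1 + r) powr (- a)) * indicator {0<..} r)"
      by (cases "r > 0") (auto simp: ennreal_mult[symmetric] mult_ac)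
  qed
  also have "\<dots> = ennreal (k * unit_ball_vol k) * (\<integral>\<^sup>+r\<in>{0<..}. ennreal (r powr (real k - 1) * (1 + r) powr (- a)) \<partial>lborel)"
    by (subst nn_integral_cmult) auto
  also have "\<dots> < \<infinity>"
    using nn_integral_powr_finite[of "real k" a] assms by (auto simp: ennreal_mult_less_top)
  finally show ?thesis .
qed

text \<open>The value in the second part does not mention \<open>M\<close>. It therefore bounds ball
  averages uniformly over all planes through \<open>x\<close>.\<close>

lemma integrable_radial_weight:
  assumes "sets M = sets borel"
    and "\<And>F. F \<in> borel_measurable borel \<Longrightarrow> (\<integral>\<^sup>+y. F (dist x y) \<partial>M) =
      (\<integral>\<^sup>+r\<in>{0<..}. F r * ennreal (k * unit_ball_vol k * r ^ (k - 1)) \<partial>lborel)"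
    and "k > 0" "a > real k"
  shows "integrable M (\<lambda>y. (1 + dist x y) powr (- a))"
    "(\<integral>y. (1 + dist x y) powr (- a) \<partial>M) = enn2real
      (\<integral>\<^sup>+r\<in>{0<..}. ennreal ((1 + r) powr (- a)) * ennreal (k * unit_ball_vol k * r ^ (k - 1)) \<partial>lborel)"
proof -
  have meas: "(\<lambda>y. (1 + dist x y) powr (- a)) \<in> borel_measurable M"
    unfolding measurable_cong_sets[OF assms(1) refl]
    by (intro borel_measurable_continuous_onI continuous_intros) (auto simp: add_nonneg_eq_0_iff)
  have eq: "(\<integral>\<^sup>+y. ennreal ((1 + dist x y) powr (- a)) \<partial>M) =
    (\<integral>\<^sup>+r\<in>{0<..}. ennreal ((1 + r) powr (- a)) * ennreal (k * unit_ball_vol k * r ^ (k - 1)) \<partial>lborel)"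
    by (rule assms(2)[where F="\<lambda>r. ennreal ((1 + r) powr (- a))"]) measurable
  show "integrable M (\<lambda>y. (1 + dist x y) powr (- a))"
    using meas eq radial_integral_finite[OF assms(3,4)] by (intro integrableI_bounded) auto
  show "(\<integral>y. (1 + dist x y) powr (- a) \<partial>M) = enn2real
      (\<integral>\<^sup>+r\<in>{0<..}. ennreal ((1 + r) powr (- a)) * ennreal (k * unit_ball_vol k * r ^ (k - 1)) \<partial>lborel)"
    using meas by (subst integral_eq_nn_integral) (auto simp: eq)
qed

lemma dominated_on_balls_radial:
  fixes f :: "real ^ 'n \<Rightarrow> complex"
  assumes f: "decays a A f" and M: "sets M = sets borel" "\<And>z r. emeasure M (cball z r) < \<infinity>"
    and polar: "\<And>F. F \<in> borel_measurable borel \<Longrightarrow> (\<integral>\<^sup>+y. F (dist x y) \<partial>M) =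
      (\<integral>\<^sup>+r\<in>{0<..}. F r * ennreal (k * unit_ball_vol k * r ^ (k - 1)) \<partial>lborel)"
    and k: "k > 0" "a > real k"
  shows "dominated_on_balls M f (\<lambda>y. A * (1 + norm x) powr a * 2 powr a * (1 + dist x y) powr (- a))"
  using M decays_continuous[OF f] decays_dist_near[OF f] integrable_radial_weight(1)[OF M(1) polar k]
  by unfold_locales auto

lemma dominated_on_balls_plane:
  assumes "decays a A f" "\<xi> \<in> planes_through k x" "k > 0" "a > real k"
  shows "dominated_on_balls (plane_lborel \<xi>) f (\<lambda>y. A * (1 + norm x) powr a * 2 powr a * (1 + dist x y) powr (- a))"
  using assms
  by (intro dominated_on_balls_radial nn_integral_polar_plane sets_plane_lborel emeasure_plane_lborel_cball_finite)

lemma dominated_on_balls_riesz: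
  assumes "decays a A f" "k > 0" "a > real k"
  shows "dominated_on_balls (riesz_measure k x) f (\<lambda>y. A * (1 + norm x) powr a * 2 powr a * (1 + dist x y) powr (- a))"
  using assms nn_integral_polar_riesz[OF assms(2), of _ x]
  by (intro dominated_on_balls_radial sets_riesz_measure emeasure_riesz_measure_finite)

text \<open>Both measures below are compared by integrating over radial sets of centres \<open>z\<close>: by symmetry
  of \<open>dist z y \<le> r\<close> this turns into the integral of a radial function of \<open>y\<close>.\<close>
lemma nn_integral_radial_cball:
  fixes x :: "real ^ 'n" and E :: "real set"
  assumes M: "sets M = sets borel" "\<And>z r. emeasure M (cball z r) < \<infinity>"
    and polar: "\<And>F. F \<in> borel_measurable borel \<Longrightarrow> (\<integral>\<^sup>+y. F (dist x y) \<partial>M) =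
      (\<integral>\<^sup>+r\<in>{0<..}. F r * ennreal (k * unit_ball_vol k * r ^ (k - 1)) \<partial>lborel)"
    and E: "E \<in> sets borel" and n: "CARD('n) \<ge> 2" and e: "norm (e :: real ^ 'n) = 1"
  shows "(\<integral>\<^sup>+z. indicator E (dist x z) * emeasure M (cball z r) \<partial>lborel) =
    (\<integral>\<^sup>+s\<in>{0<..}. (\<integral>\<^sup>+z. indicator E (dist x z) * indicator (cball (x + s *\<^sub>R e) r) z \<partial>lborel) *
       ennreal (k * unit_ball_vol k * s ^ (k - 1)) \<partial>lborel)"
proof -
  interpret M: sigma_finite_measure M using M by (rule sigma_finite_measure_cball)
  interpret pair_sigma_finite M "lborel :: (real ^ 'n) measure" ..
  define \<psi> where "\<psi> y = (\<integral>\<^sup>+z. indicator E (dist x z) * indicator (cball y r) z \<partial>lborel)" for y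
  note [measurable] = E
  have pair: "(\<lambda>(y, z). indicator E (dist x z) * indicator (cball y r) z :: ennreal) \<in> borel_measurable (borel \<Otimes>\<^sub>M borel)"
  proof -
    have "(\<lambda>(y::real^'n, z). indicator E (dist x z) * indicator {w. dist (fst w) (snd w) \<le> r} (y, z) :: ennreal) \<in> borel_measurable (borel \<Otimes>\<^sub>M borel)"
      by measurable
    then show ?thesis by (simp add: indicator_def cball_def)
  qed
  have \<psi>_meas [measurable]: "\<psi> \<in> borel_measurable borel"
  proof -
    have "(\<lambda>(y, z). indicator E (dist x z) * indicator (cball y r) z :: ennreal) \<in> borel_measurable (borel \<Otimes>\<^sub>M lborel)"
      using pair by (simp add: measurable_cong_sets[OF sets_pair_measure_cong[OF refl sets_lborel] refl])
    then show ?thesis unfolding \<psi>_def using lborel.borel_measurable_nn_integral by simp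
  qed
  \<comment> \<open>A rotation about \<open>x\<close> that moves \<open>y\<close> onto the ray in
    direction \<open>e\<close> preserves Lebesgue measure, distances to \<open>x\<close> and the
    relation \<open>dist z y \<le> r\<close>, hence \<open>\<psi>\<close>.\<close>
  have \<psi>_radial: "\<psi> y = \<psi> (x + dist x y *\<^sub>R e)" for y
  proof -
    have "norm (y - x) = norm (dist x y *\<^sub>R e)" using e by (simp add: dist_norm norm_minus_commute)
    then obtain R where R: "orthogonal_transformation R" "R (y - x) = dist x y *\<^sub>R e"
      using rotation_exists[OF n] by metis
    define T where "T z = x + R (z - x)" for z
    have lin: "linear R" and norm_R: "norm (R v) = norm v" for v
      using R(1) by (auto simp: orthogonal_transformation)
    have iso: "dist (T u) (T v) = dist u v" for u v
      by (simp add: T_def dist_norm linear_diff[OF lin, symmetric] norm_R)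
    have Tx: "T x = x" by (simp add: T_def linear_0[OF lin])
    have "surj T"
    proof (rule surjI)
      fix z show "T (x + inv R (z - x)) = z"
        using orthogonal_transformation_surj[OF R(1)] by (simp add: T_def surj_f_inv_f)
    qed
    then have T: "distr lborel borel T = lborel" using iso by (rule distr_lborel_isometry)
    have "continuous_on UNIV T" by (rule continuous_onI) (use iso in auto)
    then have [measurable]: "T \<in> borel_measurable borel" by (rule borel_measurable_continuous_onI)
    have "\<psi> (T y) = (\<integral>\<^sup>+z. indicator E (dist x z) * indicator (cball (T y) r) z \<partial>distr lborel borel T)"
      by (simp add: \<psi>_def T)
    also have "\<dots> = (\<integral>\<^sup>+z. indicator E (dist x (T z)) * indicator (cball (T y) r) (T z) \<partial>lborel)"
      by (rule nn_integral_distr) (measurable, simp)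
    also have "\<dots> = \<psi> y"
      unfolding \<psi>_def using iso[of x] iso[of y] by (simp add: Tx indicator_def)
    finally show ?thesis by (simp add: T_def R(2))
  qed
  have "(\<integral>\<^sup>+z. indicator E (dist x z) * emeasure M (cball z r) \<partial>lborel) =
    (\<integral>\<^sup>+z. (\<integral>\<^sup>+y. indicator E (dist x z) * indicator (cball y r) z \<partial>M) \<partial>lborel)"
  proof (rule nn_integral_cong)
    fix z
    have "(\<integral>\<^sup>+y. indicator E (dist x z) * indicator (cball y r) z \<partial>M) = (\<integral>\<^sup>+y. indicator E (dist x z) * indicator (cball z r) y \<partial>M)"
      by (intro nn_integral_cong) (auto simp: indicator_def dist_commute)
    also have "\<dots> = indicator E (dist x z) * emeasure M (cball z r)"
      using M(1) by (subst nn_integral_cmult_indicator) auto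
    finally show "indicator E (dist x z) * emeasure M (cball z r) = (\<integral>\<^sup>+y. indicator E (dist x z) * indicator (cball y r) z \<partial>M)" ..
  qed
  also have "\<dots> = (\<integral>\<^sup>+y. \<psi> y \<partial>M)"
    unfolding \<psi>_def
    using pair by (intro Fubini') (simp add: measurable_cong_sets[OF sets_pair_measure_cong[OF M(1) sets_lborel] refl])
  also have "\<dots> = (\<integral>\<^sup>+y. \<psi> (x + dist x y *\<^sub>R e) \<partial>M)" using \<psi>_radial by simp
  also have "\<dots> = (\<integral>\<^sup>+s\<in>{0<..}. \<psi> (x + s *\<^sub>R e) * ennreal (k * unit_ball_vol k * s ^ (k - 1)) \<partial>lborel)"
    by (rule polar[where F="\<lambda>s. \<psi> (x + s *\<^sub>R e)"]) measurable
  finally show ?thesis by (simp add: \<psi>_def)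
qed

section \<open>Averaging the plane measures over the invariant measure\<close>

lemma emeasure_plane_cball_measurable:
  fixes x :: "real ^ 'n"
  assumes \<mu>: "sets \<mu> = sets (planes_borel k x)" and k: "k > 0" and r: "r > 0"
  shows "(\<lambda>(\<xi>, z). emeasure (plane_lborel \<xi>) (cball z r)) \<in> borel_measurable (\<mu> \<Otimes>\<^sub>M lborel)"
proof -
  have "(\<lambda>(\<xi>, z). dist z (closest_point \<xi> z)) \<in> borel_measurable (\<mu> \<Otimes>\<^sub>M lborel)"
    using dist_closest_point_measurable
    by (simp add: measurable_cong_sets[OF sets_pair_measure_cong[OF \<mu> sets_lborel] refl])
  then have "(\<lambda>w. ennreal (unit_ball_vol k * sqrt (max 0 (r\<^sup>2 - ((\<lambda>(\<xi>, z). dist z (closest_point \<xi> z)) w)\<^sup>2)) ^ k))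
      \<in> borel_measurable (\<mu> \<Otimes>\<^sub>M lborel)"
    by measurable
  moreover have "ennreal (unit_ball_vol k * sqrt (max 0 (r\<^sup>2 - ((\<lambda>(\<xi>, z). dist z (closest_point \<xi> z)) w)\<^sup>2)) ^ k)
      = (\<lambda>(\<xi>, z). emeasure (plane_lborel \<xi>) (cball z r)) w" if "w \<in> space (\<mu> \<Otimes>\<^sub>M lborel)" for w
  proof -
    obtain \<xi> z where w: "w = (\<xi>, z)" by (cases w)
    with that have "\<xi> \<in> planes_through k x"
      using sets_eq_imp_space_eq[OF \<mu>] by (auto simp: space_pair_measure)
    then show ?thesis using emeasure_plane_lborel_cball[OF _ k r, of \<xi> x z] by (simp add: w)
  qed
  ultimately show ?thesis by (rule measurable_cong[THEN iffD1, rotated])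
qed

text \<open>Read off from the formula in terms of the distance to the plane, which avoids
  transporting the chosen coordinates of one plane to the other.\<close>

lemma emeasure_plane_cball_rotation:
  assumes R: "rotation_matrix R" and \<xi>: "\<xi> \<in> planes_through k x" and k: "k > 0" and r: "r > 0"
  shows "emeasure (plane_lborel (rotation_about x R ` \<xi>)) (cball (rotation_about x R z) r) =
    emeasure (plane_lborel \<xi>) (cball z r)"
  using emeasure_plane_lborel_cball[OF \<xi> k r] emeasure_plane_lborel_cball[OF rotation_about_planes_through[OF R \<xi>] k r]
  by (simp add: closest_point_rotation_about[OF R \<xi>] dist_rotation_about[OF R])

lemma rotation_about_exists:
  fixes x :: "real ^ 'n"
  assumes "CARD('n) \<ge> 2" "dist x y = dist x z"
  obtains R where "rotation_matrix R" "rotation_about x R y = z"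
proof -
  have "norm (y - x) = norm (z - x)" using assms(2) by (simp add: dist_norm norm_minus_commute)
  then obtain f where f: "orthogonal_transformation f" "det (matrix f) = 1" "f (y - x) = z - x"
    using rotation_exists[OF assms(1)] by metis
  have "linear f" using f(1) by (simp add: orthogonal_transformation)
  then have "matrix f *v v = f v" for v by (simp add: matrix_works)
  moreover have "rotation_matrix (matrix f)"
    using f by (simp add: rotation_matrix_def orthogonal_transformation_matrix)
  ultimately show thesis using f(3) by (intro that[of "matrix f"]) (auto simp: rotation_about_def)
qed

lemma distr_lborel_rotation_about:
  assumes "rotation_matrix R"
  shows "distr lborel borel (rotation_about x R) = lborel"
  using assms by (intro distr_lborel_isometry surjI[of _ "rotation_about x (transpose R)"])
    (auto simp: rotation_about_inverse dist_rotation_about)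

lemma rotation_about_borel_measurable: "rotation_about x R \<in> borel_measurable borel"
  unfolding rotation_about_def matrix_vector_mult_diff_distrib
  by (intro borel_measurable_continuous_onI continuous_intros)

lemma emeasure_riesz_rotation:
  assumes R: "rotation_matrix R"
  shows "emeasure (riesz_measure k x) (cball (rotation_about x R z) r) = emeasure (riesz_measure k x) (cball z r)"
proof -
  note [measurable] = rotation_about_borel_measurable
  let ?T = "rotation_about x R"
  have Tx: "?T x = x" by (simp add: rotation_about_def)
  have riesz: "emeasure (riesz_measure k x) (cball w r) = (\<integral>\<^sup>+y. ennreal (riesz_density k x y) * indicator (cball w r) y \<partial>lborel)" for w
    unfolding riesz_measure_def by (subst emeasure_density) auto
  have "emeasure (riesz_measure k x) (cball (?T z) r) = (\<integral>\<^sup>+y. ennreal (riesz_density k x y) * indicator (cball (?T z) r) y \<partial>distr lborel borel ?T)"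
    unfolding riesz distr_lborel_rotation_about[OF R] ..
  also have "\<dots> = (\<integral>\<^sup>+y. ennreal (riesz_density k x (?T y)) * indicator (cball (?T z) r) (?T y) \<partial>lborel)"
    by (rule nn_integral_distr) (measurable, simp)
  also have "\<dots> = emeasure (riesz_measure k x) (cball z r)"
    unfolding riesz using dist_rotation_about[OF R, of x x] dist_rotation_about[OF R, of x z]
    by (simp add: Tx indicator_def riesz_density_def)
  finally show ?thesis .
qed

text \<open>Both sides are radial in \<open>z\<close>, so it suffices that their integrals agree
  over every set of \<open>z\<close> with \<open>dist x z\<close> in a Borel set \<open>E\<close>.
  \<open>nn_integral_radial_cball\<close> evaluates these integrals to the same expression for each
  plane and for \<open>riesz_measure\<close>. Equality almost everywhere is enough for ball
  averages, which integrate over the centre.\<close>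

lemma AE_averaged_cball:
  fixes x :: "real ^ 'n"
  assumes \<mu>: "invariant_prob_on_planes k x \<mu>" and n: "CARD('n) \<ge> 2" and k: "k > 0" and r: "r > 0"
  shows "AE z in lborel. (\<integral>\<^sup>+\<xi>. emeasure (plane_lborel \<xi>) (cball z r) \<partial>\<mu>) = emeasure (riesz_measure k x) (cball z r)"
proof -
  have sets_\<mu>: "sets \<mu> = sets (planes_borel k x)" and prob: "prob_space \<mu>"
    and inv: "\<And>R. rotation_matrix R \<Longrightarrow> distr \<mu> \<mu> (\<lambda>\<xi>. rotation_about x R ` \<xi>) = \<mu>"
    using \<mu> by (auto simp: invariant_prob_on_planes_def)
  have space_\<mu>: "space \<mu> = planes_through k x" using sets_eq_imp_space_eq[OF sets_\<mu>] by simp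
  interpret prob_space \<mu> by (rule prob)
  note joint = emeasure_plane_cball_measurable[OF sets_\<mu> k r]
  define \<phi> where "\<phi> z = (\<integral>\<^sup>+\<xi>. emeasure (plane_lborel \<xi>) (cball z r) \<partial>\<mu>)" for z
  define \<phi>' where "\<phi>' z = emeasure (riesz_measure k x) (cball z r)" for z
  obtain i :: 'n where True by simp
  define e :: "real ^ 'n" where "e = axis i 1"
  have e: "norm e = 1" by (simp add: e_def)
  have meas_\<phi> [measurable]: "\<phi> \<in> borel_measurable borel"
  proof -
    have "(\<lambda>(z, \<xi>). emeasure (plane_lborel \<xi>) (cball z r)) \<in> borel_measurable (lborel \<Otimes>\<^sub>M \<mu>)"
      using measurable_pair_swap[OF joint] by (simp add: case_prod_beta')
    from borel_measurable_nn_integral[OF this] show ?thesis unfolding \<phi>_def by simp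
  qed
  interpret pair_sigma_finite \<mu> "lborel :: (real ^ 'n) measure" ..
  have meas_\<phi>' [measurable]: "\<phi>' \<in> borel_measurable borel"
  proof -
    interpret R: sigma_finite_measure "riesz_measure k x"
      using emeasure_riesz_measure_finite[OF k] by (intro sigma_finite_measure_cball) auto
    have "{w \<in> space (borel \<Otimes>\<^sub>M borel) :: ((real ^ 'n) \<times> (real ^ 'n)) set. dist (fst w) (snd w) \<le> r} \<in> sets (borel \<Otimes>\<^sub>M borel)"
      by measurable
    then have "{w :: (real ^ 'n) \<times> (real ^ 'n). dist (fst w) (snd w) \<le> r} \<in> sets (borel \<Otimes>\<^sub>M borel)"
      by (simp add: space_pair_measure)
    then have "{w :: (real ^ 'n) \<times> (real ^ 'n). dist (fst w) (snd w) \<le> r} \<in> sets (borel \<Otimes>\<^sub>M riesz_measure k x)"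
      using sets_pair_measure_cong[OF refl sets_riesz_measure] by blast
    from R.measurable_emeasure_Pair[OF this] show ?thesis
      unfolding \<phi>'_def by (simp add: vimage_def cball_def)
  qed
  \<comment> \<open>Radiality of \<open>\<phi>\<close> comes from the invariance of
    \<open>\<mu>\<close>, that of \<open>\<phi>'\<close> from the rotation invariance of Lebesgue
    measure.\<close>
  have rad: "\<phi> z = \<phi> z' \<and> \<phi>' z = \<phi>' z'" if zz: "dist x z = dist x z'" for z z'
  proof -
    obtain R where R: "rotation_matrix R" "rotation_about x R z = z'"
      using rotation_about_exists[OF n zz] .
    have m: "(\<lambda>\<xi>. emeasure (plane_lborel \<xi>) (cball z' r)) \<in> borel_measurable \<mu>"
      using measurable_compose[OF measurable_Pair2' joint, of z'] by simp
    have rot: "(\<lambda>\<xi>. rotation_about x R ` \<xi>) \<in> measurable \<mu> \<mu>"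
      using rotation_about_measurable_planes[OF R(1)] by (simp add: measurable_cong_sets[OF sets_\<mu> sets_\<mu>])
    have "\<phi> z' = (\<integral>\<^sup>+\<xi>. emeasure (plane_lborel \<xi>) (cball z' r) \<partial>distr \<mu> \<mu> (\<lambda>\<xi>. rotation_about x R ` \<xi>))"
      by (simp add: \<phi>_def inv[OF R(1)])
    also have "\<dots> = (\<integral>\<^sup>+\<xi>. emeasure (plane_lborel (rotation_about x R ` \<xi>)) (cball z' r) \<partial>\<mu>)"
      using rot m by (subst nn_integral_distr) auto
    also have "\<dots> = \<phi> z"
      unfolding \<phi>_def R(2)[symmetric]
      by (intro nn_integral_cong emeasure_plane_cball_rotation[OF R(1) _ k r]) (simp add: space_\<mu>)
    finally have "\<phi> z = \<phi> z'" ..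
    moreover have "\<phi>' z = \<phi>' z'" unfolding \<phi>'_def R(2)[symmetric] by (rule emeasure_riesz_rotation[OF R(1), symmetric])
    ultimately show ?thesis ..
  qed
  \<comment> \<open>Radial profiles along the ray in direction \<open>e\<close>. With
    \<open>N\<close>, the image of Lebesgue measure under the distance to \<open>x\<close>, the
    claim becomes uniqueness of densities on the real line.\<close>
  define a where "a s = \<phi> (x + s *\<^sub>R e)" for s
  define a' where "a' s = \<phi>' (x + s *\<^sub>R e)" for s
  have [measurable]: "a \<in> borel_measurable borel" "a' \<in> borel_measurable borel"
    unfolding a_def a'_def by measurable
  have aa: "\<phi> z = a (dist x z)" "\<phi>' z = a' (dist x z)" for z
    using rad[of z "x + dist x z *\<^sub>R e"] e by (auto simp: a_def a'_def dist_norm)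
  define N where "N = distr lborel borel (dist x)"
  have "sigma_finite_measure N"
  proof
    have "emeasure N {..real i} \<noteq> \<infinity>" for i
    proof -
      have "emeasure N {..real i} = emeasure lborel (cball x (real i))"
        unfolding N_def by (subst emeasure_distr) (auto intro!: arg_cong[where f="emeasure lborel"] simp: cball_def)
      then show ?thesis using emeasure_lborel_cball_finite[of x "real i"] by auto
    qed
    moreover have "(\<Union>i. {..real i}) = UNIV" by (auto intro: real_arch_simple)
    ultimately show "\<exists>A. countable A \<and> A \<subseteq> sets N \<and> \<Union>A = space N \<and> (\<forall>a\<in>A. emeasure N a \<noteq> \<infinity>)"
      by (intro exI[of _ "range (\<lambda>i::nat. {..real i})"]) (auto simp: N_def)
  qed
  then interpret N: sigma_finite_measure N .
  have "density N a = density N a'"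
  proof (rule measure_eqI)
    fix E assume "E \<in> sets (density N a)"
    then have E [measurable]: "E \<in> sets borel" by (simp add: N_def)
    have dens: "emeasure (density N b) E = (\<integral>\<^sup>+z. indicator E (dist x z) * b (dist x z) \<partial>lborel)"
      if [measurable]: "b \<in> borel_measurable borel" for b
    proof -
      have "emeasure (density N b) E = (\<integral>\<^sup>+s. b s * indicator E s \<partial>N)"
        by (subst emeasure_density) (auto simp: N_def)
      also have "\<dots> = (\<integral>\<^sup>+z. b (dist x z) * indicator E (dist x z) \<partial>lborel)"
        unfolding N_def by (rule nn_integral_distr) measurable
      finally show ?thesis by (simp add: mult.commute)
    qed
    let ?I = "(\<integral>\<^sup>+s\<in>{0<..}. (\<integral>\<^sup>+z. indicator E (dist x z) * indicator (cball (x + s *\<^sub>R e) r) z \<partial>lborel) *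
       ennreal (k * unit_ball_vol k * s ^ (k - 1)) \<partial>lborel)"
    have "emeasure (density N a) E = (\<integral>\<^sup>+z. indicator E (dist x z) * \<phi> z \<partial>lborel)"
      by (simp add: dens aa)
    also have "\<dots> = (\<integral>\<^sup>+z. (\<integral>\<^sup>+\<xi>. indicator E (dist x z) * emeasure (plane_lborel \<xi>) (cball z r) \<partial>\<mu>) \<partial>lborel)"
      unfolding \<phi>_def
      using measurable_compose[OF measurable_Pair2' joint] by (intro nn_integral_cong nn_integral_cmult[symmetric]) simp
    also have "\<dots> = (\<integral>\<^sup>+\<xi>. (\<integral>\<^sup>+z. indicator E (dist x z) * emeasure (plane_lborel \<xi>) (cball z r) \<partial>lborel) \<partial>\<mu>)"
    proof (rule Fubini')
      have "(\<lambda>w. indicator E (dist x (snd w)) * (\<lambda>(\<xi>, z). emeasure (plane_lborel \<xi>) (cball z r)) w) \<in> borel_measurable (\<mu> \<Otimes>\<^sub>M lborel)"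
        using joint by measurable
      then show "(\<lambda>(\<xi>, z). indicator E (dist x z) * emeasure (plane_lborel \<xi>) (cball z r)) \<in> borel_measurable (\<mu> \<Otimes>\<^sub>M lborel)"
        by (simp add: case_prod_beta')
    qed
    \<comment> \<open>\<open>?I\<close> does not mention the plane: the radial formula is the same
      for every plane through \<open>x\<close>, so averaging it over a probability measure has no
      effect.\<close>
    also have "\<dots> = (\<integral>\<^sup>+\<xi>. ?I \<partial>\<mu>)"
      using space_\<mu>
      by (intro nn_integral_cong nn_integral_radial_cball[OF _ _ _ E n e] nn_integral_polar_plane[OF _ k]
          sets_plane_lborel emeasure_plane_lborel_cball_finite[OF _ k]) auto
    also have "\<dots> = ?I" by (simp add: emeasure_space_1)
    also have "\<dots> = (\<integral>\<^sup>+z. indicator E (dist x z) * \<phi>' z \<partial>lborel)"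
      unfolding \<phi>'_def using nn_integral_polar_riesz[OF k, of _ x] emeasure_riesz_measure_finite[OF k]
      by (intro nn_integral_radial_cball[OF _ _ _ E n e, symmetric]) auto
    also have "\<dots> = emeasure (density N a') E" by (simp add: dens aa)
    finally show "emeasure (density N a) E = emeasure (density N a') E" .
  qed simp
  then have "AE s in N. a s = a' s"
    by (intro N.density_unique) (auto simp: N_def)
  then have "AE z in lborel. a (dist x z) = a' (dist x z)"
    unfolding N_def by (subst (asm) AE_distr_iff) auto
  then show ?thesis by (simp add: aa[symmetric] \<phi>_def \<phi>'_def)
qed

text \<open>For fixed radius, Fubini on planes and centres turns the mean of the ball averages over
  planes into the ball average of \<open>riesz_measure\<close>. Letting the radius tend to 0 on both
  sides gives the two integrals.\<close>

lemma dual_plane_transform: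
  fixes f :: "real ^ 'n \<Rightarrow> complex"
  assumes f: "decays a A f" and n: "CARD('n) \<ge> 2" and k: "k > 0" "k \<le> CARD('n)" and a: "a > real k"
  shows "dual_transform k (plane_transform f) x = (\<integral>y. riesz_density k x y *\<^sub>R f y \<partial>lborel)"
proof -
  define \<mu> where "\<mu> = planes_measure k x"
  have \<mu>: "invariant_prob_on_planes k x \<mu>"
    unfolding \<mu>_def planes_measure_def using invariant_prob_on_planes_exists[OF k(2)] by (rule someI_ex)
  then have sets_\<mu>: "sets \<mu> = sets (planes_borel k x)" and prob: "prob_space \<mu>"
    by (auto simp: invariant_prob_on_planes_def)
  have space_\<mu>: "space \<mu> = planes_through k x" using sets_eq_imp_space_eq[OF sets_\<mu>] by simp
  interpret prob_space \<mu> by (rule prob)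
  interpret pair_sigma_finite \<mu> "lborel :: (real ^ 'n) measure" ..
  let ?b = "\<lambda>\<xi>. ball_average (plane_lborel \<xi>) f"
  let ?w = "\<lambda>y. A * (1 + norm x) powr a * 2 powr a * (1 + dist x y) powr (- a)"
  \<comment> \<open>The integral of the majorant over a plane, common to all planes through
    \<open>x\<close>. Being constant, it is integrable over the probability measure
    \<open>\<mu>\<close> and dominates the limit below.\<close>
  define W where "W = A * (1 + norm x) powr a * 2 powr a * enn2real
      (\<integral>\<^sup>+r\<in>{0<..}. ennreal ((1 + r) powr (- a)) * ennreal (k * unit_ball_vol k * r ^ (k - 1)) \<partial>lborel)"
  note dom = dominated_on_balls_plane[OF f _ k(1) a]
  note dom' = dominated_on_balls_riesz[OF f k(1) a, of x]
  have W: "(\<integral>y. ?w y \<partial>plane_lborel \<xi>) = W" if "\<xi> \<in> planes_through k x" for \<xi>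
    using integrable_radial_weight[OF sets_plane_lborel[OF that] nn_integral_polar_plane[OF that k(1)] k(1) a]
    by (simp add: W_def)
  have avg: "integrable \<mu> (\<lambda>\<xi>. ?b \<xi> r)" 
    "(\<integral>\<xi>. ?b \<xi> r \<partial>\<mu>) = ball_average (riesz_measure k x) f r"
    if r: "0 < r" "r \<le> 1" for r
  proof -
    let ?V = "measure lborel (cball (0::real^'n) r)"
    let ?F = "\<lambda>\<xi> z. measure (plane_lborel \<xi>) (cball z r) *\<^sub>R f z"
    have V: "?V > 0" using r by simp
    note joint = emeasure_plane_cball_measurable[OF sets_\<mu> k(1) r(1)]
    have joint': "(\<lambda>(\<xi>, z). measure (plane_lborel \<xi>) (cball z r)) \<in> borel_measurable (\<mu> \<Otimes>\<^sub>M lborel)"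
    proof -
      have "(\<lambda>w. enn2real ((\<lambda>(\<xi>, z). emeasure (plane_lborel \<xi>) (cball z r)) w)) \<in> borel_measurable (\<mu> \<Otimes>\<^sub>M lborel)"
        using joint by measurable
      then show ?thesis by (simp add: measure_def case_prod_beta')
    qed
    have [measurable]: "f \<in> borel_measurable borel" using f by (rule decays_measurable)
    have int: "integrable (\<mu> \<Otimes>\<^sub>M lborel) (\<lambda>(\<xi>, z). ?F \<xi> z)"
    proof (rule Fubini_integrable, unfold prod.case)
      have "(\<lambda>w. (\<lambda>(\<xi>, z). measure (plane_lborel \<xi>) (cball z r)) w *\<^sub>R f (snd w)) \<in> borel_measurable (\<mu> \<Otimes>\<^sub>M lborel)"
        using joint' by measurable
      then show m: "(\<lambda>(\<xi>, z). ?F \<xi> z) \<in> borel_measurable (\<mu> \<Otimes>\<^sub>M lborel)" by (simp add: case_prod_beta')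
      show "AE \<xi> in \<mu>. integrable lborel (\<lambda>z. ?F \<xi> z)"
        using dominated_on_balls.integrable_measure_cball[OF dom r] by (intro AE_I2) (simp add: space_\<mu>)
      have bound: "(\<integral>z. norm (?F \<xi> z) \<partial>lborel) \<le> ?V * W" if "\<xi> \<in> planes_through k x" for \<xi>
      proof -
        have "norm (ball_average (plane_lborel \<xi>) (\<lambda>z. norm (f z)) r) \<le> W"
          using dominated_on_balls.norm_ball_average[OF dominated_on_balls.dominated_norm[OF dom[OF that]] r] W[OF that] by simp
        then show ?thesis using V by (simp add: ball_average_def field_simps)
      qed
      show "integrable \<mu> (\<lambda>\<xi>. \<integral>z. norm (?F \<xi> z) \<partial>lborel)"
      proof (rule integrable_const_bound)
        show "AE \<xi> in \<mu>. norm (\<integral>z. norm (?F \<xi> z) \<partial>lborel) \<le> ?V * W"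
          using bound by (intro AE_I2) (simp add: space_\<mu> integral_nonneg)
        show "(\<lambda>\<xi>. \<integral>z. norm (?F \<xi> z) \<partial>lborel) \<in> borel_measurable \<mu>"
          using m by measurable
      qed
    qed
    show "integrable \<mu> (\<lambda>\<xi>. ?b \<xi> r)"
      unfolding ball_average_def using integrable_fst[OF int] by simp
    have "(\<integral>\<xi>. (\<integral>z. ?F \<xi> z \<partial>lborel) \<partial>\<mu>) = (\<integral>z. (\<integral>\<xi>. ?F \<xi> z \<partial>\<mu>) \<partial>lborel)"
      by (rule Fubini_integral[OF int, symmetric])
    also have "\<dots> = (\<integral>z. measure (riesz_measure k x) (cball z r) *\<^sub>R f z \<partial>lborel)"
    proof (rule integral_cong_AE)
      show "(\<lambda>z. \<integral>\<xi>. ?F \<xi> z \<partial>\<mu>) \<in> borel_measurable lborel"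
        using integrable_snd[OF int] by (rule borel_measurable_integrable)
      show "(\<lambda>z. measure (riesz_measure k x) (cball z r) *\<^sub>R f z) \<in> borel_measurable lborel"
        using dominated_on_balls.integrable_measure_cball[OF dom' r] by (rule borel_measurable_integrable)
      show "AE z in lborel. (\<integral>\<xi>. ?F \<xi> z \<partial>\<mu>) = measure (riesz_measure k x) (cball z r) *\<^sub>R f z"
        using AE_averaged_cball[OF \<mu> n k(1) r(1)]
      proof (rule eventually_mono)
        fix z assume z: "(\<integral>\<^sup>+\<xi>. emeasure (plane_lborel \<xi>) (cball z r) \<partial>\<mu>) = emeasure (riesz_measure k x) (cball z r)"
        have m: "(\<lambda>\<xi>. measure (plane_lborel \<xi>) (cball z r)) \<in> borel_measurable \<mu>"
          using measurable_compose[OF measurable_Pair2' joint', of z] by simp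
        have "(\<integral>\<^sup>+\<xi>. ennreal (measure (plane_lborel \<xi>) (cball z r)) \<partial>\<mu>) = emeasure (riesz_measure k x) (cball z r)"
          unfolding z[symmetric]
        proof (rule nn_integral_cong)
          fix \<xi> assume "\<xi> \<in> space \<mu>"
          then have "emeasure (plane_lborel \<xi>) (cball z r) < \<infinity>"
            unfolding space_\<mu> by (rule emeasure_plane_lborel_cball_finite[OF _ k(1)])
          then show "ennreal (measure (plane_lborel \<xi>) (cball z r)) = emeasure (plane_lborel \<xi>) (cball z r)"
            by (intro emeasure_eq_ennreal_measure[symmetric]) auto
        qed
        moreover have "emeasure (riesz_measure k x) (cball z r) = ennreal (measure (riesz_measure k x) (cball z r))"
          using emeasure_riesz_measure_finite[OF k(1), of x z r] by (intro emeasure_eq_ennreal_measure) auto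
        ultimately have "has_bochner_integral \<mu> (\<lambda>\<xi>. measure (plane_lborel \<xi>) (cball z r)) (measure (riesz_measure k x) (cball z r))"
          using m by (intro has_bochner_integral_nn_integral) auto
        then have "has_bochner_integral \<mu> (\<lambda>\<xi>. ?F \<xi> z) (measure (riesz_measure k x) (cball z r) *\<^sub>R f z)"
          by (intro has_bochner_integral_scaleR_left)
        then show "(\<integral>\<xi>. ?F \<xi> z \<partial>\<mu>) = measure (riesz_measure k x) (cball z r) *\<^sub>R f z"
          by (rule has_bochner_integral_integral_eq)
      qed
    qed
    finally show "(\<integral>\<xi>. ?b \<xi> r \<partial>\<mu>) = ball_average (riesz_measure k x) f r"
      by (simp add: ball_average_def)
  qed
  define r where "r j = inverse (real (Suc j))" for j
  have r: "0 < r j" "r j \<le> 1" for j by (auto simp: r_def field_simps)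
  have lim: "(\<lambda>j. ?b \<xi> (r j)) \<longlonglongrightarrow> plane_transform f \<xi>" if "\<xi> \<in> planes_through k x" for \<xi>
    unfolding plane_transform_def r_def by (rule dominated_on_balls.ball_average_tendsto[OF dom[OF that]])
  have "(\<lambda>j. \<integral>\<xi>. ?b \<xi> (r j) \<partial>\<mu>) \<longlonglongrightarrow> (\<integral>\<xi>. plane_transform f \<xi> \<partial>\<mu>)"
  proof (rule integral_dominated_convergence[where w="\<lambda>_. W"])
    show m: "(\<lambda>\<xi>. ?b \<xi> (r j)) \<in> borel_measurable \<mu>" for j
      using avg(1)[OF r] by (rule borel_measurable_integrable)
    \<comment> \<open>The plane transform becomes measurable only here, as a pointwise limit of ball
      averages.\<close>
    show "plane_transform f \<in> borel_measurable \<mu>"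
      by (rule borel_measurable_LIMSEQ_metric[OF m]) (use lim space_\<mu> in auto)
    show "AE \<xi> in \<mu>. (\<lambda>j. ?b \<xi> (r j)) \<longlonglongrightarrow> plane_transform f \<xi>"
      using lim space_\<mu> by (intro AE_I2) auto
    show "AE \<xi> in \<mu>. norm (?b \<xi> (r j)) \<le> W" for j
      using dominated_on_balls.norm_ball_average[OF dom r] W space_\<mu> by (intro AE_I2) (metis (no_types, lifting))
  qed simp
  moreover have "(\<lambda>j. ball_average (riesz_measure k x) f (r j)) \<longlonglongrightarrow> (\<integral>y. f y \<partial>riesz_measure k x)"
    unfolding r_def by (rule dominated_on_balls.ball_average_tendsto[OF dom'])
  ultimately have "(\<integral>\<xi>. plane_transform f \<xi> \<partial>\<mu>) = (\<integral>y. f y \<partial>riesz_measure k x)"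
    unfolding avg(2)[OF r] by (rule LIMSEQ_unique)
  also have "\<dots> = (\<integral>y. riesz_density k x y *\<^sub>R f y \<partial>lborel)"
    unfolding riesz_measure_def using decays_measurable[OF f]
    by (intro integral_density) (auto simp: riesz_density_nonneg)
  finally show ?thesis by (simp add: dual_transform_def \<mu>_def)
qed

subsection \<open>The Riesz composition formula\<close>

lemma nn_integral_Gamma:
  fixes p c :: real
  assumes "p > 0" "c > 0"
  shows "(\<integral>\<^sup>+s\<in>{0<..}. ennreal (s powr (p - 1) * exp (- (c * s))) \<partial>lborel) = ennreal (Gamma p * c powr (- p))"
proof -
  have Gpos: "Gamma p > 0" using assms(1) by (rule Gamma_real_pos)
  have "(\<integral>\<^sup>+s\<in>{0<..}. ennreal (s powr (p - 1) * exp (- (c * s))) \<partial>lborel)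
    = (\<integral>\<^sup>+s. ennreal (indicator {0..} s * (s powr (p - 1) * exp (- (c * s)))) \<partial>lborel)"
    by (intro nn_integral_cong) (auto simp: indicator_def)
  also have "\<dots> = ennreal \<bar>1 / c\<bar> * (\<integral>\<^sup>+t. ennreal (indicator {0..} (0 + 1 / c * t) * ((0 + 1 / c * t) powr (p - 1) * exp (- (c * (0 + 1 / c * t))))) \<partial>lborel)"
    using assms by (intro nn_integral_real_affine) auto
  also have "(\<integral>\<^sup>+t. ennreal (indicator {0..} (0 + 1 / c * t) * ((0 + 1 / c * t) powr (p - 1) * exp (- (c * (0 + 1 / c * t))))) \<partial>lborel)
     = (\<integral>\<^sup>+t. ennreal (c powr (1 - p)) * ennreal (indicator {0..} t * t powr (p - 1) / exp t) \<partial>lborel)"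
  proof (rule nn_integral_cong)
    fix t :: real
    show "ennreal (indicator {0..} (0 + 1 / c * t) * ((0 + 1 / c * t) powr (p - 1) * exp (- (c * (0 + 1 / c * t)))))
      = ennreal (c powr (1 - p)) * ennreal (indicator {0..} t * t powr (p - 1) / exp t)"
    proof (cases "t \<ge> 0")
      case True
      have "(t / c) powr (p - 1) = t powr (p - 1) * c powr (1 - p)"
        using True assms powr_minus_divide[of c "p - 1"] by (simp add: powr_divide)
      then have "(0 + 1 / c * t) powr (p - 1) * exp (- (c * (0 + 1 / c * t))) = c powr (1 - p) * (t powr (p - 1) / exp t)"
        using assms by (simp add: exp_minus field_simps)
      then show ?thesis using True assms by (simp add: ennreal_mult[symmetric])
    next
      case False
      then have "\<not> 0 \<le> 1 / c * t" using assms by (simp add: field_simps)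
      with False show ?thesis by (simp add: indicator_def)
    qed
  qed
  also have "\<dots> = ennreal (c powr (1 - p)) * ennreal (Gamma p)"
    by (subst nn_integral_cmult) (auto simp: Gamma_conv_nn_integral_real[OF assms(1)])
  also have "ennreal \<bar>1 / c\<bar> * (ennreal (c powr (1 - p)) * ennreal (Gamma p)) = ennreal (1 / c * (c powr (1 - p) * Gamma p))"
    using assms Gpos by (simp add: ennreal_mult[symmetric])
  also have "1 / c * (c powr (1 - p) * Gamma p) = Gamma p * c powr (- p)"
    using assms by (simp add: powr_diff powr_minus field_simps)
  finally show ?thesis .
qed

text \<open>Integrate v^(p-1) u^(p+q-1) exp(-(1+v)u) over the quadrant: \<open>u\<close> first gives
  Gamma(p+q) times the left-hand side, \<open>v\<close> first gives Gamma(p) Gamma(q).\<close>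

lemma nn_integral_Beta_prime:
  fixes p q :: real
  assumes "p > 0" "q > 0"
  shows "(\<integral>\<^sup>+v\<in>{0<..}. ennreal (v powr (p - 1) * (1 + v) powr (- (p + q))) \<partial>lborel) =
    ennreal (Gamma p * Gamma q / Gamma (p + q))"
proof -
  have Gpos: "Gamma p > 0" "Gamma q > 0" "Gamma (p + q) > 0" using assms by (auto intro!: Gamma_real_pos)
  let ?K = "\<lambda>v u. ennreal (v powr (p - 1) * (u powr (p + q - 1) * exp (- ((1 + v) * u)))) * indicator {0<..} u * indicator {0<..} v :: ennreal"
  let ?I = "\<integral>\<^sup>+v\<in>{0<..}. ennreal (v powr (p - 1) * (1 + v) powr (- (p + q))) \<partial>lborel"
  have "ennreal (Gamma (p + q)) * ?I =
    (\<integral>\<^sup>+v. ennreal (Gamma (p + q)) * (ennreal (v powr (p - 1) * (1 + v) powr (- (p + q))) * indicator {0<..} v) \<partial>lborel)"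
    by (rule nn_integral_cmult[symmetric]) measurable
  also have "\<dots> = (\<integral>\<^sup>+v. (\<integral>\<^sup>+u. ?K v u \<partial>lborel) \<partial>lborel)"
  proof (rule nn_integral_cong)
    fix v :: real
    show "ennreal (Gamma (p + q)) * (ennreal (v powr (p - 1) * (1 + v) powr (- (p + q))) * indicator {0<..} v)
      = (\<integral>\<^sup>+u. ?K v u \<partial>lborel)"
    proof (cases "v > 0")
      case True
      have "(\<integral>\<^sup>+u. ?K v u \<partial>lborel)
        = (\<integral>\<^sup>+u. ennreal (v powr (p - 1)) * (ennreal (u powr (p + q - 1) * exp (- ((1 + v) * u))) * indicator {0<..} u) \<partial>lborel)"
        using True by (intro nn_integral_cong) (auto simp: ennreal_mult indicator_def)
      also have "\<dots> = ennreal (v powr (p - 1)) * ennreal (Gamma (p + q) * (1 + v) powr (- (p + q)))"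
        using True assms by (subst nn_integral_cmult) (auto simp: nn_integral_Gamma)
      also have "\<dots> = ennreal (Gamma (p + q)) * (ennreal (v powr (p - 1) * (1 + v) powr (- (p + q))) * indicator {0<..} v)"
        using True Gpos by (simp add: ennreal_mult[symmetric] mult_ac)
      finally show ?thesis ..
    qed simp
  qed
  also have "\<dots> = (\<integral>\<^sup>+u. (\<integral>\<^sup>+v. ?K v u \<partial>lborel) \<partial>lborel)"
    by (rule lborel_pair.Fubini') measurable
  also have "\<dots> = (\<integral>\<^sup>+u. ennreal (Gamma p) * (ennreal (u powr (q - 1) * exp (- (1 * u))) * indicator {0<..} u) \<partial>lborel)"
  proof (rule nn_integral_cong)
    fix u :: real
    show "(\<integral>\<^sup>+v. ?K v u \<partial>lborel)
      = ennreal (Gamma p) * (ennreal (u powr (q - 1) * exp (- (1 * u))) * indicator {0<..} u)"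
    proof (cases "u > 0")
      case True
      have "(\<integral>\<^sup>+v. ?K v u \<partial>lborel)
        = (\<integral>\<^sup>+v. ennreal (u powr (p + q - 1) * exp (- u)) * (ennreal (v powr (p - 1) * exp (- (u * v))) * indicator {0<..} v) \<partial>lborel)"
        using True by (intro nn_integral_cong) (auto simp: ennreal_mult[symmetric] indicator_def exp_add[symmetric] algebra_simps)
      also have "\<dots> = ennreal (u powr (p + q - 1) * exp (- u)) * ennreal (Gamma p * u powr (- p))"
        using True assms by (subst nn_integral_cmult) (auto simp: nn_integral_Gamma)
      also have "\<dots> = ennreal (Gamma p * ((u powr (p + q - 1) * u powr (- p)) * exp (- u)))"
        using Gpos by (simp add: ennreal_mult[symmetric] mult_ac)
      also have "u powr (p + q - 1) * u powr (- p) = u powr (q - 1)" by (simp add: powr_add[symmetric])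
      finally show ?thesis using True Gpos by (simp add: ennreal_mult)
    qed simp
  qed
  also have "\<dots> = ennreal (Gamma p) * ennreal (Gamma q)"
    using nn_integral_Gamma[of q 1] assms by (subst nn_integral_cmult) auto
  finally have "ennreal (Gamma (p + q)) * ?I = ennreal (Gamma (p + q)) * ennreal (Gamma p * Gamma q / Gamma (p + q))"
    using Gpos by (simp add: ennreal_mult[symmetric])
  then show ?thesis using Gpos by (subst (asm) ennreal_mult_cancel_left) auto
qed

text \<open>The sublevel sets of the squared distance have volume proportional to r^(n/2), so
  \<open>nn_integral_power_density\<close> reduces the Gaussian to a Gamma integral.\<close>

lemma nn_integral_Gaussian:
  fixes m :: "real ^ 'n"
  assumes c: "c > 0"
  shows "(\<integral>\<^sup>+z. ennreal (exp (- (c * (dist m z)\<^sup>2))) \<partial>lborel) = ennreal ((pi / c) powr (CARD('n) / 2))"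
proof -
  let ?n = "real CARD('n)"
  have sub: "emeasure lborel {z \<in> space lborel. (dist m z)\<^sup>2 \<le> r} = ennreal (unit_ball_vol ?n * r powr (?n / 2))" if "r > 0" for r
  proof -
    have "{z \<in> space lborel. (dist m z)\<^sup>2 \<le> r} = cball m (sqrt r)"
      using that real_le_rsqrt[of _ r] by (auto simp: real_sqrt_le_iff' dest: real_le_rsqrt sqrt_le_D) 
        (metis abs_of_nonneg less_imp_le power2_le_iff_abs_le real_sqrt_ge_zero real_sqrt_pow2 zero_le_dist)
    moreover have "sqrt r ^ CARD('n) = r powr (?n / 2)"
      using that by (simp add: powr_half_sqrt[symmetric] powr_powr powr_realpow[symmetric])
    ultimately show ?thesis using that by (simp add: emeasure_cball)
  qed
  have G: "Gamma (?n / 2) > 0" by (intro Gamma_real_pos) auto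
  have "(\<integral>\<^sup>+z. ennreal (exp (- (c * (dist m z)\<^sup>2))) \<partial>lborel)
    = (\<integral>\<^sup>+r\<in>{0<..}. ennreal (exp (- (c * r))) * ennreal (?n / 2 * unit_ball_vol ?n * r powr (?n / 2 - 1)) \<partial>lborel)"
    by (rule nn_integral_power_density[where F="\<lambda>r. ennreal (exp (- (c * r)))", OF _ _ _ sub]) auto
  also have "\<dots> = (\<integral>\<^sup>+r. ennreal (?n / 2 * unit_ball_vol ?n) * (ennreal (r powr (?n / 2 - 1) * exp (- (c * r))) * indicator {0<..} r) \<partial>lborel)"
    by (intro nn_integral_cong) (auto simp: ennreal_mult[symmetric] indicator_def mult_ac)
  also have "\<dots> = ennreal (?n / 2 * unit_ball_vol ?n) * ennreal (Gamma (?n / 2) * c powr (- (?n / 2)))"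
    using c by (subst nn_integral_cmult) (auto simp: nn_integral_Gamma)
  also have "\<dots> = ennreal (?n * unit_ball_vol ?n / 2 * Gamma (?n / 2) * c powr (- (?n / 2)))"
    using G by (subst ennreal_mult[symmetric]) (auto simp: mult_ac)
  also have "?n * unit_ball_vol ?n / 2 * Gamma (?n / 2) = pi powr (?n / 2)"
  proof -
    have "Gamma (?n / 2) \<noteq> 0" using G by linarith
    then show ?thesis by (subst unit_ball_vol_times) auto
  qed
  also have "pi powr (?n / 2) * c powr (- (?n / 2)) = (pi / c) powr (?n / 2)"
    using c by (simp add: powr_divide powr_minus_divide)
  finally show ?thesis .
qed

text \<open>Completes the square about the weighted barycentre of \<open>x\<close> and
  \<open>y\<close>. Only the first term on the right depends on \<open>z\<close>, so a product of
  two Gaussians in \<open>z\<close> is one Gaussian times a constant.\<close>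

lemma Gaussian_product_exponent:
  fixes x y z :: "'a::real_inner"
  assumes "s > 0" "t > 0"
  shows "s * (dist x z)\<^sup>2 + t * (dist z y)\<^sup>2 =
    (s + t) * (dist ((s / (s + t)) *\<^sub>R x + (t / (s + t)) *\<^sub>R y) z)\<^sup>2 + s * t / (s + t) * (dist x y)\<^sup>2"
proof -
  define a where "a = s / (s + t)"
  define b where "b = t / (s + t)"
  have st: "s + t \<noteq> 0" "a + b = 1" "s = (s + t) * a" "t = (s + t) * b"
    using assms by (simp_all add: a_def b_def add_divide_distrib[symmetric])
  have "s * t / (s + t) = s * b" by (simp add: b_def)
  also have "\<dots> = (s + t) * (a * b)" using st(3) by (metis mult.assoc)
  finally have st5: "s * t / (s + t) = (s + t) * (a * b)" .
  define u where "u = x - z"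
  define v where "v = y - z"
  let ?X = "(a * a * (u \<bullet> u) + 2 * (a * b) * (u \<bullet> v) + b * b * (v \<bullet> v)) + a * b * (u \<bullet> u - 2 * (u \<bullet> v) + v \<bullet> v)"
  have "a *\<^sub>R x + b *\<^sub>R y - z = a *\<^sub>R x + b *\<^sub>R y - (a + b) *\<^sub>R z" by (simp add: st(2))
  also have "\<dots> = a *\<^sub>R u + b *\<^sub>R v" by (simp add: u_def v_def algebra_simps)
  finally have "(dist (a *\<^sub>R x + b *\<^sub>R y) z)\<^sup>2 = a * a * (u \<bullet> u) + 2 * (a * b) * (u \<bullet> v) + b * b * (v \<bullet> v)"
    by (simp add: dist_norm power2_norm_eq_inner inner_add_left inner_add_right inner_commute algebra_simps)
  moreover have "(dist x y)\<^sup>2 = u \<bullet> u - 2 * (u \<bullet> v) + v \<bullet> v"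
  proof -
    have "x - y = u - v" by (simp add: u_def v_def)
    then show ?thesis by (simp add: dist_norm power2_norm_eq_inner inner_diff_left inner_diff_right inner_commute)
  qed
  moreover have "(dist x z)\<^sup>2 = u \<bullet> u" "(dist z y)\<^sup>2 = v \<bullet> v"
    by (simp_all add: dist_norm power2_norm_eq_inner u_def v_def norm_minus_commute[of z])
  moreover have "a * (u \<bullet> u) + b * (v \<bullet> v) = ?X"
  proof -
    have "a * (a + b) * (u \<bullet> u) + b * (a + b) * (v \<bullet> v) = ?X"
      by (simp add: algebra_simps)
    then show ?thesis by (simp add: st(2))
  qed
  then have "(s + t) * (a * (u \<bullet> u) + b * (v \<bullet> v)) = (s + t) * (?X)"
    by simp
  ultimately show ?thesis
    unfolding a_def[symmetric] b_def[symmetric] st5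
    by (metis (no_types, opaque_lifting) st(3,4) distrib_left mult.assoc)
qed

lemma nn_integral_Gaussian_product:
  fixes x y :: "real ^ 'n"
  assumes s: "s > 0" and t: "t > 0"
  shows "(\<integral>\<^sup>+z. ennreal (exp (- (s * (dist x z)\<^sup>2)) * exp (- (t * (dist z y)\<^sup>2))) \<partial>lborel) =
    ennreal ((pi / (s + t)) powr (CARD('n) / 2) * exp (- (s * t / (s + t) * (dist x y)\<^sup>2)))"
proof -
  define m where "m = (s / (s + t)) *\<^sub>R x + (t / (s + t)) *\<^sub>R y"
  have "exp (- (s * (dist x z)\<^sup>2)) * exp (- (t * (dist z y)\<^sup>2)) =
      exp (- (s * t / (s + t) * (dist x y)\<^sup>2)) * exp (- ((s + t) * (dist m z)\<^sup>2))" for z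
    using Gaussian_product_exponent[OF s t, of x z y] by (simp add: exp_add[symmetric] m_def)
  then have "(\<integral>\<^sup>+z. ennreal (exp (- (s * (dist x z)\<^sup>2)) * exp (- (t * (dist z y)\<^sup>2))) \<partial>lborel) =
    (\<integral>\<^sup>+z. ennreal (exp (- (s * t / (s + t) * (dist x y)\<^sup>2))) * ennreal (exp (- ((s + t) * (dist m z)\<^sup>2))) \<partial>lborel)"
    by (simp add: ennreal_mult[symmetric])
  also have "\<dots> = ennreal (exp (- (s * t / (s + t) * (dist x y)\<^sup>2))) * ennreal ((pi / (s + t)) powr (CARD('n) / 2))"
    using s t by (subst nn_integral_cmult) (auto simp: nn_integral_Gaussian)
  finally show ?thesis by (simp add: ennreal_mult[symmetric] mult.commute)
qed

lemma nn_integral_riesz_kernel: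
  fixes v p :: real
  assumes "p > 0" "v > 0"
  shows "(\<integral>\<^sup>+s\<in>{0<..}. ennreal (s powr (p - 1) * exp (- (s * v\<^sup>2))) \<partial>lborel) = ennreal (Gamma p * v powr (- 2 * p))"
proof -
  have "(v\<^sup>2) powr (- p) = v powr (- 2 * p)"
    using assms by (simp add: powr_realpow[symmetric] powr_powr del: powr_numeral)
  then show ?thesis using nn_integral_Gamma[of p "v\<^sup>2"] assms by (simp add: mult.commute)
qed

text \<open>Writing each power of the distance as a superposition of Gaussians reduces the convolution to
  \<open>nn_integral_Gaussian_product\<close>; the substitution \<open>t = s * v\<close> then leaves a Gamma and a Beta integral.\<close>
lemma nn_integral_riesz_composition_aux:
  fixes x y :: "real ^ 'n" and \<alpha> \<beta> :: real
  assumes \<alpha>: "\<alpha> > 0" and \<beta>: "\<beta> > 0" and sum: "\<alpha> + \<beta> < CARD('n)" and xy: "x \<noteq> y"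
  defines "a \<equiv> (CARD('n) - \<alpha>) / 2" and "b \<equiv> (CARD('n) - \<beta>) / 2"
  shows "ennreal (Gamma a * Gamma b) * (\<integral>\<^sup>+z. ennreal (dist x z powr (\<alpha> - CARD('n)) * dist z y powr (\<beta> - CARD('n))) \<partial>lborel) =
    ennreal (pi powr (CARD('n) / 2) * Gamma ((CARD('n) - (\<alpha> + \<beta>)) / 2) *
      (Gamma (\<beta> / 2) * Gamma (\<alpha> / 2) / Gamma ((\<alpha> + \<beta>) / 2)) * dist x y powr (\<alpha> + \<beta> - CARD('n)))"
proof -
  let ?n = "real CARD('n)"
  \<comment> \<open>The resulting kernel is \<open>D powr (- 2 * q)\<close>; the assumption on
    \<alpha> + \<beta> is exactly \<open>q > 0\<close>, which makes the integral over
    \<open>s\<close> converge.\<close>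
  define q where "q = (?n - (\<alpha> + \<beta>)) / 2"
  define D where "D = dist x y"
  have D: "D > 0" using xy by (simp add: D_def)
  have ab: "a > 0" "b > 0" "q > 0" using assms by (auto simp: a_def b_def q_def)
  have G: "Gamma a > 0" "Gamma b > 0" "Gamma q > 0" "Gamma (\<alpha> / 2) > 0" "Gamma (\<beta> / 2) > 0" "Gamma (\<beta> / 2 + \<alpha> / 2) > 0"
    using ab \<alpha> \<beta> by (auto intro!: Gamma_real_pos)
  let ?K = "\<lambda>z s t. s powr (a - 1) * t powr (b - 1) * (exp (- (s * (dist x z)\<^sup>2)) * exp (- (t * (dist z y)\<^sup>2)))"
  let ?I = "\<lambda>s t. indicator {0<..} s * indicator {0<..} t :: ennreal"
  let ?M = "\<lambda>s t. s powr (a - 1) * t powr (b - 1) * ((pi / (s + t)) powr (?n / 2) * exp (- (s * t / (s + t) * D\<^sup>2)))"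
  \<comment> \<open>\<open>?M\<close> after the substitution, with its Jacobian \<open>s\<close>
    absorbed into \<open>s powr (q - 1)\<close>. The exponent is written as a square to match
    \<open>nn_integral_riesz_kernel\<close>.\<close>
  let ?L = "\<lambda>s v. pi powr (?n / 2) * (v powr (b - 1) * (1 + v) powr (- (?n / 2))) * (s powr (q - 1) * exp (- (s * (sqrt (v / (1 + v)) * D)\<^sup>2)))"
  have "ennreal (Gamma a * Gamma b) * (\<integral>\<^sup>+z. ennreal (dist x z powr (\<alpha> - ?n) * dist z y powr (\<beta> - ?n)) \<partial>lborel)
    = (\<integral>\<^sup>+z. ennreal (Gamma a * Gamma b) * ennreal (dist x z powr (\<alpha> - ?n) * dist z y powr (\<beta> - ?n)) \<partial>lborel)"
    by (rule nn_integral_cmult[symmetric]) measurable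
  also have "\<dots> = (\<integral>\<^sup>+z. (\<integral>\<^sup>+s. (\<integral>\<^sup>+t. ennreal (?K z s t) * ?I s t \<partial>lborel) \<partial>lborel) \<partial>lborel)"
  proof (rule nn_integral_cong_AE)
    \<comment> \<open>At these two points one of the superposition integrals is infinite, while
      \<open>0 powr\<close> yields 0.\<close>
    have "AE z in lborel. z \<noteq> x \<and> z \<noteq> y"
      using AE_lborel_singleton[of x] AE_lborel_singleton[of y] by eventually_elim auto
    then show "AE z in lborel. ennreal (Gamma a * Gamma b) * ennreal (dist x z powr (\<alpha> - ?n) * dist z y powr (\<beta> - ?n))
      = (\<integral>\<^sup>+s. (\<integral>\<^sup>+t. ennreal (?K z s t) * ?I s t \<partial>lborel) \<partial>lborel)"
    proof eventually_elim
      case (elim z)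
      then have d: "dist x z > 0" "dist z y > 0" by auto
      have exps: "- 2 * a = \<alpha> - ?n" "- 2 * b = \<beta> - ?n" by (simp_all add: a_def b_def)
      have "(\<integral>\<^sup>+t. ennreal (?K z s t) * ?I s t \<partial>lborel)
        = ennreal (Gamma b * dist z y powr (\<beta> - ?n)) * (ennreal (s powr (a - 1) * exp (- (s * (dist x z)\<^sup>2))) * indicator {0<..} s)" for s
      proof -
        have "(\<integral>\<^sup>+t. ennreal (?K z s t) * ?I s t \<partial>lborel)
          = (\<integral>\<^sup>+t. (ennreal (s powr (a - 1) * exp (- (s * (dist x z)\<^sup>2))) * indicator {0<..} s) *
              (ennreal (t powr (b - 1) * exp (- (t * (dist z y)\<^sup>2))) * indicator {0<..} t) \<partial>lborel)"
          by (intro nn_integral_cong) (auto simp: indicator_def ennreal_mult[symmetric] mult_ac)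
        also have "\<dots> = (ennreal (s powr (a - 1) * exp (- (s * (dist x z)\<^sup>2))) * indicator {0<..} s) *
            ennreal (Gamma b * dist z y powr (\<beta> - ?n))"
          using nn_integral_riesz_kernel[OF ab(2) d(2)] exps(2) by (subst nn_integral_cmult) auto
        finally show ?thesis by (simp add: mult.commute)
      qed
      then have "(\<integral>\<^sup>+s. (\<integral>\<^sup>+t. ennreal (?K z s t) * ?I s t \<partial>lborel) \<partial>lborel)
        = ennreal (Gamma b * dist z y powr (\<beta> - ?n)) * ennreal (Gamma a * dist x z powr (\<alpha> - ?n))"
        using nn_integral_riesz_kernel[OF ab(1) d(1)] exps(1) by (simp add: nn_integral_cmult)
      then show ?case using G by (simp add: ennreal_mult[symmetric] mult_ac)
    qed
  qed
  also have "\<dots> = (\<integral>\<^sup>+s. (\<integral>\<^sup>+z. (\<integral>\<^sup>+t. ennreal (?K z s t) * ?I s t \<partial>lborel) \<partial>lborel) \<partial>lborel)"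
    by (rule lborel_pair.Fubini') measurable
  also have "\<dots> = (\<integral>\<^sup>+s. (\<integral>\<^sup>+t. (\<integral>\<^sup>+z. ennreal (?K z s t) * ?I s t \<partial>lborel) \<partial>lborel) \<partial>lborel)"
    by (intro nn_integral_cong lborel_pair.Fubini') measurable
  also have "\<dots> = (\<integral>\<^sup>+s. (\<integral>\<^sup>+t. ennreal (?M s t) * ?I s t \<partial>lborel) \<partial>lborel)"
  proof (intro nn_integral_cong)
    fix s t :: real
    show "(\<integral>\<^sup>+z. ennreal (?K z s t) * ?I s t \<partial>lborel)
      = ennreal (?M s t) * ?I s t"
    proof (cases "s > 0 \<and> t > 0")
      case True
      then have "(\<integral>\<^sup>+z. ennreal (?K z s t) * ?I s t \<partial>lborel)
        = (\<integral>\<^sup>+z. ennreal (s powr (a - 1) * t powr (b - 1)) * ennreal (exp (- (s * (dist x z)\<^sup>2)) * exp (- (t * (dist z y)\<^sup>2))) \<partial>lborel)"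
        by (simp add: ennreal_mult)
      also have "\<dots> = ennreal (s powr (a - 1) * t powr (b - 1)) * ennreal ((pi / (s + t)) powr (?n / 2) * exp (- (s * t / (s + t) * D\<^sup>2)))"
        using True nn_integral_Gaussian_product[of s t x y] by (subst nn_integral_cmult) (auto simp: D_def)
      finally show ?thesis using True by (simp add: ennreal_mult[symmetric])
    qed auto
  qed
  also have "\<dots> = (\<integral>\<^sup>+s. (\<integral>\<^sup>+v. ennreal (?L s v) * ?I s v \<partial>lborel) \<partial>lborel)"
  proof (rule nn_integral_cong)
    fix s :: real
    let ?f = "\<lambda>t. ennreal (?M s t) * ?I s t"
    show "(\<integral>\<^sup>+t. ?f t \<partial>lborel) = (\<integral>\<^sup>+v. ennreal (?L s v) * ?I s v \<partial>lborel)"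
    proof (cases "s > 0")
      case s: True
      have "(\<integral>\<^sup>+t. ?f t \<partial>lborel) = ennreal \<bar>s\<bar> * (\<integral>\<^sup>+v. ?f (0 + s * v) \<partial>lborel)"
        using s by (intro nn_integral_real_affine) auto
      also have "\<dots> = (\<integral>\<^sup>+v. ennreal \<bar>s\<bar> * ?f (0 + s * v) \<partial>lborel)"
        by (rule nn_integral_cmult[symmetric]) measurable
      also have "\<dots> = (\<integral>\<^sup>+v. ennreal (?L s v) * ?I s v \<partial>lborel)"
      proof (intro nn_integral_cong)
        fix v :: real
        show "ennreal \<bar>s\<bar> * ?f (0 + s * v) = ennreal (?L s v) * ?I s v"
        proof (cases "v > 0")
          case v: True
          have e1: "s * (s * v) / (s + s * v) * D\<^sup>2 = s * (sqrt (v / (1 + v)) * D)\<^sup>2"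
          proof -
            have "s * (s * v) / (s + s * v) = s * (s * v) / (s * (1 + v))" by (simp add: algebra_simps)
            also have "\<dots> = s * (v / (1 + v))" using s by simp
            finally show ?thesis using v by (simp add: power_mult_distrib)
          qed
          have e2: "(pi / (s + s * v)) powr (?n / 2) = pi powr (?n / 2) * (s powr (- (?n / 2)) * (1 + v) powr (- (?n / 2)))"
          proof -
            have "s + s * v = s * (1 + v)" by (simp add: algebra_simps)
            then show ?thesis using s v by (simp add: powr_divide powr_mult powr_minus_divide)
          qed
          have "s * s powr (a - 1) * s powr (b - 1) * s powr (- (?n / 2)) = s powr 1 * s powr (a - 1) * s powr (b - 1) * s powr (- (?n / 2))"
            using s by simp
          also have "\<dots> = s powr (1 + (a - 1) + (b - 1) + (- (?n / 2)))" by (simp only: powr_add)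
          also have "1 + (a - 1) + (b - 1) + (- (?n / 2)) = q - 1" by (simp add: a_def b_def q_def field_simps)
          finally have e3: "s * s powr (a - 1) * s powr (b - 1) * s powr (- (?n / 2)) = s powr (q - 1)" .
          have "s * (?M s (s * v))
            = (s * s powr (a - 1) * s powr (b - 1) * s powr (- (?n / 2))) * (pi powr (?n / 2) * (v powr (b - 1) * (1 + v) powr (- (?n / 2))) * exp (- (s * (sqrt (v / (1 + v)) * D)\<^sup>2)))"
            unfolding e1 e2 using s v by (simp add: powr_mult mult_ac)
          also have "\<dots> = ?L s v"
            unfolding e3 by (simp only: mult_ac)
          finally have e4: "s * (?M s (s * v))
            = ?L s v" .
          have "ennreal \<bar>s\<bar> * ?f (0 + s * v) = ennreal (s * (?M s (s * v)))"
            using s v by (simp add: ennreal_mult)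
          then show ?thesis unfolding e4 using s v by simp
        next
          case False
          then have "\<not> 0 < s * v" using s by (simp add: zero_less_mult_iff)
          with False show ?thesis by simp
        qed
      qed
      finally show ?thesis .
    qed simp
  qed
  also have "\<dots> = (\<integral>\<^sup>+v. (\<integral>\<^sup>+s. ennreal (?L s v) * ?I s v \<partial>lborel) \<partial>lborel)"
    by (rule lborel_pair.Fubini') measurable
  also have "\<dots> = (\<integral>\<^sup>+v. ennreal (pi powr (?n / 2) * Gamma q * D powr (- 2 * q)) * (ennreal (v powr (\<alpha> / 2 - 1) * (1 + v) powr (- (\<alpha> / 2 + \<beta> / 2))) * indicator {0<..} v) \<partial>lborel)"
  proof (intro nn_integral_cong)
    fix v :: real
    show "(\<integral>\<^sup>+s. ennreal (?L s v) * ?I s v \<partial>lborel)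
      = ennreal (pi powr (?n / 2) * Gamma q * D powr (- 2 * q)) * (ennreal (v powr (\<alpha> / 2 - 1) * (1 + v) powr (- (\<alpha> / 2 + \<beta> / 2))) * indicator {0<..} v)"
    proof (cases "v > 0")
      case v: True
      let ?c = "pi powr (?n / 2) * (v powr (b - 1) * (1 + v) powr (- (?n / 2)))"
      have pos: "sqrt (v / (1 + v)) * D > 0" using v D by simp
      have "(\<integral>\<^sup>+s. ennreal (?c * (s powr (q - 1) * exp (- (s * (sqrt (v / (1 + v)) * D)\<^sup>2)))) * ?I s v \<partial>lborel)
        = (\<integral>\<^sup>+s. ennreal ?c * (ennreal (s powr (q - 1) * exp (- (s * (sqrt (v / (1 + v)) * D)\<^sup>2))) * indicator {0<..} s) \<partial>lborel)"
        using v by (intro nn_integral_cong) (auto simp: indicator_def ennreal_mult[symmetric])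
      also have "\<dots> = ennreal ?c * ennreal (Gamma q * (sqrt (v / (1 + v)) * D) powr (- 2 * q))"
        by (subst nn_integral_cmult) (auto simp: nn_integral_riesz_kernel[OF ab(3) pos])
      also have "(sqrt (v / (1 + v)) * D) powr (- 2 * q) = v powr (- q) * (1 + v) powr q * D powr (- 2 * q)"
      proof -
        have "sqrt (v / (1 + v)) powr (- 2 * q) = (v / (1 + v)) powr (- q)"
          using v by (simp add: powr_half_sqrt[symmetric] powr_powr)
        also have "\<dots> = v powr (- q) * (1 + v) powr q"
          using v by (simp add: powr_divide powr_minus_divide)
        finally show ?thesis using v D by (simp add: powr_mult)
      qed
      also have "ennreal ?c * ennreal (Gamma q * (v powr (- q) * (1 + v) powr q * D powr (- 2 * q)))
        = ennreal (pi powr (?n / 2) * Gamma q * D powr (- 2 * q) * ((v powr (b - 1) * v powr (- q)) * ((1 + v) powr (- (?n / 2)) * (1 + v) powr q)))"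
        using G by (simp add: ennreal_mult[symmetric] mult_ac)
      also have "v powr (b - 1) * v powr (- q) = v powr (\<alpha> / 2 - 1)"
        unfolding powr_add[symmetric] by (rule arg_cong[where f="(powr) v"]) (simp add: b_def q_def field_simps)
      also have "(1 + v) powr (- (?n / 2)) * (1 + v) powr q = (1 + v) powr (- (\<alpha> / 2 + \<beta> / 2))"
        unfolding powr_add[symmetric] by (rule arg_cong[where f="(powr) (1 + v)"]) (simp add: q_def field_simps)
      finally show ?thesis using v G by (simp add: ennreal_mult)
    qed simp
  qed
  also have "\<dots> = ennreal (pi powr (?n / 2) * Gamma q * D powr (- 2 * q)) *
      (\<integral>\<^sup>+v\<in>{0<..}. ennreal (v powr (\<alpha> / 2 - 1) * (1 + v) powr (- (\<alpha> / 2 + \<beta> / 2))) \<partial>lborel)"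
    by (rule nn_integral_cmult) measurable
  also have "(\<integral>\<^sup>+v\<in>{0<..}. ennreal (v powr (\<alpha> / 2 - 1) * (1 + v) powr (- (\<alpha> / 2 + \<beta> / 2))) \<partial>lborel) =
      ennreal (Gamma (\<alpha> / 2) * Gamma (\<beta> / 2) / Gamma (\<alpha> / 2 + \<beta> / 2))"
    using \<alpha> \<beta> by (intro nn_integral_Beta_prime) auto
  also have "ennreal (pi powr (?n / 2) * Gamma q * D powr (- 2 * q)) * \<dots> = ennreal (pi powr (?n / 2) * Gamma q * (Gamma (\<beta> / 2) * Gamma (\<alpha> / 2) / Gamma ((\<alpha> + \<beta>) / 2)) * D powr (- 2 * q))"
    using G by (simp add: ennreal_mult[symmetric] mult_ac add_divide_distrib add.commute)
  also have "- 2 * q = \<alpha> + \<beta> - ?n" by (simp add: q_def field_simps)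
  finally show ?thesis unfolding q_def D_def .
qed

text \<open>The reciprocal of the constant H_n(s) for real \<open>s\<close>. With it the kernels
  form a semigroup under convolution.\<close>

definition riesz_factor :: "real \<Rightarrow> real \<Rightarrow> real" where
  "riesz_factor n s = Gamma ((n - s) / 2) / (2 powr s * pi powr (n / 2) * Gamma (s / 2))"

lemma riesz_factor_pos:
  assumes "0 < s" "s < n"
  shows "riesz_factor n s > 0"
  using assms unfolding riesz_factor_def
  by (intro divide_pos_pos mult_pos_pos Gamma_real_pos) auto

lemma nn_integral_riesz_composition:
  fixes x y :: "real ^ 'n" and \<alpha> \<beta> :: real
  assumes \<alpha>: "\<alpha> > 0" and \<beta>: "\<beta> > 0" and sum: "\<alpha> + \<beta> < CARD('n)" and xy: "x \<noteq> y"
  shows "(\<integral>\<^sup>+z. ennreal (dist x z powr (\<alpha> - CARD('n)) * dist z y powr (\<beta> - CARD('n))) \<partial>lborel) =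
    ennreal (riesz_factor CARD('n) (\<alpha> + \<beta>) / (riesz_factor CARD('n) \<alpha> * riesz_factor CARD('n) \<beta>) * dist x y powr (\<alpha> + \<beta> - CARD('n)))"
    (is "?I = ennreal (?R * ?d)")
proof -
  let ?n = "real CARD('n)"
  define A where "A = Gamma ((?n - \<alpha>) / 2)"
  define B where "B = Gamma ((?n - \<beta>) / 2)"
  define Q where "Q = Gamma ((?n - (\<alpha> + \<beta>)) / 2)"
  define a where "a = Gamma (\<alpha> / 2)"
  define b where "b = Gamma (\<beta> / 2)"
  define c where "c = Gamma ((\<alpha> + \<beta>) / 2)"
  define p where "p = pi powr (?n / 2)"
  have pos: "A > 0" "B > 0" "Q > 0" "a > 0" "b > 0" "c > 0" "p > 0"
    using assms unfolding A_def B_def Q_def a_def b_def c_def p_def by (auto intro!: Gamma_real_pos)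
  have R: "?R = p * Q * (b * a / c) / (A * B)"
    unfolding riesz_factor_def A_def[symmetric] B_def[symmetric] Q_def[symmetric] a_def[symmetric] b_def[symmetric] c_def[symmetric] p_def[symmetric]
    using pos by (simp add: powr_add field_simps)
  have "ennreal (A * B) * ?I = ennreal (p * Q * (b * a / c) * ?d)"
    using nn_integral_riesz_composition_aux[OF assms] by (simp only: A_def B_def Q_def a_def b_def c_def p_def)
  also have "p * Q * (b * a / c) * ?d = (A * B) * (?R * ?d)"
    unfolding R using pos by simp
  also have "ennreal \<dots> = ennreal (A * B) * ennreal (?R * ?d)"
    unfolding R using pos by (intro ennreal_mult) auto
  finally show ?thesis
    using pos by (subst (asm) ennreal_mult_cancel_left) auto
qed

subsection \<open>Potentials of decaying functions\<close>

lemma C_decay_imp_decays: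
  fixes f :: "real ^ 'n \<Rightarrow> complex"
  assumes f: "f \<in> C_decay a" and a: "a \<ge> 0"
  obtains A where "decays a A f"
proof -
  have cont: "continuous_on UNIV f" and O: "(\<lambda>x. norm (f x)) \<in> O[at_infinity](\<lambda>x. norm x powr (- a))"
    using f by (auto simp: C_decay_def)
  from O obtain c where c: "c > 0" "eventually (\<lambda>x. norm (norm (f x)) \<le> c * norm (norm x powr (- a))) at_infinity"
    by (rule landau_o.bigE)
  then obtain R where R: "\<And>x. norm x \<ge> R \<Longrightarrow> norm (f x) \<le> c * norm x powr (- a)"
    by (auto simp: eventually_at_infinity)
  \<comment> \<open>At least 1, so that 1 + |x| \<le> 2 |x| outside the ball.\<close>
  define S where "S = max R 1"
  have "compact (cball (0 :: real ^ 'n) S)" by simp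
  then have "bounded (f ` cball 0 S)"
    by (intro compact_imp_bounded compact_continuous_image continuous_on_subset[OF cont]) auto
  then obtain B where B: "B > 0" "\<And>x. norm x \<le> S \<Longrightarrow> norm (f x) \<le> B"
    unfolding bounded_pos by auto
  define A where "A = max (B * (1 + S) powr a) (c * 2 powr a)"
  have "norm (f x) \<le> A * (1 + norm x) powr (- a)" for x
  proof (cases "norm x \<le> S")
    case True
    have "(1 + S) powr (- a) \<le> (1 + norm x) powr (- a)"
      using True a by (intro powr_mono2') (auto intro: add_pos_nonneg)
    then have "B * (1 + S) powr a * (1 + S) powr (- a) \<le> B * (1 + S) powr a * (1 + norm x) powr (- a)"
      using B(1) by (intro mult_left_mono) auto
    moreover have "B * (1 + S) powr a * (1 + S) powr (- a) = B"
      by (simp add: S_def powr_minus field_simps)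
    moreover have "B * (1 + S) powr a * (1 + norm x) powr (- a) \<le> A * (1 + norm x) powr (- a)"
      by (intro mult_right_mono) (auto simp: A_def)
    ultimately show ?thesis using B(2)[OF True] by linarith
  next
    case False
    then have x: "norm x \<ge> R" "norm x \<ge> 1" "norm x > 0" by (auto simp: S_def)
    have "norm x powr (- a) \<le> ((1 + norm x) / 2) powr (- a)"
      using x a by (intro powr_mono2') (auto intro: add_pos_nonneg)
    also have "\<dots> = 2 powr a * (1 + norm x) powr (- a)"
      by (simp add: powr_divide powr_minus_divide add_nonneg_nonneg)
    finally have "c * norm x powr (- a) \<le> c * (2 powr a * (1 + norm x) powr (- a))"
      using c(1) by (intro mult_left_mono) auto
    also have "\<dots> \<le> A * (1 + norm x) powr (- a)"
      unfolding mult.assoc[symmetric] by (intro mult_right_mono) (auto simp: A_def)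
    finally show ?thesis using R[OF x(1)] by linarith
  qed
  moreover have "A \<ge> 0" using c by (simp add: A_def le_max_iff_disj)
  ultimately show thesis using cont a by (intro that[of A]) (auto simp: decays_def)
qed

lemma decays_mono:
  assumes "decays a A f" "0 \<le> a'" "a' \<le> a"
  shows "decays a' A f"
proof -
  have "A * (1 + norm y) powr (- a) \<le> A * (1 + norm y) powr (- a')" for y :: "real ^ 'n"
    using assms by (intro mult_left_mono powr_mono) (auto simp: decays_def)
  then show ?thesis using assms by (auto simp: decays_def intro: order_trans)
qed

lemma nn_integral_riesz_weight_finite:
  fixes x :: "real ^ 'n" and s a :: real
  assumes "0 < s" "s < a"
  shows "(\<integral>\<^sup>+y. ennreal (dist x y powr (s - CARD('n)) * (1 + dist x y) powr (- a)) \<partial>lborel) < \<infinity>"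
proof -
  let ?F = "\<lambda>r. ennreal ((1 + r) powr (- a))"
  have "(\<integral>\<^sup>+y. ennreal (dist x y powr (s - CARD('n)) * (1 + dist x y) powr (- a)) \<partial>lborel)
    = (\<integral>\<^sup>+y. ennreal (dist x y powr (s - CARD('n))) * ?F (dist x y) \<partial>lborel)"
    by (simp add: ennreal_mult)
  also have "\<dots> = ennreal (CARD('n) * unit_ball_vol CARD('n)) * (\<integral>\<^sup>+r\<in>{0<..}. ennreal (r powr (s - 1)) * ?F r \<partial>lborel)"
    by (rule nn_integral_polar_powr) measurable
  also have "\<dots> < \<infinity>"
    using nn_integral_powr_finite[OF assms] by (auto simp: ennreal_mult_less_top ennreal_mult)
  finally show ?thesis .
qed

lemma integrable_riesz_weight:
  fixes x :: "real ^ 'n" and s a :: real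
  assumes "0 < s" "s < a"
  shows "integrable lborel (\<lambda>y. dist x y powr (s - CARD('n)) * (1 + dist x y) powr (- a))"
  using nn_integral_riesz_weight_finite[OF assms, of x] by (intro integrableI_bounded) auto

lemma integrable_riesz_decays:
  fixes f :: "real ^ 'n \<Rightarrow> complex" and s a :: real
  assumes f: "decays a A f" and s: "0 < s" "s < a"
  shows "integrable lborel (\<lambda>y. dist x y powr (s - CARD('n)) *\<^sub>R f y)"
proof (rule Bochner_Integration.integrable_bound)
  let ?c = "A * (1 + norm x) powr a"
  show "integrable lborel (\<lambda>y. ?c * (dist x y powr (s - CARD('n)) * (1 + dist x y) powr (- a)))"
    using integrable_riesz_weight[OF s] by (rule integrable_mult_right)
  show "(\<lambda>y. dist x y powr (s - CARD('n)) *\<^sub>R f y) \<in> borel_measurable lborel"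
    using decays_measurable[OF f] by measurable
  show "AE y in lborel. norm (dist x y powr (s - CARD('n)) *\<^sub>R f y) \<le> norm (?c * (dist x y powr (s - CARD('n)) * (1 + dist x y) powr (- a)))"
  proof (rule AE_I2)
    fix y
    have "dist x y powr (s - CARD('n)) * norm (f y) \<le> dist x y powr (s - CARD('n)) * (?c * (1 + dist x y) powr (- a))"
      using decays_dist[OF f] by (intro mult_left_mono) auto
    moreover have "A \<ge> 0" using f by (simp add: decays_def)
    ultimately show "norm (dist x y powr (s - CARD('n)) *\<^sub>R f y) \<le> norm (?c * (dist x y powr (s - CARD('n)) * (1 + dist x y) powr (- a)))"
      by (simp add: abs_mult mult_ac)
  qed
qed

text \<open>The Riesz potential without its normalising factor and for real exponents, where
  nonnegative kernels allow Tonelli arguments.\<close>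

definition kernel_potential :: "real \<Rightarrow> (real ^ 'n \<Rightarrow> complex) \<Rightarrow> real ^ 'n \<Rightarrow> complex" where
  "kernel_potential s f x = (\<integral>y. dist x y powr (s - CARD('n)) *\<^sub>R f y \<partial>lborel)"

text \<open>Moves \<open>x\<close> from the singular kernel to the continuous function
  \<open>f\<close>. Continuity of the potential then follows by dominated convergence against a
  fixed kernel.\<close>

lemma kernel_potential_shift:
  fixes f :: "real ^ 'n \<Rightarrow> complex"
  assumes "f \<in> borel_measurable borel"
  shows "kernel_potential s f x = (\<integral>u. norm u powr (s - CARD('n)) *\<^sub>R f (x + u) \<partial>lborel)"
proof -
  have "kernel_potential s f x = (\<integral>y. dist x y powr (s - CARD('n)) *\<^sub>R f y \<partial>distr lborel borel ((+) x))"
    by (simp add: kernel_potential_def lborel_distr_plus)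
  also have "\<dots> = (\<integral>u. dist x (x + u) powr (s - CARD('n)) *\<^sub>R f (x + u) \<partial>lborel)"
    using assms by (intro integral_distr) auto
  finally show ?thesis by (simp add: dist_norm)
qed

lemma continuous_kernel_potential:
  fixes f :: "real ^ 'n \<Rightarrow> complex" and s a :: real
  assumes f: "decays a A f" and s: "0 < s" "s < a"
  shows "continuous_on UNIV (kernel_potential s f)"
proof (rule continuous_on_sequentiallyI)
  fix X :: "nat \<Rightarrow> real ^ 'n" and x assume X: "X \<longlonglongrightarrow> x"
  have [measurable]: "f \<in> borel_measurable borel" using f by (rule decays_measurable)
  have "Bseq X" using X by (intro convergent_imp_Bseq convergentI)
  then obtain B where B: "B > 0" "\<And>j. norm (X j) \<le> B" by (auto simp: Bseq_def)
  let ?c = "A * (1 + B) powr a"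
  have A: "A \<ge> 0" "a \<ge> 0" using f by (auto simp: decays_def)
  have "(\<lambda>j. \<integral>u. norm u powr (s - CARD('n)) *\<^sub>R f (X j + u) \<partial>lborel) \<longlonglongrightarrow> (\<integral>u. norm u powr (s - CARD('n)) *\<^sub>R f (x + u) \<partial>lborel)"
  proof (rule integral_dominated_convergence)
    show "integrable lborel (\<lambda>u::real^'n. ?c * (norm u powr (s - CARD('n)) * (1 + norm u) powr (- a)))"
      using integrable_riesz_weight[OF s, of "0 :: real ^ 'n"] by (intro integrable_mult_right) simp
    show "AE u in lborel. (\<lambda>j. norm u powr (s - CARD('n)) *\<^sub>R f (X j + u)) \<longlonglongrightarrow> norm u powr (s - CARD('n)) *\<^sub>R f (x + u)"
      using X by (intro AE_I2 tendsto_scaleR tendsto_const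
        continuous_on_tendsto_compose[OF decays_continuous[OF f]] tendsto_add) auto
    show "AE u in lborel. norm (norm u powr (s - CARD('n)) *\<^sub>R f (X j + u)) \<le> ?c * (norm u powr (s - CARD('n)) * (1 + norm u) powr (- a))" for j
    proof (rule AE_I2)
      fix u :: "real ^ 'n"
      have "norm (f (X j + u)) \<le> A * (1 + norm (X j)) powr a * (1 + dist (X j) (X j + u)) powr (- a)"
        by (rule decays_dist[OF f])
      also have "\<dots> \<le> ?c * (1 + norm u) powr (- a)"
        using A B(2)[of j] by (auto simp: dist_norm intro!: mult_right_mono mult_left_mono powr_mono2 add_nonneg_nonneg)
      finally have "norm u powr (s - CARD('n)) * norm (f (X j + u)) \<le> norm u powr (s - CARD('n)) * (?c * (1 + norm u) powr (- a))"
        by (intro mult_left_mono) auto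
      then show "norm (norm u powr (s - CARD('n)) *\<^sub>R f (X j + u)) \<le> ?c * (norm u powr (s - CARD('n)) * (1 + norm u) powr (- a))"
        by (simp add: mult_ac)
    qed
  qed measurable
  then show "(\<lambda>j. kernel_potential s f (X j)) \<longlonglongrightarrow> kernel_potential s f x"
    by (simp add: kernel_potential_shift)
qed

text \<open>Bounding \<open>f\<close> by a multiple of |y|^(-a) = |y|^((n-a)-n) turns the potential
  into a convolution of two kernels with exponents \<open>s\<close> and n - a, whose value is a
  multiple of |x|^(s-a). Here \<open>a\<close> below \<open>n\<close> makes the second exponent
  positive, and \<open>s < a\<close> keeps the sum below \<open>n\<close>.\<close>

lemma kernel_potential_C_decay:
  fixes f :: "real ^ 'n \<Rightarrow> complex" and s a :: real
  assumes f: "decays a A f" and s: "0 < s" "s < a" and a: "a < CARD('n)"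
  shows "kernel_potential s f \<in> C_decay (a - s)"
proof -
  let ?n = "real CARD('n)"
  define K where "K = riesz_factor ?n (s + (?n - a)) / (riesz_factor ?n s * riesz_factor ?n (?n - a))"
  have K: "K \<ge> 0" unfolding K_def using s a by (intro divide_nonneg_nonneg mult_nonneg_nonneg less_imp_le riesz_factor_pos) auto
  have A: "A \<ge> 0" using f by (auto simp: decays_def)
  have [measurable]: "f \<in> borel_measurable borel" using f by (rule decays_measurable)
  have bound: "norm (kernel_potential s f x) \<le> A * K * norm x powr (- (a - s))" if x: "x \<noteq> 0" for x
  proof -
    have "ennreal (norm (kernel_potential s f x)) \<le> (\<integral>\<^sup>+y. ennreal (norm (dist x y powr (s - ?n) *\<^sub>R f y)) \<partial>lborel)"
      unfolding kernel_potential_def using integrable_riesz_decays[OF f s]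
      by (rule integral_norm_bound_ennreal)
    also have "\<dots> \<le> (\<integral>\<^sup>+y. ennreal A * ennreal (dist x y powr (s - ?n) * dist y 0 powr ((?n - a) - ?n)) \<partial>lborel)"
    proof (rule nn_integral_mono_AE)
      show "AE y in lborel. ennreal (norm (dist x y powr (s - ?n) *\<^sub>R f y)) \<le> ennreal A * ennreal (dist x y powr (s - ?n) * dist y 0 powr ((?n - a) - ?n))"
        using AE_lborel_singleton[of "0 :: real ^ 'n"]
      proof eventually_elim
        case (elim y)
        have "norm (f y) \<le> A * (1 + norm y) powr (- a)" using f by (auto simp: decays_def)
        also have "\<dots> \<le> A * norm y powr (- a)"
          using elim A f by (intro mult_left_mono powr_mono2') (auto simp: decays_def)
        finally have "dist x y powr (s - ?n) * norm (f y) \<le> dist x y powr (s - ?n) * (A * norm y powr (- a))"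
          by (intro mult_left_mono) auto
        then show ?case using A by (simp add: ennreal_mult[symmetric] mult_ac ennreal_leI)
      qed
    qed
    also have "\<dots> = ennreal A * (\<integral>\<^sup>+y. ennreal (dist x y powr (s - ?n) * dist y 0 powr ((?n - a) - ?n)) \<partial>lborel)"
      by (rule nn_integral_cmult) measurable
    also have "(\<integral>\<^sup>+y. ennreal (dist x y powr (s - ?n) * dist y 0 powr ((?n - a) - ?n)) \<partial>lborel)
       = ennreal (K * dist x 0 powr (s + (?n - a) - ?n))"
      unfolding K_def using s a x by (intro nn_integral_riesz_composition) auto
    also have "ennreal A * \<dots> = ennreal (A * K * norm x powr (- (a - s)))"
      using A K by (simp add: ennreal_mult[symmetric] mult.assoc)
    finally show ?thesis using A K by (subst (asm) ennreal_le_iff) auto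
  qed
  have "(\<lambda>x. norm (kernel_potential s f x)) \<in> O[at_infinity](\<lambda>x. norm x powr (- (a - s)))"
  proof (rule landau_o.bigI[of "A * K + 1"])
    show "A * K + 1 > 0" using A K by (simp add: add_nonneg_pos)
    show "\<forall>\<^sub>F x in at_infinity. norm (norm (kernel_potential s f x)) \<le> (A * K + 1) * norm (norm x powr (- (a - s)))"
      unfolding eventually_at_infinity
    proof (intro exI allI impI)
      fix x :: "real ^ 'n" assume "1 \<le> norm x"
      then have "norm (kernel_potential s f x) \<le> A * K * norm x powr (- (a - s))" by (intro bound) auto
      then show "norm (norm (kernel_potential s f x)) \<le> (A * K + 1) * norm (norm x powr (- (a - s)))"
        unfolding distrib_right by (simp add: add_increasing2)
    qed
  qed
  then show ?thesis using continuous_kernel_potential[OF f s] by (simp add: C_decay_def)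
qed

text \<open>The composition formula for nonnegative kernels does two things: it evaluates the inner
  integral over \<open>y\<close>, and it reduces absolute convergence of the double integral to that
  of the potential of exponent \<open>s + t\<close>.\<close>

lemma kernel_potential_composition:
  fixes f :: "real ^ 'n \<Rightarrow> complex" and s t a :: real
  assumes f: "decays a A f" and t: "0 < t" and s: "0 < s" "s + t < a" and a: "a < CARD('n)"
  shows "riesz_factor CARD('n) s * riesz_factor CARD('n) t * kernel_potential s (kernel_potential t f) x =
    riesz_factor CARD('n) (s + t) * kernel_potential (s + t) f x"
proof -
  let ?n = "real CARD('n)"
  define K where "K = riesz_factor ?n (s + t) / (riesz_factor ?n s * riesz_factor ?n t)"
  have pos: "riesz_factor ?n s > 0" "riesz_factor ?n t > 0" "riesz_factor ?n (s + t) > 0"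
    using s t a by (auto intro!: riesz_factor_pos)
  then have K: "K \<ge> 0" by (simp add: K_def)
  have [measurable]: "f \<in> borel_measurable borel" using f by (rule decays_measurable)
  let ?F = "\<lambda>w y. (dist x y powr (s - ?n) * dist y w powr (t - ?n)) *\<^sub>R f w"
  have ne: "AE w in lborel. w \<noteq> x" by (rule AE_lborel_singleton)
  have comp: "(\<integral>\<^sup>+y. ennreal (dist x y powr (s - ?n) * dist y w powr (t - ?n)) \<partial>lborel) = ennreal (K * dist x w powr (s + t - ?n))"
    if "w \<noteq> x" for w
    unfolding K_def using that s t a by (intro nn_integral_riesz_composition) auto
  then have has: "has_bochner_integral lborel (\<lambda>y. dist x y powr (s - ?n) * dist y w powr (t - ?n)) (K * dist x w powr (s + t - ?n))"
    if "w \<noteq> x" for w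
    using that K by (intro has_bochner_integral_nn_integral) auto
  have int: "integrable (lborel \<Otimes>\<^sub>M lborel) (\<lambda>(w, y). ?F w y)"
  proof (rule lborel_pair.Fubini_integrable)
    show m: "(\<lambda>(w, y). ?F w y) \<in> borel_measurable (lborel \<Otimes>\<^sub>M lborel)" by measurable
    show "AE w in lborel. integrable lborel (\<lambda>y. case (w, y) of (w, y) \<Rightarrow> ?F w y)"
      using ne
    proof eventually_elim
      case (elim w)
      then show ?case using has[OF elim] by (auto simp: has_bochner_integral_iff)
    qed
    have I1: "integrable lborel (\<lambda>w. K * norm (dist x w powr (s + t - ?n) *\<^sub>R f w))"
      using integrable_riesz_decays[OF f, of "s + t" x] s t by (intro integrable_mult_right integrable_norm) auto
    have I2: "AE w in lborel. K * norm (dist x w powr (s + t - ?n) *\<^sub>R f w) = (\<integral>y. norm (case (w, y) of (w, y) \<Rightarrow> ?F w y) \<partial>lborel)"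
      using ne
    proof eventually_elim
      case (elim w)
      then show ?case using has[OF elim] by (auto simp: has_bochner_integral_iff abs_mult)
    qed
    show "integrable lborel (\<lambda>w. \<integral>y. norm (case (w, y) of (w, y) \<Rightarrow> ?F w y) \<partial>lborel)"
    proof (rule integrable_cong_AE[THEN iffD1, OF _ _ I2 I1])
      show "(\<lambda>w. \<integral>y. norm (case (w, y) of (w, y) \<Rightarrow> ?F w y) \<partial>lborel) \<in> borel_measurable lborel"
        using m by measurable
    qed measurable
  qed
  have "kernel_potential s (kernel_potential t f) x = (\<integral>y. (\<integral>w. ?F w y \<partial>lborel) \<partial>lborel)"
    unfolding kernel_potential_def by (simp flip: scaleR_scaleR)
  also have "\<dots> = (\<integral>w. (\<integral>y. ?F w y \<partial>lborel) \<partial>lborel)"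
    by (rule lborel_pair.Fubini_integral[OF int])
  also have "\<dots> = (\<integral>w. K *\<^sub>R (dist x w powr (s + t - ?n) *\<^sub>R f w) \<partial>lborel)"
  proof (rule integral_cong_AE)
    show "AE w in lborel. (\<integral>y. ?F w y \<partial>lborel) = K *\<^sub>R (dist x w powr (s + t - ?n) *\<^sub>R f w)"
      using ne
    proof eventually_elim
      case (elim w)
      then show ?case using has[OF elim] by (auto simp: has_bochner_integral_iff)
    qed
    show "(\<lambda>w. \<integral>y. ?F w y \<partial>lborel) \<in> borel_measurable lborel"
      using lborel_pair.integrable_fst[OF int] by (rule borel_measurable_integrable)
  qed measurable
  also have "\<dots> = K *\<^sub>R kernel_potential (s + t) f x"
    unfolding kernel_potential_def by (rule integral_scaleR_right)
  finally have *: "kernel_potential s (kernel_potential t f) x = K *\<^sub>R kernel_potential (s + t) f x" .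
  show ?thesis unfolding * using pos by (simp add: K_def scaleR_conv_of_real)
qed

subsection \<open>Holomorphic dependence and analytic continuation\<close>

text \<open>The remainder in differentiation under the integral. The factor \<open>L\<^sup>2\<close>
  is traded for exponentials, that is, for a small shift of the exponent; both signs occur because
  \<open>L\<close> will be the logarithm of a distance.\<close>

lemma exp_second_order_bound:
  fixes h :: complex and L \<eta> :: real
  assumes "norm h \<le> \<eta>" "\<eta> > 0"
  shows "norm (exp (h * of_real L) - 1 - h * of_real L) \<le> (norm h)\<^sup>2 * (2 / \<eta>\<^sup>2 * (exp (2 * \<eta> * L) + exp (- (2 * \<eta> * L))))"
proof -
  let ?z = "h * of_real L"
  have "norm (exp ?z - (\<Sum>i\<le>1. ?z ^ i / fact i)) \<le> exp \<bar>Re ?z\<bar> * (norm ?z) ^ (Suc 1) / fact 1"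
    by (rule Taylor_exp)
  moreover have "(\<Sum>i\<le>1. ?z ^ i / fact i) = 1 + ?z" by simp
  ultimately have 1: "norm (exp ?z - 1 - ?z) \<le> exp \<bar>Re ?z\<bar> * (norm ?z)\<^sup>2" by (simp add: diff_diff_eq power2_eq_square)
  have "\<bar>Re ?z\<bar> \<le> \<eta> * \<bar>L\<bar>"
  proof -
    have "\<bar>Re h\<bar> \<le> \<eta>" using abs_Re_le_cmod[of h] assms(1) by linarith
    then show ?thesis by (simp add: abs_mult mult_right_mono)
  qed
  then have "exp \<bar>Re ?z\<bar> \<le> exp (\<eta> * \<bar>L\<bar>)" by simp
  moreover have "L\<^sup>2 \<le> 2 / \<eta>\<^sup>2 * exp (\<eta> * \<bar>L\<bar>)"
  proof -
    have "(\<eta> * \<bar>L\<bar>)\<^sup>2 / 2 \<le> exp (\<eta> * \<bar>L\<bar>)"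
    proof -
      have "0 \<le> \<eta> * \<bar>L\<bar>" using assms by simp
      with exp_lower_Taylor_quadratic[OF this] show ?thesis by linarith
    qed
    then show ?thesis using assms by (simp add: power_mult_distrib field_simps)
  qed
  ultimately have "exp \<bar>Re ?z\<bar> * L\<^sup>2 \<le> exp (\<eta> * \<bar>L\<bar>) * (2 / \<eta>\<^sup>2 * exp (\<eta> * \<bar>L\<bar>))"
    by (intro mult_mono) auto
  also have "\<dots> = 2 / \<eta>\<^sup>2 * exp (2 * \<eta> * \<bar>L\<bar>)" by (simp add: exp_add[symmetric])
  also have "\<dots> \<le> 2 / \<eta>\<^sup>2 * (exp (2 * \<eta> * L) + exp (- (2 * \<eta> * L)))"
    by (intro mult_left_mono) (auto simp: abs_if add_increasing add_increasing2)
  finally have "(norm h)\<^sup>2 * (exp \<bar>Re ?z\<bar> * L\<^sup>2) \<le> (norm h)\<^sup>2 * (2 / \<eta>\<^sup>2 * (exp (2 * \<eta> * L) + exp (- (2 * \<eta> * L))))"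
    by (intro mult_left_mono) auto
  then show ?thesis using 1 by (simp add: norm_mult power_mult_distrib mult_ac)
qed

lemma exp_first_order_bound:
  fixes L \<eta> :: real
  assumes "\<eta> > 0"
  shows "\<bar>L\<bar> \<le> 1 / \<eta> * (exp (\<eta> * L) + exp (- (\<eta> * L)))"
proof -
  have "\<eta> * \<bar>L\<bar> \<le> exp (\<eta> * \<bar>L\<bar>)" using exp_ge_add_one_self[of "\<eta> * \<bar>L\<bar>"] by linarith
  also have "\<dots> \<le> exp (\<eta> * L) + exp (- (\<eta> * L))"
    by (auto simp: abs_if add_increasing add_increasing2)
  finally show ?thesis using assms by (simp add: field_simps)
qed

lemma norm_integral_le_integral:
  fixes f :: "'a \<Rightarrow> 'b::{banach, second_countable_topology}"
  assumes "integrable M f" "integrable M g" "\<And>x. norm (f x) \<le> g x"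
  shows "norm (\<integral>x. f x \<partial>M) \<le> (\<integral>x. g x \<partial>M)"
  using assms by (intro order_trans[OF integral_norm_bound] integral_mono integrable_norm)

text \<open>With \<open>L\<close> the logarithm of a distance,
  \<open>exp (z * of_real (L y))\<close> is a complex power of that distance. Integrability at all
  real exponents of the open interval is enough, since shifting the exponent inside it also controls
  the factors \<open>L\<close> and \<open>L\<^sup>2\<close>.\<close>

lemma holomorphic_on_integral_exp:
  fixes G :: "'a \<Rightarrow> complex" and L :: "'a \<Rightarrow> real"
  assumes G: "G \<in> borel_measurable M" and L: "L \<in> borel_measurable M"
    and int: "\<And>s. lo < s \<Longrightarrow> s < hi \<Longrightarrow> integrable M (\<lambda>y. norm (G y) * exp (s * L y))"
  shows "(\<lambda>z. \<integral>y. G y * exp (z * of_real (L y)) \<partial>M) holomorphic_on {z. lo < Re z \<and> Re z < hi}"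
proof -
  note [measurable] = G L
  let ?S = "{z. lo < Re z \<and> Re z < hi}"
  define F where "F z = (\<integral>y. G y * exp (z * of_real (L y)) \<partial>M)" for z
  have intF: "integrable M (\<lambda>y. G y * exp (z * of_real (L y)))" if "z \<in> ?S" for z
    by (rule Bochner_Integration.integrable_bound[OF int[of "Re z"]])
      (use that in \<open>auto simp: norm_mult\<close>)
  have "\<exists>D. (F has_field_derivative D) (at z)" if z: "z \<in> ?S" for z
  proof -
    \<comment> \<open>A quarter of the distance to the edges of the strip, so that a shift by
      \<open>2 * \<eta>\<close> stays inside.\<close>
    define \<eta> where "\<eta> = min (Re z - lo) (hi - Re z) / 4"
    have \<eta>: "\<eta> > 0" "lo < Re z - 2 * \<eta>" "Re z + 2 * \<eta> < hi" "lo < Re z - \<eta>" "Re z + \<eta> < hi"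
      using z by (auto simp: \<eta>_def min_def field_simps)
    let ?g = "\<lambda>y. G y * exp (z * of_real (L y))"
    let ?B = "\<lambda>y. 1 / \<eta> * (norm (G y) * exp ((Re z + \<eta>) * L y) + norm (G y) * exp ((Re z - \<eta>) * L y))"
    let ?R = "\<lambda>h y. exp (h * of_real (L y)) - 1 - h * of_real (L y)"
    define D where "D = (\<integral>y. ?g y * of_real (L y) \<partial>M)"
    define B where "B y = norm (G y) * exp ((Re z + 2 * \<eta>) * L y) + norm (G y) * exp ((Re z - 2 * \<eta>) * L y)" for y
    have B: "integrable M B"
      unfolding B_def using \<eta> by (intro Bochner_Integration.integrable_add int) auto
    have intD: "integrable M (\<lambda>y. ?g y * of_real (L y))"
    proof (rule Bochner_Integration.integrable_bound)
      show "integrable M (\<lambda>y. ?B y)"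
        using \<eta> by (intro integrable_mult_right Bochner_Integration.integrable_add int) auto
      show "AE y in M. norm (?g y * of_real (L y)) \<le> norm (?B y)"
      proof (rule AE_I2)
        fix y
        have "norm (?g y * of_real (L y)) = norm (G y) * exp (Re z * L y) * \<bar>L y\<bar>"
          by (simp add: norm_mult)
        also have "\<dots> \<le> norm (G y) * exp (Re z * L y) * (1 / \<eta> * (exp (\<eta> * L y) + exp (- (\<eta> * L y))))"
          using exp_first_order_bound[OF \<eta>(1)] by (intro mult_left_mono) auto
        also have "\<dots> = ?B y"
          by (simp add: distrib_right left_diff_distrib exp_add exp_diff exp_minus field_simps)
        also have "\<dots> \<le> norm \<dots>" unfolding real_norm_def by (rule abs_ge_self)
        finally show "norm (?g y * of_real (L y)) \<le> norm (?B y)" .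
      qed
    qed measurable
    define K where "K = 2 / \<eta>\<^sup>2 * (\<integral>y. B y \<partial>M)"
    have K: "K \<ge> 0" unfolding K_def B_def by (intro mult_nonneg_nonneg integral_nonneg) auto
    have est: "norm (F (z + h) - F z - h * D) \<le> K * (norm h)\<^sup>2" if h: "norm h \<le> \<eta>" for h
    proof -
      have zh: "z + h \<in> ?S"
        using abs_Re_le_cmod[of h] h \<eta> by auto
      have "F (z + h) - F z - h * D = (\<integral>y. G y * exp ((z + h) * of_real (L y)) - ?g y - h * (?g y * of_real (L y)) \<partial>M)"
        unfolding F_def D_def
        by (simp add: intF[OF zh] intF[OF z] intD Bochner_Integration.integral_diff)
      also have "(\<lambda>y. G y * exp ((z + h) * of_real (L y)) - ?g y - h * (?g y * of_real (L y)))
        = (\<lambda>y. ?g y * ?R h y)"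
        by (auto simp: distrib_right exp_add algebra_simps)
      finally have eq: "F (z + h) - F z - h * D = (\<integral>y. ?g y * ?R h y \<partial>M)" .
      have "norm (\<integral>y. ?g y * ?R h y \<partial>M) \<le> (\<integral>y. (norm h)\<^sup>2 * (2 / \<eta>\<^sup>2) * B y \<partial>M)"
      proof (rule norm_integral_le_integral)
        have "integrable M (\<lambda>y. G y * exp ((z + h) * of_real (L y)) - ?g y - h * (?g y * of_real (L y)))"
          using intF[OF zh] intF[OF z] intD by (intro Bochner_Integration.integrable_diff integrable_mult_right)
        then show "integrable M (\<lambda>y. ?g y * ?R h y)"
          by (simp add: distrib_right exp_add algebra_simps)
        show "integrable M (\<lambda>y. (norm h)\<^sup>2 * (2 / \<eta>\<^sup>2) * B y)" using B by (rule integrable_mult_right)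
        fix y
        have "norm (?g y * ?R h y)
          = norm (G y) * exp (Re z * L y) * norm (?R h y)"
          by (simp add: norm_mult)
        also have "\<dots> \<le> norm (G y) * exp (Re z * L y) * ((norm h)\<^sup>2 * (2 / \<eta>\<^sup>2 * (exp (2 * \<eta> * L y) + exp (- (2 * \<eta> * L y)))))"
          by (intro mult_left_mono exp_second_order_bound[OF h \<eta>(1)]) auto
        also have "\<dots> = (norm h)\<^sup>2 * (2 / \<eta>\<^sup>2) * (norm (G y) * (exp (Re z * L y) * exp (2 * \<eta> * L y)) + norm (G y) * (exp (Re z * L y) * exp (- (2 * \<eta> * L y))))"
          by (simp only: distrib_left mult_ac)
        also have "exp (Re z * L y) * exp (2 * \<eta> * L y) = exp ((Re z + 2 * \<eta>) * L y)"
          by (simp add: exp_add[symmetric] algebra_simps)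
        also have "exp (Re z * L y) * exp (- (2 * \<eta> * L y)) = exp ((Re z - 2 * \<eta>) * L y)"
          by (simp add: exp_add[symmetric] algebra_simps)
        finally show "norm (?g y * ?R h y) \<le> (norm h)\<^sup>2 * (2 / \<eta>\<^sup>2) * B y"
          by (simp only: B_def)
      qed
      also have "\<dots> = K * (norm h)\<^sup>2" by (simp add: K_def)
      finally show ?thesis unfolding eq .
    qed
    have "(F has_field_derivative D) (at z)"
      unfolding has_field_derivative_def has_derivative_at
    proof (intro conjI bounded_linear_mult_right)
      show "(\<lambda>h. norm (F (z + h) - F z - D * h) / norm h) \<midarrow>0\<rightarrow> 0"
      proof (rule Lim_null_comparison)
        show "\<forall>\<^sub>F h in at 0. norm (norm (F (z + h) - F z - D * h) / norm h) \<le> K * norm h"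
        proof (subst eventually_at, intro exI[of _ \<eta>] conjI \<eta> ballI impI)
          fix h :: complex assume "h \<noteq> 0 \<and> dist h 0 < \<eta>"
          then have h: "norm h \<le> \<eta>" "norm h > 0" by auto
          from est[OF h(1)] show "norm (norm (F (z + h) - F z - D * h) / norm h) \<le> K * norm h"
            using h(2) by (simp add: divide_le_eq power2_eq_square mult_ac)
        qed
        show "((\<lambda>h. K * norm h) \<longlongrightarrow> 0) (at (0::complex))"
          by (intro tendsto_mult_right_zero tendsto_norm_zero tendsto_ident_at)
      qed
    qed
    then show ?thesis by blast
  qed
  moreover have "open ?S"
    by (intro open_Collect_conj open_Collect_less continuous_intros)
  ultimately show ?thesis
    unfolding F_def[symmetric] by (auto simp: holomorphic_on_open field_differentiable_def)
qed

section \<open>Complex exponents: the normalising factor and uniqueness of the continuation\<close>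

lemma Gamma_real_nonzero: "x > 0 \<Longrightarrow> Gamma x \<noteq> (0 :: real)"
  using Gamma_real_pos[of x] by linarith

text \<open>Uses the entire function \<open>rGamma\<close>, so the factor is holomorphic at 0, where
  Gamma(z/2) has its pole and the factor a zero.\<close>

definition riesz_factor_complex :: "nat \<Rightarrow> complex \<Rightarrow> complex" where
  "riesz_factor_complex n z =
     Gamma ((of_nat n - z) / 2) * rGamma (z / 2) / (2 powr z * of_real (pi powr (n / 2)))"

text \<open>Valid for every \<open>z\<close>, including poles: \<open>Gamma\<close> is 0 there by
  convention, and so is the inverse of 0.\<close>

lemma inverse_riesz_const: "1 / riesz_const n z = riesz_factor_complex n z"
proof -
  have "1 / (a * b * c / d) = d * inverse c / (a * b)" for a b c d :: complex
    by (simp add: divide_inverse mult_ac)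
  then show ?thesis by (simp only: riesz_const_def riesz_factor_complex_def rGamma_inverse_Gamma)
qed

lemma riesz_factor_complex_of_real:
  "riesz_factor_complex n (of_real s) = of_real (riesz_factor n s)"
proof -
  have G: "Gamma ((of_nat n - of_real s) / 2 :: complex) = of_real (Gamma ((n - s) / 2))"
    by (simp flip: Gamma_complex_of_real)
  have R: "rGamma (of_real s / 2 :: complex) = of_real (inverse (Gamma (s / 2)))"
    by (simp add: rGamma_inverse_Gamma flip: Gamma_complex_of_real)
  have P: "(2 :: complex) powr of_real s = of_real (2 powr s)"
    using powr_of_real[of 2 s] by simp
  have "Gamma ((n - s) / 2) * inverse (Gamma (s / 2)) / (2 powr s * pi powr (n / 2)) = riesz_factor n s"
  proof -
    have "a * inverse b / (p * q) = a / (p * q * b)" for a b p q :: real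
      by (simp add: divide_inverse)
    then show ?thesis unfolding riesz_factor_def .
  qed
  then show ?thesis
    unfolding riesz_factor_complex_def G R P by (simp only: of_real_mult[symmetric] of_real_divide[symmetric])
qed

lemma half_complement_not_nonpos_Int:
  assumes "Re z < real n"
  shows "(of_nat n - z) / 2 \<notin> \<int>\<^sub>\<le>\<^sub>0"
proof
  assume "(of_nat n - z) / 2 \<in> \<int>\<^sub>\<le>\<^sub>0"
  then obtain m where m: "(of_nat n - z) / 2 = of_int m" "m \<le> 0" by (elim nonpos_Ints_cases)
  from m(1) have "Re ((of_nat n - z) / 2) = of_int m" by simp
  then have "Re ((of_nat n - z) / 2) \<le> 0" using m(2) by simp
  then show False using assms by simp
qed

lemma holomorphic_riesz_factor_complex:
  assumes "\<And>z. z \<in> S \<Longrightarrow> Re z < real n"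
  shows "riesz_factor_complex n holomorphic_on S"
  unfolding riesz_factor_complex_def using half_complement_not_nonpos_Int[OF assms]
  by (intro holomorphic_intros) auto

text \<open>At \<open>r = 0\<close> both sides are 0 because \<open>0 powr\<close> is 0, so the
  point \<open>y = x\<close> of the potential needs no separate treatment.\<close>

lemma powr_exp_ln:
  fixes r s d :: real
  assumes "r \<ge> 0"
  shows "r powr (- d) * exp (s * ln r) = r powr (s - d)"
  using assms by (cases "r = 0") (simp_all add: powr_def exp_add[symmetric] algebra_simps)

lemma complex_powr_exp_ln:
  fixes r :: real and z :: complex
  assumes "r \<ge> 0"
  shows "of_real r powr (z - of_nat d) = of_real (r powr (- real d)) * exp (z * of_real (ln r))"
proof (cases "r = 0")
  case False
  then have "r > 0" using assms by simp
  then have "of_real r powr (z - of_nat d) = exp ((z - of_nat d) * of_real (ln r))"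
    by (simp add: powr_def Ln_of_real)
  also have "\<dots> = exp (of_real (- real d * ln r)) * exp (z * of_real (ln r))"
    by (simp add: exp_add[symmetric] algebra_simps)
  also have "exp (of_real (- real d * ln r)) = complex_of_real (r powr (- real d))"
    using False unfolding exp_of_real by (simp add: powr_def)
  finally show ?thesis .
qed simp

lemma riesz_integral_exp:
  fixes g :: "real ^ 'n \<Rightarrow> complex"
  shows "riesz_integral z g x = riesz_factor_complex CARD('n) z *
    (\<integral>y. (dist x y powr (- real CARD('n)) *\<^sub>R g y) * exp (z * of_real (ln (dist x y))) \<partial>lborel)"
  unfolding riesz_integral_def inverse_riesz_const dist_norm[symmetric]
  by (simp add: complex_powr_exp_ln scaleR_conv_of_real mult_ac)

lemma scaleR_powr_exp_ln:
  fixes v :: complex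
  shows "(dist x y powr (- real d) *\<^sub>R v) * exp (of_real s * of_real (ln (dist x y))) = dist x y powr (s - d) *\<^sub>R v"
proof -
  have "exp (of_real s * of_real (ln (dist x y))) = complex_of_real (exp (s * ln (dist x y)))"
    by (simp flip: of_real_mult exp_of_real)
  then have "(dist x y powr (- real d) *\<^sub>R v) * exp (of_real s * of_real (ln (dist x y))) =
    of_real (dist x y powr (- real d) * exp (s * ln (dist x y))) * v"
    by (simp add: scaleR_conv_of_real)
  then show ?thesis by (simp only: powr_exp_ln[OF zero_le_dist] scaleR_conv_of_real)
qed

lemma riesz_integral_of_real:
  fixes g :: "real ^ 'n \<Rightarrow> complex"
  shows "riesz_integral (of_real s) g x = of_real (riesz_factor CARD('n) s) * kernel_potential s g x"
  by (simp only: riesz_integral_exp riesz_factor_complex_of_real kernel_potential_def scaleR_powr_exp_ln)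

lemma holomorphic_riesz_integral:
  fixes g :: "real ^ 'n \<Rightarrow> complex" and b :: real
  assumes g: "decays b B g" and b: "b \<le> CARD('n)"
  shows "(\<lambda>z. riesz_integral z g x) holomorphic_on {z. 0 < Re z \<and> Re z < b}"
  unfolding riesz_integral_exp
proof (intro holomorphic_on_mult holomorphic_riesz_factor_complex holomorphic_on_integral_exp)
  have [measurable]: "g \<in> borel_measurable borel" using g by (rule decays_measurable)
  show "(\<lambda>y. dist x y powr (- real CARD('n)) *\<^sub>R g y) \<in> borel_measurable lborel"
    "(\<lambda>y. ln (dist x y)) \<in> borel_measurable lborel" by measurable
  show "integrable lborel (\<lambda>y. norm (dist x y powr (- real CARD('n)) *\<^sub>R g y) * exp (s * ln (dist x y)))"
    if "0 < s" "s < b" for s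
  proof -
    have "norm (dist x y powr (- real CARD('n)) *\<^sub>R g y) * exp (s * ln (dist x y)) = norm (dist x y powr (s - CARD('n)) *\<^sub>R g y)" for y
      by (simp add: powr_exp_ln[symmetric] mult_ac)
    then show ?thesis using integrable_norm[OF integrable_riesz_decays[OF g that, of x]] by (simp only:)
  qed
qed (use b in auto)

text \<open>On the intersection of the two strips both functions agree with the potential near the
  imaginary axis on its right. The poles form a closed countable set, whose removal leaves an open
  strip connected, so the identity theorem applies.\<close>

lemma has_riesz_continuation_unique:
  fixes g :: "real ^ 'n \<Rightarrow> complex"
  assumes v: "has_riesz_continuation \<alpha> g x v" and w: "has_riesz_continuation \<alpha> g x w"
    and \<alpha>: "\<alpha> \<notin> riesz_poles CARD('n)"
  shows "v = w"
proof -
  let ?P = "riesz_poles CARD('n)"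
  from v obtain b c h where h: "0 < b" "c < 0" "c < Re \<alpha>" "Re \<alpha> < b"
    "h holomorphic_on ({z. c < Re z \<and> Re z < b} - ?P)"
    "\<And>z. 0 < Re z \<Longrightarrow> Re z < b \<Longrightarrow> z \<notin> ?P \<Longrightarrow> h z = riesz_integral z g x" "h \<alpha> = v"
    unfolding has_riesz_continuation_def by blast
  from w obtain b' c' h' where h': "0 < b'" "c' < 0" "c' < Re \<alpha>" "Re \<alpha> < b'"
    "h' holomorphic_on ({z. c' < Re z \<and> Re z < b'} - ?P)"
    "\<And>z. 0 < Re z \<Longrightarrow> Re z < b' \<Longrightarrow> z \<notin> ?P \<Longrightarrow> h' z = riesz_integral z g x" "h' \<alpha> = w"
    unfolding has_riesz_continuation_def by blast
  define B where "B = min b b'"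
  define C where "C = max c c'"
  define S where "S = {z. C < Re z \<and> Re z < B}"
  \<comment> \<open>Cut off at 1 because every pole has real part at least \<open>n\<close>, hence
    at least 1.\<close>
  define T where "T = {z. 0 < Re z \<and> Re z < min B 1}"
  have poles: "Re z \<ge> 1" if z: "z \<in> ?P" for z
  proof -
    have "real CARD('n) \<ge> 1" by (simp add: Suc_leI)
    moreover obtain j where "z = of_nat (CARD('n) + 2 * j)" using z unfolding riesz_poles_def by blast
    then have "Re z = real CARD('n) + 2 * real j" by simp
    ultimately show ?thesis by linarith
  qed
  have "countable ?P"
  proof -
    have "?P = range (\<lambda>j. of_nat (CARD('n) + 2 * j))" by (auto simp: riesz_poles_def)
    then show ?thesis by simp
  qed
  have "closed ?P"
  proof -
    have "?P \<subseteq> \<int>" by (auto simp: riesz_poles_def)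
    then show ?thesis by (rule closed_subset_Ints)
  qed
  have "open S" unfolding S_def by (intro open_Collect_conj open_Collect_less continuous_intros)
  have "open T" unfolding T_def by (intro open_Collect_conj open_Collect_less continuous_intros)
  have "convex S"
    unfolding S_def using convex_Int[OF convex_halfspace_Re_gt[of C] convex_halfspace_Re_lt[of B]]
    by (simp add: Collect_conj_eq)
  have "h \<alpha> = h' \<alpha>"
  proof (rule analytic_continuation_open[of T "S - ?P" h h' \<alpha>])
    show "open (S - ?P)" using \<open>open S\<close> \<open>closed ?P\<close> by (rule open_Diff)
    have "complex_of_real (min B 1 / 2) \<in> T" using h(1) h'(1) by (auto simp: T_def B_def)
    then show "T \<noteq> {}" by blast
    show "connected (S - ?P)"
      using \<open>open S\<close> \<open>convex S\<close> \<open>countable ?P\<close>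
      by (intro connected_open_diff_countable convex_connected) auto
    show "T \<subseteq> S - ?P" using poles h(2) h'(2) by (force simp: T_def S_def C_def)
    show "h holomorphic_on S - ?P" "h' holomorphic_on S - ?P"
      by (auto intro!: holomorphic_on_subset[OF h(5)] holomorphic_on_subset[OF h'(5)] simp: S_def B_def C_def)
    show "\<alpha> \<in> S - ?P" using \<alpha> h h' by (auto simp: S_def B_def C_def)
    show "h z = h' z" if "z \<in> T" for z
      using that poles[of z] h(6)[of z] h'(6)[of z] by (force simp: T_def B_def)
  qed (fact \<open>open T\<close>)
  then show ?thesis using h(7) h'(7) by simp
qed

section \<open>Continuation of the potential across exponent 0\<close>

lemma locally_Hoelder_at:
  fixes f :: "real ^ 'n \<Rightarrow> complex"
  assumes "locally_Hoelder f"
  obtains \<rho> \<epsilon> M where "0 < \<rho>" "\<rho> \<le> 1" "0 < \<epsilon>" "0 \<le> M"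
    "\<And>y. dist x y \<le> \<rho> \<Longrightarrow> norm (f y - f x) \<le> M * dist x y powr \<epsilon>"
proof -
  from assms obtain U \<epsilon> M where U: "open U" "x \<in> U" "0 < \<epsilon>" "0 < M"
    "\<forall>x1\<in>U. \<forall>x2\<in>U. norm (f x1 - f x2) \<le> M * norm (x1 - x2) powr \<epsilon>"
    unfolding locally_Hoelder_def by metis
  then obtain r where r: "r > 0" "cball x r \<subseteq> U" by (meson open_contains_cball)
  show thesis
  proof (rule that[of "min r 1" \<epsilon> M])
    fix y assume "dist x y \<le> min r 1"
    then have "y \<in> U" using r by auto
    then show "norm (f y - f x) \<le> M * dist x y powr \<epsilon>"
      using U by (metis dist_commute dist_norm)
  qed (use U r in auto)
qed

text \<open>On the ball the Hoelder bound improves the kernel exponent from \<open>s\<close> to s +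
  \<epsilon>, which is positive; off the ball the kernel is not singular and the decay of
  \<open>f\<close> suffices.\<close>

lemma integrable_Hoelder_difference:
  fixes f :: "real ^ 'n \<Rightarrow> complex" and a s :: real
  assumes f: "decays a A f" and a: "a > 0" and \<rho>: "0 < \<rho>" "\<rho> \<le> 1" and M: "0 \<le> M" 
    and H: "\<And>y. dist x y \<le> \<rho> \<Longrightarrow> norm (f y - f x) \<le> M * dist x y powr \<epsilon>"
    and s: "- \<epsilon> < s" "s < a"
  shows "integrable lborel (\<lambda>y. dist x y powr (s - CARD('n)) *\<^sub>R (f y - indicator (cball x \<rho>) y *\<^sub>R f x))"
proof (rule Bochner_Integration.integrable_bound)
  let ?n = "real CARD('n)"
  have [measurable]: "f \<in> borel_measurable borel" using f by (rule decays_measurable)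
  have A: "A \<ge> 0" using f by (simp add: decays_def)
  \<comment> \<open>On the ball the factor 2^q (1 + |x - y|)^(-q) is at least 1. Inserting it puts
    the majorant \<open>N\<close> into the form of \<open>integrable_riesz_weight\<close>, which
    needs \<open>q\<close> above s + \<epsilon>.\<close>
  define q where "q = s + \<epsilon> + 1"
  \<comment> \<open>A positive exponent below \<open>a\<close> and not below \<open>s\<close>. Where
    |x - y| exceeds \<rho>, passing from \<open>s\<close> to \<open>s'\<close> costs only the
    constant \<open>\<rho> powr (s - s')\<close>.\<close>
  define s' where "s' = max s (a / 2)"
  have s': "0 < s'" "s' < a" "s \<le> s'" using a s by (auto simp: s'_def)
  define N where "N y = M * 2 powr q * (dist x y powr (s + \<epsilon> - ?n) * (1 + dist x y) powr (- q))" for y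
  define R where "R y = A * (1 + norm x) powr a * \<rho> powr (s - s') * (dist x y powr (s' - ?n) * (1 + dist x y) powr (- a))" for y
  have N0: "N y \<ge> 0" and R0: "R y \<ge> 0" for y using M A by (simp_all add: N_def R_def)
  show "integrable lborel (\<lambda>y. N y + R y)"
    unfolding N_def R_def using s s' by (intro Bochner_Integration.integrable_add integrable_mult_right integrable_riesz_weight) (auto simp: q_def)
  show "(\<lambda>y. dist x y powr (s - ?n) *\<^sub>R (f y - indicator (cball x \<rho>) y *\<^sub>R f x)) \<in> borel_measurable lborel"
  proof -
    have [measurable]: "cball x \<rho> \<in> sets borel" by simp
    show ?thesis by measurable
  qed
  show "AE y in lborel. norm (dist x y powr (s - ?n) *\<^sub>R (f y - indicator (cball x \<rho>) y *\<^sub>R f x)) \<le> norm (N y + R y)"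
  proof (rule AE_I2)
    fix y
    have "norm (dist x y powr (s - ?n) *\<^sub>R (f y - indicator (cball x \<rho>) y *\<^sub>R f x)) \<le> N y + R y"
    proof (cases "dist x y \<le> \<rho>")
      case True
      have "norm (dist x y powr (s - ?n) *\<^sub>R (f y - indicator (cball x \<rho>) y *\<^sub>R f x)) = dist x y powr (s - ?n) * norm (f y - f x)"
        using True by simp
      also have "\<dots> \<le> dist x y powr (s - ?n) * (M * dist x y powr \<epsilon>)"
        using H[OF True] by (intro mult_left_mono) auto
      also have "\<dots> = M * dist x y powr (s + \<epsilon> - ?n) * 1" by (simp add: powr_add[symmetric] algebra_simps)
      also have "\<dots> \<le> M * dist x y powr (s + \<epsilon> - ?n) * (2 powr q * (1 + dist x y) powr (- q))"
      proof (intro mult_left_mono)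
        have "2 powr (- q) \<le> (1 + dist x y) powr (- q)"
          using True \<rho> s by (intro powr_mono2') (auto simp: q_def intro: add_pos_nonneg)
        then have "2 powr q * 2 powr (- q) \<le> 2 powr q * (1 + dist x y) powr (- q)" by (intro mult_left_mono) auto
        then show "1 \<le> 2 powr q * (1 + dist x y) powr (- q)" by (simp add: powr_add[symmetric])
      qed (use M in auto)
      also have "\<dots> = N y" by (simp add: N_def)
      finally show ?thesis using R0[of y] by linarith
    next
      case False
      then have d: "dist x y > \<rho>" by simp
      have "dist x y powr (s - ?n) = dist x y powr (s' - ?n) * dist x y powr (s - s')"
        by (simp add: powr_add[symmetric])
      also have "\<dots> \<le> dist x y powr (s' - ?n) * \<rho> powr (s - s')"
        using d \<rho> s' by (intro mult_left_mono powr_mono2') auto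
      finally have 1: "dist x y powr (s - ?n) \<le> dist x y powr (s' - ?n) * \<rho> powr (s - s')" .
      have "norm (dist x y powr (s - ?n) *\<^sub>R (f y - indicator (cball x \<rho>) y *\<^sub>R f x)) = dist x y powr (s - ?n) * norm (f y)"
        using d by simp
      also have "\<dots> \<le> (dist x y powr (s' - ?n) * \<rho> powr (s - s')) * (A * (1 + norm x) powr a * (1 + dist x y) powr (- a))"
        using decays_dist[OF f, of y x] 1 by (intro mult_mono) auto
      also have "\<dots> = R y" by (simp add: R_def)
      finally show ?thesis using N0[of y] by linarith
    qed
    then show "norm (dist x y powr (s - ?n) *\<^sub>R (f y - indicator (cball x \<rho>) y *\<^sub>R f x)) \<le> norm (N y + R y)"
      using N0[of y] R0[of y] by simp
  qed
qed

lemma integral_cball_powr: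
  fixes x :: "real ^ 'n" and s \<rho> :: real
  assumes s: "s > 0" and \<rho>: "\<rho> > 0"
  shows "has_bochner_integral lborel (\<lambda>y. dist x y powr (s - CARD('n)) * indicator (cball x \<rho>) y)
    (CARD('n) * unit_ball_vol CARD('n) * (\<rho> powr s / s))"
proof (rule has_bochner_integral_nn_integral)
  let ?n = "CARD('n)"
  let ?c = "?n * unit_ball_vol ?n"
  have [measurable]: "cball x \<rho> \<in> sets borel" by simp
  show "(\<lambda>y. dist x y powr (s - ?n) * indicator (cball x \<rho>) y) \<in> borel_measurable lborel" by measurable
  let ?F = "\<lambda>r. indicator {..\<rho>} r :: ennreal"
  have "(\<integral>\<^sup>+y. ennreal (dist x y powr (s - ?n) * indicator (cball x \<rho>) y) \<partial>lborel)
    = (\<integral>\<^sup>+y. ennreal (dist x y powr (s - ?n)) * ?F (dist x y) \<partial>lborel)"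
    by (intro nn_integral_cong) (auto simp: indicator_def)
  also have "\<dots> = ennreal ?c * (\<integral>\<^sup>+r\<in>{0<..}. ennreal (r powr (s - 1)) * ?F r \<partial>lborel)"
    by (rule nn_integral_polar_powr) measurable
  also have "(\<integral>\<^sup>+r\<in>{0<..}. ennreal (r powr (s - 1)) * ?F r \<partial>lborel) =
    (\<integral>\<^sup>+r. ennreal (indicator {0..\<rho>} r * r powr (s - 1)) \<partial>lborel)"
    by (intro nn_integral_cong) (auto simp: indicator_def)
  also have "\<dots> = ennreal (\<rho> powr (s - 1 + 1) / (s - 1 + 1))"
    using s \<rho> by (intro nn_integral_has_integral_lebesgue has_integral_powr_from_0) auto
  finally show "(\<integral>\<^sup>+y. ennreal (dist x y powr (s - ?n) * indicator (cball x \<rho>) y) \<partial>lborel) = ennreal (?c * (\<rho> powr s / s))"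
    using s by (simp add: ennreal_mult[symmetric])
qed (use s in auto)

text \<open>Subtracting \<open>f x\<close> on a small ball makes the integral converge for \<open>Re z > - \<epsilon>\<close>. The subtracted
  term is explicit, and its factor \<open>1 / z\<close> is absorbed by \<open>rGamma (z / 2)\<close>.\<close>
lemma riesz_integral_continuation:
  fixes f :: "real ^ 'n \<Rightarrow> complex" and a :: real
  assumes f: "decays a A f" and a: "0 < a" "a < CARD('n)" and H: "locally_Hoelder f"
  obtains \<epsilon> J where "\<epsilon> > 0" "J holomorphic_on {z. - \<epsilon> < Re z \<and> Re z < a}"
    "\<And>s. 0 < s \<Longrightarrow> s < a \<Longrightarrow> J (of_real s) = riesz_integral (of_real s) f x" "J 0 = f x"
proof -
  let ?n = "CARD('n)"
  let ?c = "?n * unit_ball_vol ?n"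
  obtain \<rho> \<epsilon> M where H: "0 < \<rho>" "\<rho> \<le> 1" "0 < \<epsilon>" "0 \<le> M"
    "\<And>y. dist x y \<le> \<rho> \<Longrightarrow> norm (f y - f x) \<le> M * dist x y powr \<epsilon>"
    using locally_Hoelder_at[OF H] by metis
  have [measurable]: "f \<in> borel_measurable borel" using f by (rule decays_measurable)
  have [measurable]: "cball x \<rho> \<in> sets borel" by simp
  define g where "g y = f y - indicator (cball x \<rho>) y *\<^sub>R f x" for y
  have [measurable]: "g \<in> borel_measurable borel" unfolding g_def by measurable
  define F where "F z = (\<integral>y. (dist x y powr (- real ?n) *\<^sub>R g y) * exp (z * of_real (ln (dist x y))) \<partial>lborel)" for z
  \<comment> \<open>The normalised potential of the indicator of the ball at its centre is the
    normalising factor times \<open>?c * \<rho> powr z / z\<close>. Here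
    \<open>rGamma (z / 2) / z\<close> is replaced by \<open>rGamma (z / 2 + 1) / 2\<close>, which is
    regular at 0.\<close>
  define E where "E z = Gamma ((of_nat ?n - z) / 2) / (2 powr z * of_real (pi powr (?n / 2))) *
    (of_real ?c * of_real \<rho> powr z) * (rGamma (z / 2 + 1) / 2)" for z :: complex
  let ?S = "{z. - \<epsilon> < Re z \<and> Re z < a}"
  have int: "integrable lborel (\<lambda>y. dist x y powr (s - ?n) *\<^sub>R g y)" if "- \<epsilon> < s" "s < a" for s
    unfolding g_def by (rule integrable_Hoelder_difference[OF f a(1) H(1,2,4,5) that])
  have holF: "F holomorphic_on ?S"
    unfolding F_def
  proof (rule holomorphic_on_integral_exp)
    fix s assume s: "- \<epsilon> < s" "s < a"
    have "norm (dist x y powr (- real ?n) *\<^sub>R g y) * exp (s * ln (dist x y)) = norm (dist x y powr (s - ?n) *\<^sub>R g y)" for y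
      by (simp add: powr_exp_ln[symmetric] mult_ac)
    then show "integrable lborel (\<lambda>y. norm (dist x y powr (- real ?n) *\<^sub>R g y) * exp (s * ln (dist x y)))"
      using integrable_norm[OF int[OF s]] by (simp only:)
  qed measurable
  have np: "Re z < real ?n" if "z \<in> ?S" for z using that a by simp
  have holE: "E holomorphic_on ?S"
    unfolding E_def using half_complement_not_nonpos_Int[OF np] by (intro holomorphic_intros) auto
  define J where "J z = riesz_factor_complex ?n z * F z + f x * E z" for z
  have holJ: "J holomorphic_on ?S"
    unfolding J_def by (intro holomorphic_intros holF holE holomorphic_riesz_factor_complex np)
  have J_real: "J (of_real s) = riesz_integral (of_real s) f x" if s: "0 < s" "s < a" for s
  proof -
    have "F (of_real s) = (\<integral>y. dist x y powr (s - ?n) *\<^sub>R g y \<partial>lborel)"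
    proof -
      have "(dist x y powr (- real ?n) *\<^sub>R g y) * exp (of_real s * of_real (ln (dist x y))) = dist x y powr (s - ?n) *\<^sub>R g y" for y
        by (rule scaleR_powr_exp_ln)
      then show ?thesis by (simp only: F_def)
    qed
    also have "\<dots> = (\<integral>y. dist x y powr (s - ?n) *\<^sub>R f y - (dist x y powr (s - ?n) * indicator (cball x \<rho>) y) *\<^sub>R f x \<partial>lborel)"
      by (simp add: g_def scaleR_diff_right)
    also have "\<dots> = kernel_potential s f x - (?c * (\<rho> powr s / s)) *\<^sub>R f x"
    proof -
      have i: "has_bochner_integral lborel (\<lambda>y. (dist x y powr (s - ?n) * indicator (cball x \<rho>) y) *\<^sub>R f x) ((?c * (\<rho> powr s / s)) *\<^sub>R f x)"
        using integral_cball_powr[OF s(1) H(1)] by (intro has_bochner_integral_scaleR_left)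
      have "has_bochner_integral lborel (\<lambda>y. dist x y powr (s - ?n) *\<^sub>R f y) (kernel_potential s f x)"
        unfolding kernel_potential_def using integrable_riesz_decays[OF f s] by (rule has_bochner_integral_integrable)
      from has_bochner_integral_diff[OF this i] show ?thesis by (rule has_bochner_integral_integral_eq)
    qed
    finally have F: "F (of_real s) = kernel_potential s f x - (?c * (\<rho> powr s / s)) *\<^sub>R f x" .
    have E: "E (of_real s) = riesz_factor_complex ?n (of_real s) * of_real (?c * (\<rho> powr s / s))"
    proof -
      have "rGamma (of_real s / 2 :: complex) = of_real s / 2 * rGamma (of_real s / 2 + 1)"
        by (rule rGamma_plus1[symmetric])
      then have "rGamma (of_real s / 2 + 1) / 2 = rGamma (of_real s / 2 :: complex) / of_real s"
        using s by simp
      moreover have "of_real \<rho> powr of_real s = complex_of_real (\<rho> powr s)" using H(1) by (simp add: powr_of_real)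
      moreover have "p / q * (c * r) * (u / w) = p * u / q * (c * (r / w))" for p q c r u w :: complex
        by (simp add: divide_inverse mult_ac)
      ultimately show ?thesis unfolding E_def riesz_factor_complex_def of_real_mult of_real_divide by (simp only:)
    qed
    show ?thesis
      unfolding J_def F E riesz_integral_of_real riesz_factor_complex_of_real
      by (simp add: scaleR_conv_of_real algebra_simps)
  qed
  \<comment> \<open>At 0 the factor in front of \<open>F\<close> vanishes since
    \<open>rGamma\<close> does, so only the subtracted term survives; \<open>E 0 = 1\<close> is the
    formula for the area of the unit sphere.\<close>
  have "J 0 = f x"
  proof -
    have "Gamma (?n / 2) \<noteq> 0" by (rule Gamma_real_nonzero) simp
    moreover have "?c = 2 * pi powr (?n / 2) / Gamma (?n / 2)" by (rule unit_ball_vol_times) simp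
    ultimately have "Gamma (?n / 2) / pi powr (?n / 2) * ?c / 2 = 1" by (simp add: field_simps)
    then have one: "complex_of_real (Gamma (?n / 2) / pi powr (?n / 2) * ?c / 2) = 1" by (simp only: of_real_1)
    have G: "Gamma (of_nat ?n / 2 :: complex) = of_real (Gamma (?n / 2))"
      by (simp flip: Gamma_complex_of_real)
    have "E 0 = Gamma (of_nat ?n / 2) / of_real (pi powr (?n / 2)) * of_real ?c / 2"
      using H(1) by (simp add: E_def rGamma_inverse_Gamma)
    also have "\<dots> = of_real (Gamma (?n / 2) / pi powr (?n / 2) * ?c / 2)"
      unfolding G by (simp only: of_real_mult of_real_divide of_real_numeral)
    finally have "E 0 = 1" unfolding one .
    then show ?thesis by (simp add: J_def riesz_factor_complex_def)
  qed
  then show thesis using H(3) holJ J_real by (intro that[of \<epsilon> J]) auto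
qed

subsection \<open>The inversion formula\<close>

text \<open>Carries the composition formula from real exponents to the strip demanded by
  \<open>has_riesz_continuation\<close>.\<close>

lemma holomorphic_eq_on_strip:
  fixes h k :: "complex \<Rightarrow> complex"
  assumes b: "0 < b" and h: "h holomorphic_on {z. 0 < Re z \<and> Re z < b}" and k: "k holomorphic_on {z. 0 < Re z \<and> Re z < b}"
    and eq: "\<And>s. 0 < s \<Longrightarrow> s < b \<Longrightarrow> h (of_real s) = k (of_real s)"
    and w: "0 < Re w" "Re w < b"
  shows "h w = k w"
proof -
  let ?S = "{z. 0 < Re z \<and> Re z < b}"
  let ?U = "complex_of_real ` {0<..<b}"
  have "h w - k w = 0"
  proof (rule analytic_continuation[of "\<lambda>z. h z - k z" ?S ?U "of_real (b / 2)"])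
    show "(\<lambda>z. h z - k z) holomorphic_on ?S" using h k by (rule holomorphic_on_diff)
    show "open ?S" by (intro open_Collect_conj open_Collect_less continuous_intros)
    have "convex ?S"
      using convex_Int[OF convex_halfspace_Re_gt[of 0] convex_halfspace_Re_lt[of b]]
      by (simp add: Collect_conj_eq)
    then show "connected ?S" by (rule convex_connected)
    have lim: "b / 2 islimpt {0<..<b}" using b by (intro interior_limit_point) auto
    show "complex_of_real (b / 2) islimpt ?U"
      unfolding islimpt_approachable
    proof (intro allI impI)
      fix e :: real assume "e > 0"
      then obtain t where "t \<in> {0<..<b}" "t \<noteq> b / 2" "dist t (b / 2) < e"
        using lim unfolding islimpt_approachable by blast
      then show "\<exists>z\<in>?U. z \<noteq> complex_of_real (b / 2) \<and> dist z (complex_of_real (b / 2)) < e"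
        by (intro bexI[of _ "complex_of_real t"] conjI imageI) (simp_all only: dist_of_real of_real_eq_iff not_False_eq_True)
    qed
  qed (use b w eq in auto)
  then show ?thesis by simp
qed

text \<open>The factor by which the dual transform of the plane transform exceeds the normalised
  potential of order \<open>k\<close>.\<close>

definition inversion_const :: "nat \<Rightarrow> nat \<Rightarrow> real" where
  "inversion_const n k = (4 * pi) powr (real k / 2) * (Gamma (real n / 2) / Gamma ((real n - real k) / 2))"

lemma riesz_density_eq:
  assumes "k > 0" "k < CARD('n)"
  shows "riesz_density k (x :: real ^ 'n) y =
    inversion_const CARD('n) k * riesz_factor CARD('n) k * dist x y powr (real k - CARD('n))"
proof -
  let ?n = "CARD('n)"
  define a where "a = Gamma (real k / 2)"
  define b where "b = Gamma (real ?n / 2)"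
  define c where "c = Gamma ((real ?n - real k) / 2)"
  have pos: "a > 0" "b > 0" "c > 0"
    using assms by (auto simp: a_def b_def c_def intro!: Gamma_real_pos)
  have k: "k * unit_ball_vol k = 2 * pi powr (k / 2) / a"
    using assms unfolding a_def by (intro unit_ball_vol_times) simp
  have n: "?n * unit_ball_vol ?n = 2 * pi powr (?n / 2) / b"
    unfolding b_def by (intro unit_ball_vol_times) simp
  \<comment> \<open>The power of 2 comes from H_n(k), the power of pi from the area of the unit
    sphere in dimension \<open>k\<close>; the remaining powers of pi and Gamma(k/2) cancel.\<close>
  have four: "(4 * pi) powr (k / 2) = 2 powr k * pi powr (k / 2)"
  proof -
    have "(4::real) powr (k / 2) = (2 powr 2) powr (k / 2)" by simp
    also have "\<dots> = 2 powr k" by (simp only: powr_powr) simp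
    finally show ?thesis by (simp add: powr_mult)
  qed
  have "k * unit_ball_vol k / (?n * unit_ball_vol ?n) = inversion_const ?n k * riesz_factor ?n k"
    unfolding k n inversion_const_def riesz_factor_def a_def[symmetric] b_def[symmetric] c_def[symmetric] four
    using pos by (simp add: field_simps)
  then show ?thesis by (simp add: riesz_density_def)
qed

lemma dual_plane_transform_potential:
  fixes f :: "real ^ 'n \<Rightarrow> complex"
  assumes f: "decays a A f" and n: "CARD('n) \<ge> 2" and k: "k > 0" "k < CARD('n)" and a: "a > real k"
  shows "dual_transform k (plane_transform f) =
    (\<lambda>x. of_real (inversion_const CARD('n) k * riesz_factor CARD('n) k) * kernel_potential k f x)"
proof
  fix x
  have "dual_transform k (plane_transform f) x = (\<integral>y. riesz_density k x y *\<^sub>R f y \<partial>lborel)"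
    using k by (intro dual_plane_transform[OF f n _ _ a]) auto
  also have "\<dots> = (\<integral>y. (inversion_const CARD('n) k * riesz_factor CARD('n) k) *\<^sub>R (dist x y powr (real k - CARD('n)) *\<^sub>R f y) \<partial>lborel)"
    by (simp add: riesz_density_eq[OF k])
  also have "\<dots> = (inversion_const CARD('n) k * riesz_factor CARD('n) k) *\<^sub>R kernel_potential k f x"
    unfolding kernel_potential_def by (rule integral_scaleR_right)
  finally show "dual_transform k (plane_transform f) x =
    of_real (inversion_const CARD('n) k * riesz_factor CARD('n) k) * kernel_potential k f x"
    by (simp only: scaleR_conv_of_real)
qed

lemma C_decay_cmult:
  assumes "f \<in> C_decay b"
  shows "(\<lambda>x. c * f x) \<in> C_decay b"
  using assms unfolding C_decay_def
  by (cases "c = 0") (auto intro!: continuous_intros simp: norm_mult)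

lemma kernel_potential_cmult:
  fixes f :: "real ^ 'a \<Rightarrow> complex"
  shows "kernel_potential s (\<lambda>x. c * f x) x = c * kernel_potential s f x"
proof -
  have "(\<lambda>y. dist x y powr (s - CARD('a)) *\<^sub>R (c * f y)) = (\<lambda>y. c * (dist x y powr (s - CARD('a)) *\<^sub>R f y))"
    by (simp only: mult_scaleR_right)
  then show ?thesis by (simp only: kernel_potential_def integral_mult_right_zero)
qed

lemma has_riesz_continuation_dual_plane_transform:
  fixes f :: "real ^ 'n \<Rightarrow> complex"
  assumes f: "f \<in> C_kn k" and n: "CARD('n) \<ge> 2" and k: "k > 0" "k < CARD('n)"
  shows "has_riesz_continuation (- of_nat k) (dual_transform k (plane_transform f)) x
    (of_real (inversion_const CARD('n) k) * f x)"
proof -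
  let ?n = "CARD('n)"
  let ?C = "inversion_const ?n k"
  from f obtain \<delta> where \<delta>: "\<delta> > 0" "f \<in> C_decay (real k + \<delta>)" and H: "locally_Hoelder f"
    by (auto simp: C_kn_def)
  \<comment> \<open>With \<open>b\<close> at most 1/2, \<open>a\<close> lies strictly between
    \<open>k\<close> and \<open>n\<close>: above \<open>k\<close> for convergence on planes, below
    \<open>n\<close> for composition and to avoid the poles. The dual transform then decays with
    exponent \<open>b\<close>.\<close>
  define b where "b = min \<delta> (1 / 2)"
  define a where "a = real k + b"
  have b: "0 < b" "b \<le> 1 / 2" "b \<le> \<delta>" using \<delta>(1) by (auto simp: b_def)
  have a: "a > real k" "a < ?n" "0 < a" "a - real k = b" using b k by (auto simp: a_def)
  obtain A0 where "decays (real k + \<delta>) A0 f" using C_decay_imp_decays[OF \<delta>(2)] \<delta>(1) by auto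
  then have dec: "decays a A0 f" by (rule decays_mono) (use a b in \<open>auto simp: a_def\<close>)
  define g where "g = dual_transform k (plane_transform f)"
  have g: "g = (\<lambda>x. of_real (?C * riesz_factor ?n k) * kernel_potential k f x)"
    unfolding g_def by (rule dual_plane_transform_potential[OF dec n k a(1)])
  have "kernel_potential k f \<in> C_decay b"
    using kernel_potential_C_decay[OF dec _ a(1) a(2)] k a(4) by simp
  then have g_decay: "g \<in> C_decay b" unfolding g by (rule C_decay_cmult)
  obtain B where B: "decays b B g" using C_decay_imp_decays[OF g_decay] b by auto
  obtain \<epsilon> J where J: "\<epsilon> > 0" "J holomorphic_on {z. - \<epsilon> < Re z \<and> Re z < a}"
    "\<And>s. 0 < s \<Longrightarrow> s < a \<Longrightarrow> J (of_real s) = riesz_integral (of_real s) f x" "J 0 = f x"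
    by (rule riesz_integral_continuation[OF dec a(3,2) H]) (rule that)
  \<comment> \<open>For real \<open>s\<close> in (0, b) this is the potential of \<open>g\<close> by
    the composition formula. It is holomorphic as long as \<open>z + of_nat k\<close> stays in the
    strip of \<open>J\<close>, and at \<open>- of_nat k\<close> it takes the value of
    \<open>J\<close> at 0.\<close>
  define h where "h z = of_real ?C * J (z + of_nat k)" for z
  have h_hol: "h holomorphic_on {z. - real k - \<epsilon> < Re z \<and> Re z < b}"
  proof -
    have "(\<lambda>z. J (z + of_nat k)) holomorphic_on {z. - real k - \<epsilon> < Re z \<and> Re z < b}"
      by (rule holomorphic_on_compose_gen[OF _ J(2), unfolded o_def])
        (auto intro!: holomorphic_intros simp: a_def)
    then show ?thesis unfolding h_def by (intro holomorphic_intros)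
  qed
  have h_real: "h (of_real s) = riesz_integral (of_real s) g x" if s: "0 < s" "s < b" for s
  proof -
    have "h (of_real s) = of_real ?C * J (of_real (s + real k))" by (simp add: h_def)
    also have "J (of_real (s + real k)) = of_real (riesz_factor ?n (s + real k)) * kernel_potential (s + real k) f x"
      using s a J(3)[of "s + real k"] by (simp add: riesz_integral_of_real[of "s + real k", simplified])
    also have "\<dots> = of_real (riesz_factor ?n s) * of_real (riesz_factor ?n k) * kernel_potential s (kernel_potential k f) x"
      using kernel_potential_composition[OF dec, of "real k" s x] s k a by simp
    also have "of_real ?C * \<dots> = riesz_integral (of_real s) g x"
      by (simp add: riesz_integral_of_real g kernel_potential_cmult)
    finally show ?thesis .
  qed
  have "h z = riesz_integral z g x" if "0 < Re z" "Re z < b" for z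
  proof (rule holomorphic_eq_on_strip[of b h "\<lambda>z. riesz_integral z g x", OF b(1)])
    show "h holomorphic_on {z. 0 < Re z \<and> Re z < b}"
      by (rule holomorphic_on_subset[OF h_hol]) (use J(1) in auto)
    show "(\<lambda>z. riesz_integral z g x) holomorphic_on {z. 0 < Re z \<and> Re z < b}"
      using B n b by (intro holomorphic_riesz_integral) auto
  qed (use h_real that in auto)
  moreover have "h (- of_nat k) = of_real ?C * f x" by (simp add: h_def J(4))
  moreover have "h holomorphic_on ({z. - real k - \<epsilon> < Re z \<and> Re z < b} - riesz_poles ?n)"
    using h_hol by (rule holomorphic_on_subset) auto
  ultimately show ?thesis
    unfolding has_riesz_continuation_def g_def[symmetric] using b J(1) k g_decay
    by (intro exI[of _ b] exI[of _ "- real k - \<epsilon>"] exI[of _ h]) auto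
qed

theorem theorem5p1:
  fixes f :: "real ^ 'n \<Rightarrow> complex" and k :: nat
  assumes "CARD('n) \<ge> 2"
    and "k \<in> {1..CARD('n) - 1}"
    and "f \<in> C_kn k"
  shows "\<forall>x.
    (\<exists>v. has_riesz_continuation (- of_nat k) (dual_transform k (plane_transform f)) x v) \<and>
    f x = of_real ((4 * pi) powr (- (real k / 2)) *
        (Gamma ((real CARD('n) - real k) / 2) / Gamma (real CARD('n) / 2))) *
      riesz_potential (- of_nat k) (dual_transform k (plane_transform f)) x"
proof
  fix x
  let ?n = "CARD('n)"
  let ?g = "dual_transform k (plane_transform f)"
  let ?v = "of_real (inversion_const ?n k) * f x"
  have k: "k > 0" "k < ?n" using assms(1,2) by auto
  have v: "has_riesz_continuation (- of_nat k) ?g x ?v"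
    by (rule has_riesz_continuation_dual_plane_transform[OF assms(3,1) k])
  \<comment> \<open>Off the poles the continuation is unique, which makes the description operator
    in \<open>riesz_potential\<close> return \<open>?v\<close>.\<close>
  have "- of_nat k \<notin> riesz_poles ?n"
  proof
    assume "- of_nat k \<in> riesz_poles ?n"
    then obtain j where "- of_nat k = (of_nat (?n + 2 * j) :: complex)" unfolding riesz_poles_def by blast
    then have "Re (- of_nat k) = Re (of_nat (?n + 2 * j))" by (rule arg_cong)
    then have "- real k = real (?n + 2 * j)" by simp
    then show False using k by linarith
  qed
  then have "(THE w. has_riesz_continuation (- of_nat k) ?g x w) = ?v"
    using v has_riesz_continuation_unique by (intro the_equality) blast+
  then have pot: "riesz_potential (- of_nat k) ?g x = ?v"
    by (simp add: riesz_potential_def)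
  let ?c = "(4 * pi) powr (- (real k / 2)) * (Gamma ((real ?n - real k) / 2) / Gamma (real ?n / 2))"
  have "?c * inversion_const ?n k = 1"
  proof -
    have "p * (u / v) * (q * (v / u)) = p * q" if "u \<noteq> 0" "v \<noteq> 0" for p q u v :: real
      using that by simp
    from this[OF Gamma_real_nonzero Gamma_real_nonzero]
    have "?c * inversion_const ?n k = (4 * pi) powr (- (real k / 2)) * (4 * pi) powr (real k / 2)"
      unfolding inversion_const_def using k by simp
    also have "\<dots> = 1" by (simp add: powr_add[symmetric])
    finally show ?thesis .
  qed
  then have "f x = of_real (?c * inversion_const ?n k) * f x" by (simp only: of_real_1 mult_1)
  also have "\<dots> = of_real ?c * riesz_potential (- of_nat k) ?g x"
    unfolding pot of_real_mult by (simp only: mult.assoc)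
  finally show "(\<exists>v. has_riesz_continuation (- of_nat k) ?g x v) \<and> f x = of_real ?c * riesz_potential (- of_nat k) ?g x"
    using v by blast
qed

end
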